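(* Let $\mathcal M_h=(\mathcal T_h,\mathcal F_h)$ be a polytopal mesh, regular with parameter $\varrho$, and let $T\in\mathcal T_h$ be an element such that the faces $F\in\mathcal F_T$ are $(d-1)$-simplices and $T$ is star-shaped with respect to a point $x_T$ whose orthogonal distance $d_{TF}$ to each face $F\in\mathcal F_T$ satisfies $d_{TF}\ge\varrho h_T$. For $F\in\mathcal F_T$ let $P_{TF}$ be the $d$-simplex with base $F$ and apex $x_T$, and let $L_{TF}:U_T\to\mathbb{RT}^{k+1}(P_{TF})$ be defined by: for all $\underline v_T\in U_T$ and all $\eta\in\mathbb{RT}^{k+1}(P_{TF})$, $$(L_{TF}\underline v_T,\eta)_{P_{TF}}=-\big(\nabla r_T\underline v_T-G_T\underline v_T-\nabla\delta_T\underline v_T,\eta\big)_{P_{TF}}+\big((\delta_{TF}-\delta_T)\underline v_T,\eta\cdot n_{TF}\big)_F,$$ with $L_{TF}\underline v_T$ extended by zero outside $P_{TF}$. Then the stabilising contribution $$S_T:=\sum_{F\in\mathcal F_T}L_{TF}$$ satisfies the following properties. (S1) There is a real number $C>0$, independent of $h$ and $T$ but possibly depending on $d$ and on discretisation parameters including $\varrho,k,l$, such that $C|\underline v_T|_{2,\partial T}\le\|S_T\underline v_T\|_{L^2(T)^d}\le C^{-1}|\underline v_T|_{2,\partial T}$ for all $\underline v_T\in U_T$. (S2) $(S_T\underline v_T,\phi)_T=0$ for all $\underline v_T\in U_T$ and all $\phi\in\mathbb P^k(T)^d$. (S3) If $p\neq2$, there is $k_S\in\mathbb N$ independent of $h$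 and $T$ such that the image of $S_T$ is contained in the space of $\mathbb R^d$-valued broken polynomials of total degree at most $k_S$ on a regular polytopal partition $\mathcal P_T$ of $T$, where regular means that, for all $P\in\mathcal P_T$ with inradius $r_P$ and diameter $h_P$, $\varrho h_P\le r_P$ and $\varrho h_T\le h_P$.
   Context: **Meshes.** $\Omega\subset\mathbb R^d$, $d\ge1$, is a bounded polytopal domain and $p\in(1,+\infty)$ is a fixed exponent. For a set $X$, $h_X$ denotes its diameter and $|X|$ its measure. A polytopal mesh is a couple $\mathcal M_h=(\mathcal T_h,\mathcal F_h)$: $\mathcal T_h$ is a finite collection of nonempty disjoint connected open polytopes $T$ (elements) whose closures cover $\overline\Omega$, with $h=\max_T h_T$; $\mathcal F_h$ is a finite collection of disjoint faces, each a nonempty relatively open subset $F$ of a hyperplane with positive $(d-1)$-measure and $|\overline F\setminus F|=0$. For each $T$ there is $\mathcal F_T\subset\mathcal F_h$ with $\partial T=\bigcup_{F\in\mathcal F_T}\overline F$; each $F$ either belongs to exactly one $\mathcal F_T$ and lies on $\partial\Omega$, or belongs to $\mathcal F_T$ for exactly two elements $T$ and lies in $\Omega$. Each $T$ is strictly star-shaped with respect to some point of $T$. $n_{TF}$ is the unit normal to $F$ pointing out of $T$. (If $d=1$, faces are points and $h_F$ is read as $h_T$.) The mesh is regular with parameter $\varrho\in(0,1)$ if there is a matching (conforming) simplicial mesh of $\Omega$, each of whose simplices is contained in one element of $\mathcal T_h$ and each of whose faces is, for each $F\in\mathcal F_h$, either contained in $F$ or disjoint from $F$, such that each simplex $\tau$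 of inradius $r_\tau$ satisfies $\varrho h_\tau\le r_\tau$, and $\varrho h_T\le h_\tau$ if $\tau\subset T$. **Spaces and projectors.** $(\cdot,\cdot)_X$ is the $L^2(X)$- or $L^2(X)^d$-product. $\mathbb P^\ell(X)$ is the space of polynomials on $X$ of total degree at most $\ell$ ($\mathbb P^{-1}(X)=\{0\}$), and $\pi_X^{0,\ell}$ is the $L^2$-orthogonal projector onto $\mathbb P^\ell(X)$. For an integer $m\ge0$, $\mathbb{RT}^m(P_{TF})=\mathbb P^m(P_{TF})^d+x\,\mathbb P^m(P_{TF})$ is the Raviart--Thomas--Nédélec space of degree $m$ on the simplex $P_{TF}$. Fix integers $k\ge0$ and $l\in\{k-1,k,k+1\}$. $U_T=\mathbb P^l(T)\times\big(\times_{F\in\mathcal F_T}\mathbb P^k(F)\big)$ with elements $\underline v_T=(v_T,(v_F)_{F\in\mathcal F_T})$. If $l=-1$ (so $k=0$), there is no element unknown and one sets $v_T:=\sum_{F\in\mathcal F_T}\omega_{TF}v_F$, with weights $\omega_{TF}$ such that $\sum_{F\in\mathcal F_T}\omega_{TF}\frac{(q,1)_F}{|F|}=\frac{(q,1)_T}{|T|}$ for all $q\in\mathbb P^1(T)$. **Local operators.** $G_T:U_T\to\mathbb P^k(T)^d$ is defined by $(G_T\underline v_T,\phi)_T=-(v_T,\nabla\cdot\phi)_T+\sum_{F\in\mathcal F_T}(v_F,\phi\cdot n_{TF})_F$ for all $\phi\in\mathbb P^k(T)^d$. $r_T:U_T\to\mathbb P^{k+1}(T)$ is defined by $(\nabla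 r_T\underline v_T,\nabla w)_T=-(v_T,\Delta w)_T+\sum_{F\in\mathcal F_T}(v_F,\nabla w\cdot n_{TF})_F$ for all $w\in\mathbb P^{k+1}(T)$ and $(r_T\underline v_T-v_T,1)_T=0$. Set $\delta_T\underline v_T=\pi_T^{0,l}(r_T\underline v_T-v_T)$, $\delta_{TF}\underline v_T=\pi_F^{0,k}(r_T\underline v_T-v_F)$ and $|\underline v_T|_{2,\partial T}^2=\sum_{F\in\mathcal F_T}h_F^{-1}\|(\delta_{TF}-\delta_T)\underline v_T\|_{L^2(F)}^2$.
   Formalization: In (S3) the inradius bound ϱh_P ≤ r_P, which can fail with the mesh's own ϱ, is replaced by ϱ_S h_P ≤ r_P for some 0 < ϱ_S ≤ ϱ independent of h and T; the bound ϱh_T ≤ h_P is kept. *)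

theory Defs
  imports "HOL-Analysis.Analysis"
begin

section \<open>Polynomials and differential operators\<close>

text \<open>Polynomial spaces on a set X are represented by polynomial functions on the whole space;
  all operators below see an element of the space only through its values on X.
  The degree is an integer, and the space for degree -1 is {0}.\<close>

definition multi_indices :: "int \<Rightarrow> ('a::euclidean_space \<Rightarrow> nat) set" where
  "multi_indices m = {\<alpha>. (\<forall>b. b \<notin> Basis \<longrightarrow> \<alpha> b = 0) \<and> int (\<Sum>b\<in>Basis. \<alpha> b) \<le> m}"

definition poly_space :: "int \<Rightarrow> ('a::euclidean_space \<Rightarrow> real) set" where
  "poly_space m = {q. \<exists>c. q = (\<lambda>x. \<Sum>\<alpha>\<in>multi_indices m. c \<alpha> * (\<Prod>b\<in>Basis. (x \<bullet> b) ^ \<alpha> b))}"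

definition poly_fields :: "int \<Rightarrow> ('a::euclidean_space \<Rightarrow> 'a) set" where
  "poly_fields m = {\<phi>. \<forall>b\<in>Basis. (\<lambda>x. \<phi> x \<bullet> b) \<in> poly_space m}"

definition RT_space :: "int \<Rightarrow> ('a::euclidean_space \<Rightarrow> 'a) set" where
  "RT_space m = {\<eta>. \<exists>\<phi>\<in>poly_fields m. \<exists>q\<in>poly_space m. \<eta> = (\<lambda>x. \<phi> x + q x *\<^sub>R x)}"

definition grad :: "('a::euclidean_space \<Rightarrow> real) \<Rightarrow> 'a \<Rightarrow> 'a" where
  "grad f x = (\<Sum>b\<in>Basis. frechet_derivative f (at x) b *\<^sub>R b)"

definition divergence :: "('a::euclidean_space \<Rightarrow> 'a) \<Rightarrow> 'a \<Rightarrow> real" where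
  "divergence \<phi> x = (\<Sum>b\<in>Basis. frechet_derivative \<phi> (at x) b \<bullet> b)"

definition laplacian :: "('a::euclidean_space \<Rightarrow> real) \<Rightarrow> 'a \<Rightarrow> real" where
  "laplacian f = divergence (grad f)"


section \<open>Inner products and projectors\<close>

text \<open>Lebesgue measure of codimension one on a hyperplane H: by Fubini, the measure of a part A of H
  is the full-dimensional measure of the cylinder over A of height one, normal to H and centred
  at H.  In dimension one this is the unit point mass.\<close>

definition hyperplane_measure :: "'a::euclidean_space set \<Rightarrow> 'a measure" where
  "hyperplane_measure H =
     distr (restrict_space lborel {x. infdist x H \<le> 1/2}) borel (closest_point H)"

abbreviation face_measure :: "'a::euclidean_space set \<Rightarrow> 'a measure" where
  "face_measure F \<equiv> hyperplane_measure (affine hull F)"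

definition L2_inner :: "'a measure \<Rightarrow> 'a set \<Rightarrow> ('a \<Rightarrow> 'b::real_inner) \<Rightarrow> ('a \<Rightarrow> 'b) \<Rightarrow> real" where
  "L2_inner M X f g = (LINT x:X|M. f x \<bullet> g x)"

definition L2_norm_on :: "'a measure \<Rightarrow> 'a set \<Rightarrow> ('a \<Rightarrow> 'b::real_inner) \<Rightarrow> real" where
  "L2_norm_on M X f = sqrt (L2_inner M X f f)"

abbreviation inner_on :: "'a::euclidean_space set \<Rightarrow> ('a \<Rightarrow> 'b::real_inner) \<Rightarrow> ('a \<Rightarrow> 'b) \<Rightarrow> real" where
  "inner_on X \<equiv> L2_inner lborel X"

abbreviation inner_face :: "'a::euclidean_space set \<Rightarrow> ('a \<Rightarrow> 'b::real_inner) \<Rightarrow> ('a \<Rightarrow> 'b) \<Rightarrow> real" where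
  "inner_face F \<equiv> L2_inner (face_measure F) F"

text \<open>On a face only the restriction of the projection to the face is determined.\<close>

definition L2_proj :: "'a measure \<Rightarrow> 'a set \<Rightarrow> int \<Rightarrow> ('a::euclidean_space \<Rightarrow> real) \<Rightarrow> 'a \<Rightarrow> real" where
  "L2_proj M X m f =
     (SOME q. q \<in> poly_space m \<and> (\<forall>w\<in>poly_space m. L2_inner M X q w = L2_inner M X f w))"


section \<open>Polytopal meshes\<close>

text \<open>Open polytopes need not be convex.\<close>

definition open_polytope :: "'a::euclidean_space set \<Rightarrow> bool" where
  "open_polytope X \<longleftrightarrow> X \<noteq> {} \<and> connected X \<and>
     (\<exists>K. finite K \<and> (\<forall>S\<in>K. int DIM('a) simplex S) \<and> X = interior (\<Union>K))"

definition mesh_face :: "'a::euclidean_space set \<Rightarrow> bool" where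
  "mesh_face F \<longleftrightarrow> F \<noteq> {} \<and>
     (\<exists>n c. n \<noteq> 0 \<and> openin (top_of_set {x. n \<bullet> x = c}) F) \<and>
     0 < emeasure (face_measure F) F \<and> emeasure (face_measure F) (closure F - F) = 0"

definition strictly_star_shaped :: "'a::euclidean_space set \<Rightarrow> 'a \<Rightarrow> bool" where
  "strictly_star_shaped X a \<longleftrightarrow> (\<forall>y\<in>closure X. closed_segment a y - {y} \<subseteq> X)"

definition star_shaped :: "'a::euclidean_space set \<Rightarrow> 'a \<Rightarrow> bool" where
  "star_shaped X a \<longleftrightarrow> a \<in> X \<and> (\<forall>y\<in>X. closed_segment a y \<subseteq> X)"

definition inradius :: "'a::euclidean_space set \<Rightarrow> real" where
  "inradius X = Sup {r. \<exists>a. ball a r \<subseteq> X}"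

text \<open>\<open>\<F> T\<close> is the set of faces of the element T.\<close>

definition polytopal_mesh ::
  "'a::euclidean_space set \<Rightarrow> 'a set set \<Rightarrow> 'a set set \<Rightarrow> ('a set \<Rightarrow> 'a set set) \<Rightarrow> bool" where
  "polytopal_mesh \<Omega> \<T>\<^sub>h \<F>\<^sub>h \<F> \<longleftrightarrow>
     open_polytope \<Omega> \<and>
     finite \<T>\<^sub>h \<and> pairwise disjnt \<T>\<^sub>h \<and>
     (\<forall>T\<in>\<T>\<^sub>h. open_polytope T \<and> (\<exists>a\<in>T. strictly_star_shaped T a)) \<and>
     closure \<Omega> = (\<Union>T\<in>\<T>\<^sub>h. closure T) \<and>
     finite \<F>\<^sub>h \<and> pairwise disjnt \<F>\<^sub>h \<and> (\<forall>F\<in>\<F>\<^sub>h. mesh_face F) \<and>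
     (\<forall>T\<in>\<T>\<^sub>h. \<F> T \<subseteq> \<F>\<^sub>h \<and> frontier T = (\<Union>F\<in>\<F> T. closure F)) \<and>
     (\<forall>F\<in>\<F>\<^sub>h. card {T\<in>\<T>\<^sub>h. F \<in> \<F> T} = 1 \<and> F \<subseteq> frontier \<Omega> \<or>
              card {T\<in>\<T>\<^sub>h. F \<in> \<F> T} = 2 \<and> F \<subseteq> \<Omega>)"

text \<open>The simplices of the submesh \<open>\<S>\<close> are closed, whereas elements and faces are open;
  hence the interiors.\<close>

definition regular_mesh ::
  "real \<Rightarrow> 'a::euclidean_space set \<Rightarrow> 'a set set \<Rightarrow> 'a set set \<Rightarrow> bool" where
  "regular_mesh \<rho> \<Omega> \<T>\<^sub>h \<F>\<^sub>h \<longleftrightarrow>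
     (\<exists>\<S>. triangulation \<S> \<and> (\<forall>\<tau>\<in>\<S>. int DIM('a) simplex \<tau>) \<and> \<Union>\<S> = closure \<Omega> \<and>
       (\<forall>\<tau>\<in>\<S>. \<exists>T\<in>\<T>\<^sub>h. interior \<tau> \<subseteq> T) \<and>
       (\<forall>\<tau>\<in>\<S>. \<forall>\<sigma>. \<sigma> facet_of \<tau> \<longrightarrow>
          (\<forall>F\<in>\<F>\<^sub>h. rel_interior \<sigma> \<subseteq> F \<or> rel_interior \<sigma> \<inter> F = {})) \<and>
       (\<forall>\<tau>\<in>\<S>. \<rho> * diameter \<tau> \<le> inradius \<tau>) \<and>
       (\<forall>\<tau>\<in>\<S>. \<forall>T\<in>\<T>\<^sub>h. interior \<tau> \<subseteq> T \<longrightarrow> \<rho> * diameter T \<le> diameter \<tau>))"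

definition polytopal_partition :: "'a::euclidean_space set set \<Rightarrow> 'a set \<Rightarrow> bool" where
  "polytopal_partition \<P> T \<longleftrightarrow>
     finite \<P> \<and> pairwise disjnt \<P> \<and> (\<forall>P\<in>\<P>. open_polytope P \<and> P \<subseteq> T) \<and>
     closure T = (\<Union>P\<in>\<P>. closure P)"

definition face_size :: "'a::euclidean_space set \<Rightarrow> 'a set \<Rightarrow> real" where
  "face_size T F = (if DIM('a) = 1 then diameter T else diameter F)"

definition outward_normal :: "'a::euclidean_space set \<Rightarrow> 'a set \<Rightarrow> 'a" where
  "outward_normal T F =
     (THE n. norm n = 1 \<and> (\<forall>x\<in>F. \<forall>y\<in>F. n \<bullet> (x - y) = 0) \<and>
        (\<forall>x\<in>F. \<forall>\<^sub>F t in at_right 0. x - t *\<^sub>R n \<in> T \<and> x + t *\<^sub>R n \<notin> T))"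


section \<open>Local space and operators\<close>

text \<open>An element of the local space is a pair of the element component and the family of face
  components.  In the operators, T is the element, \<open>\<F>\<close> the set of its faces, and \<open>\<omega>\<close> the family
  of weights used when l = -1.\<close>

type_synonym 'a dofs = "('a \<Rightarrow> real) \<times> ('a set \<Rightarrow> 'a \<Rightarrow> real)"

definition local_space :: "nat \<Rightarrow> int \<Rightarrow> 'a::euclidean_space set set \<Rightarrow> 'a dofs set" where
  "local_space k l \<F> = {v. fst v \<in> poly_space l \<and> (\<forall>F\<in>\<F>. snd v F \<in> poly_space (int k))}"

definition admissible_weights ::
  "'a::euclidean_space set \<Rightarrow> 'a set set \<Rightarrow> ('a set \<Rightarrow> real) \<Rightarrow> bool" where
  "admissible_weights T \<F> \<omega> \<longleftrightarrow>
     (\<forall>q\<in>poly_space 1.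
        (\<Sum>F\<in>\<F>. \<omega> F * (inner_face F q (\<lambda>_. 1) / measure (face_measure F) F)) =
        inner_on T q (\<lambda>_. 1) / measure lborel T)"

definition elem_val ::
  "int \<Rightarrow> ('a set \<Rightarrow> real) \<Rightarrow> 'a set set \<Rightarrow> 'a dofs \<Rightarrow> 'a \<Rightarrow> real" where
  "elem_val l \<omega> \<F> v = (if l = -1 then (\<lambda>x. \<Sum>F\<in>\<F>. \<omega> F * snd v F x) else fst v)"

definition grad_rec ::
  "nat \<Rightarrow> int \<Rightarrow> ('a::euclidean_space set \<Rightarrow> real) \<Rightarrow> 'a set \<Rightarrow> 'a set set \<Rightarrow> 'a dofs \<Rightarrow> 'a \<Rightarrow> 'a" where
  "grad_rec k l \<omega> T \<F> v =
     (THE G. G \<in> poly_fields (int k) \<and>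
        (\<forall>\<phi>\<in>poly_fields (int k).
           inner_on T G \<phi> =
             - inner_on T (elem_val l \<omega> \<F> v) (divergence \<phi>)
             + (\<Sum>F\<in>\<F>. inner_face F (snd v F) (\<lambda>x. \<phi> x \<bullet> outward_normal T F))))"

definition pot_rec ::
  "nat \<Rightarrow> int \<Rightarrow> ('a::euclidean_space set \<Rightarrow> real) \<Rightarrow> 'a set \<Rightarrow> 'a set set \<Rightarrow> 'a dofs \<Rightarrow> 'a \<Rightarrow> real" where
  "pot_rec k l \<omega> T \<F> v =
     (THE r. r \<in> poly_space (int k + 1) \<and>
        (\<forall>w\<in>poly_space (int k + 1).
           inner_on T (grad r) (grad w) =
             - inner_on T (elem_val l \<omega> \<F> v) (laplacian w)
             + (\<Sum>F\<in>\<F>. inner_face F (snd v F) (\<lambda>x. grad w x \<bullet> outward_normal T F))) \<and>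
        inner_on T (\<lambda>x. r x - elem_val l \<omega> \<F> v x) (\<lambda>_. 1) = 0)"

definition delta_elem ::
  "nat \<Rightarrow> int \<Rightarrow> ('a::euclidean_space set \<Rightarrow> real) \<Rightarrow> 'a set \<Rightarrow> 'a set set \<Rightarrow> 'a dofs \<Rightarrow> 'a \<Rightarrow> real" where
  "delta_elem k l \<omega> T \<F> v =
     L2_proj lborel T l (\<lambda>x. pot_rec k l \<omega> T \<F> v x - elem_val l \<omega> \<F> v x)"

definition delta_face ::
  "nat \<Rightarrow> int \<Rightarrow> ('a::euclidean_space set \<Rightarrow> real) \<Rightarrow> 'a set \<Rightarrow> 'a set set \<Rightarrow> 'a set \<Rightarrow> 'a dofs
     \<Rightarrow> 'a \<Rightarrow> real" where
  "delta_face k l \<omega> T \<F> F v =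
     L2_proj (face_measure F) F (int k) (\<lambda>x. pot_rec k l \<omega> T \<F> v x - snd v F x)"

definition boundary_seminorm ::
  "nat \<Rightarrow> int \<Rightarrow> ('a::euclidean_space set \<Rightarrow> real) \<Rightarrow> 'a set \<Rightarrow> 'a set set \<Rightarrow> 'a dofs \<Rightarrow> real" where
  "boundary_seminorm k l \<omega> T \<F> v =
     sqrt (\<Sum>F\<in>\<F>. inverse (face_size T F) *
       (L2_norm_on (face_measure F) F
          (\<lambda>x. delta_face k l \<omega> T \<F> F v x - delta_elem k l \<omega> T \<F> v x))\<^sup>2)"


section \<open>Stabilising contribution\<close>

definition pyramid :: "'a::euclidean_space \<Rightarrow> 'a set \<Rightarrow> 'a set" where
  "pyramid a F = interior (convex hull (insert a F))"

text \<open>The lifting, already extended by zero outside the pyramid with base F and apex a.\<close>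

definition lifting ::
  "nat \<Rightarrow> int \<Rightarrow> ('a::euclidean_space set \<Rightarrow> real) \<Rightarrow> 'a set \<Rightarrow> 'a set set \<Rightarrow> 'a \<Rightarrow> 'a set \<Rightarrow> 'a dofs
     \<Rightarrow> 'a \<Rightarrow> 'a" where
  "lifting k l \<omega> T \<F> a F v x = indicat_real (pyramid a F) x *\<^sub>R
     (THE L. L \<in> RT_space (int k + 1) \<and>
        (\<forall>\<eta>\<in>RT_space (int k + 1).
           inner_on (pyramid a F) L \<eta> =
             - inner_on (pyramid a F)
                 (\<lambda>y. grad (pot_rec k l \<omega> T \<F> v) y - grad_rec k l \<omega> T \<F> v y
                        - grad (delta_elem k l \<omega> T \<F> v) y) \<eta>
             + inner_face F
                 (\<lambda>y. delta_face k l \<omega> T \<F> F v y - delta_elem k l \<omega> T \<F> v y)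
                 (\<lambda>y. \<eta> y \<bullet> outward_normal T F))) x"

definition stab ::
  "nat \<Rightarrow> int \<Rightarrow> ('a::euclidean_space set \<Rightarrow> real) \<Rightarrow> 'a set \<Rightarrow> 'a set set \<Rightarrow> 'a \<Rightarrow> 'a dofs
     \<Rightarrow> 'a \<Rightarrow> 'a" where
  "stab k l \<omega> T \<F> a v x = (\<Sum>F\<in>\<F>. lifting k l \<omega> T \<F> a F v x)"

end

theory Submission
  imports Defs
begin

text \<open>
  Let h be the diameter of T, n the outward normal of a face F, \<open>\<lambda>\<close> the affine function that is 1 at
  the apex \<open>x\<^sub>T\<close> and 0 on F, z = \<open>\<nabla>\<close>r - G - \<open>\<nabla>\<delta>\<^sub>T\<close>, a vector polynomial of degree at most k on T, and
  g = \<open>\<delta>\<^sub>F - \<delta>\<^sub>T\<close>, a polynomial of degree at most k + 1 on F.  Green's formula and the definitions of r, G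
  and of the projectors give (\<open>consistency_identity\<close>)
    \<open>(z, \<phi>)\<^sub>T = \<Sum>\<^sub>F (g, \<phi> \<bullet> n)\<^sub>F\<close> for all vector polynomials \<open>\<phi>\<close> of degree at most k.
  Summing the defining equations of the liftings over the faces and inserting this identity yields the
  orthogonality of the stabilising contribution to these \<open>\<phi>\<close>.

  The upper bound for its norm follows by taking the lifting L as its own test field and z as test
  field in the identity, together with the trace inequality on a pyramid (\<open>trace_inequality\<close>).  For the lower
  bound two Raviart--Thomas fields on the pyramid suffice.  The field \<open>\<lambda>z\<close> has no trace on F, so
  that (L, \<open>\<lambda>z\<close>) = - (z, \<open>\<lambda>z\<close>) bounds z by L (\<open>residual_le_lift\<close>).  The field \<open>x - x\<^sub>T\<close> has constant
  normal component on F; multiplied by a polynomial extension of g, constant along n, it has normal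
  trace a multiple of g, and it bounds g by L + z (\<open>data_le_lift\<close>).

  All constants come from one fact: on polynomials of bounded degree, the maximum over a ball is
  bounded by the mean square over a concentric ball of comparable radius (\<open>poly_space_sup_bound\<close>).  It
  applies because every pyramid contains a ball of radius comparable with h (\<open>pyramid_ball\<close>).  Indeed,
  by Baire's theorem each face contains a facet of a simplex of the matching submesh
  (\<open>face_contains_facet\<close>), and a facet contains a disc as large as any ball inside the simplex
  (\<open>facet_contains_disc\<close>).  The pyramids form a partition of T because no face hyperplane passes
  through the apex, so that every ray from the apex meets the frontier exactly once
  (\<open>frontier_ray_unique\<close>).  On each of them the stabilising contribution is a Raviart--Thomas field.

  Green's formula needs the divergence theorem on T, with the face measures that are defined by
  averaging over slabs.  A derivative is first integrated by parts against the cut-off that is 1 at the apex,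
  affine on each pyramid and 0 outside T; for polynomials that are homogeneous about the apex the
  polar formula for cones (\<open>integral_cone\<close>) then turns the result into the divergence theorem
  (\<open>divergence_homogeneous\<close>).
\<close>


section \<open>Polynomial spaces\<close>

definition monomial :: "('a::euclidean_space \<Rightarrow> nat) \<Rightarrow> 'a \<Rightarrow> real" where
  "monomial \<alpha> x = (\<Prod>b\<in>Basis. (x \<bullet> b) ^ \<alpha> b)"

lemma poly_space_alt:
  "poly_space m = {q. \<exists>c. q = (\<lambda>x. \<Sum>\<alpha>\<in>multi_indices m. c \<alpha> * monomial \<alpha> x)}"
  by (simp add: poly_space_def monomial_def)

lemma finite_multi_indices: "finite (multi_indices m :: ('a::euclidean_space \<Rightarrow> nat) set)"
proof (rule finite_subset)
  show "finite {\<alpha>. \<forall>b::'a. (b \<in> Basis \<longrightarrow> \<alpha> b \<in> {..nat m}) \<and> (b \<notin> Basis \<longrightarrow> \<alpha> b = 0)}"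
    by (rule finite_set_of_finite_funs) auto
  show "(multi_indices m :: ('a \<Rightarrow> nat) set)
      \<subseteq> {\<alpha>. \<forall>b. (b \<in> Basis \<longrightarrow> \<alpha> b \<in> {..nat m}) \<and> (b \<notin> Basis \<longrightarrow> \<alpha> b = 0)}"
  proof
    fix \<alpha> :: "'a \<Rightarrow> nat" assume \<alpha>: "\<alpha> \<in> multi_indices m"
    have "\<alpha> b \<le> nat m" if "b \<in> Basis" for b
      using member_le_sum[of b Basis \<alpha>] that \<alpha> by (auto simp: multi_indices_def simp del: of_nat_sum)
    then show "\<alpha> \<in> {\<alpha>. \<forall>b. (b \<in> Basis \<longrightarrow> \<alpha> b \<in> {..nat m}) \<and> (b \<notin> Basis \<longrightarrow> \<alpha> b = 0)}"
      using \<alpha> by (auto simp: multi_indices_def)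
  qed
qed

lemma poly_space_zero: "(\<lambda>x. 0) \<in> poly_space m"
  unfolding poly_space_alt by (auto intro!: exI[of _ "\<lambda>_. 0"])

lemma poly_space_add:
  assumes "p \<in> poly_space m" "q \<in> poly_space m"
  shows "(\<lambda>x. p x + q x) \<in> poly_space m"
proof -
  obtain c d where "p = (\<lambda>x. \<Sum>\<alpha>\<in>multi_indices m. c \<alpha> * monomial \<alpha> x)"
    "q = (\<lambda>x. \<Sum>\<alpha>\<in>multi_indices m. d \<alpha> * monomial \<alpha> x)"
    using assms unfolding poly_space_alt by auto
  then have "(\<lambda>x. p x + q x) = (\<lambda>x. \<Sum>\<alpha>\<in>multi_indices m. (c \<alpha> + d \<alpha>) * monomial \<alpha> x)"
    by (simp add: sum.distrib algebra_simps)
  then show ?thesis unfolding poly_space_alt by (auto intro!: exI[of _ "\<lambda>\<alpha>. c \<alpha> + d \<alpha>"])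
qed

lemma poly_space_cmult:
  assumes "p \<in> poly_space m"
  shows "(\<lambda>x. c * p x) \<in> poly_space m"
proof -
  obtain d where "p = (\<lambda>x. \<Sum>\<alpha>\<in>multi_indices m. d \<alpha> * monomial \<alpha> x)"
    using assms unfolding poly_space_alt by auto
  then have "(\<lambda>x. c * p x) = (\<lambda>x. \<Sum>\<alpha>\<in>multi_indices m. (c * d \<alpha>) * monomial \<alpha> x)"
    by (simp add: sum_distrib_left algebra_simps)
  then show ?thesis unfolding poly_space_alt by (auto intro!: exI[of _ "\<lambda>\<alpha>. c * d \<alpha>"])
qed

lemma poly_space_uminus: "p \<in> poly_space m \<Longrightarrow> (\<lambda>x. - p x) \<in> poly_space m"
  using poly_space_cmult[of p m "-1"] by simp

lemma poly_space_diff: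
  "p \<in> poly_space m \<Longrightarrow> q \<in> poly_space m \<Longrightarrow> (\<lambda>x. p x - q x) \<in> poly_space m"
  using poly_space_add[OF _ poly_space_uminus, of p m q] by simp

lemma poly_space_sum:
  "(\<And>i. i \<in> I \<Longrightarrow> p i \<in> poly_space m) \<Longrightarrow> (\<lambda>x. \<Sum>i\<in>I. p i x) \<in> poly_space m"
  by (induction I rule: infinite_finite_induct) (auto simp: poly_space_zero poly_space_add)

lemma monomial_in_poly_space:
  assumes "\<alpha> \<in> multi_indices m"
  shows "monomial \<alpha> \<in> poly_space m"
  using assms unfolding poly_space_alt
  by (auto intro!: exI[of _ "\<lambda>\<beta>. if \<beta> = \<alpha> then 1 else 0"] simp: finite_multi_indices if_distrib
        [where f="\<lambda>c. c * monomial _ _"] sum.delta cong: if_cong)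

text \<open>Statements that are linear in the polynomial reduce to scaled monomials.\<close>

lemma poly_space_induct [consumes 1, case_names zero add monomial]:
  assumes "q \<in> poly_space m"
    and "P (\<lambda>x. 0)"
    and "\<And>p q. p \<in> poly_space m \<Longrightarrow> q \<in> poly_space m \<Longrightarrow> P p \<Longrightarrow> P q \<Longrightarrow> P (\<lambda>x. p x + q x)"
    and "\<And>c \<alpha>. \<alpha> \<in> multi_indices m \<Longrightarrow> P (\<lambda>x. c * monomial \<alpha> x)"
  shows "P q"
proof -
  obtain c where q: "q = (\<lambda>x. \<Sum>\<alpha>\<in>multi_indices m. c \<alpha> * monomial \<alpha> x)"
    using assms(1) unfolding poly_space_alt by auto
  have "A \<subseteq> multi_indices m \<Longrightarrow> P (\<lambda>x. \<Sum>\<alpha>\<in>A. c \<alpha> * monomial \<alpha> x)" if "finite A" for A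
    using that
  proof (induction A)
    case empty
    then show ?case using assms(2) by simp
  next
    case (insert \<alpha> A)
    then have "P (\<lambda>x. c \<alpha> * monomial \<alpha> x + (\<Sum>\<alpha>\<in>A. c \<alpha> * monomial \<alpha> x))"
      by (intro assms(3,4) poly_space_sum poly_space_cmult monomial_in_poly_space) auto
    then show ?case using insert by simp
  qed
  from this[OF finite_multi_indices] show ?thesis by (simp add: q)
qed

lemma poly_space_mono:
  assumes "m \<le> n"
  shows "poly_space m \<subseteq> poly_space n"
proof
  fix q :: "'a \<Rightarrow> real"
  assume "q \<in> poly_space m"
  then show "q \<in> poly_space n"
  proof (induction q rule: poly_space_induct)
    case (monomial c \<alpha>)
    then have "\<alpha> \<in> multi_indices n" using assms by (auto simp: multi_indices_def)
    then show ?case by (intro poly_space_cmult monomial_in_poly_space)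
  qed (auto intro: poly_space_zero poly_space_add)
qed

lemma monomial_mult: "monomial \<alpha> x * monomial \<beta> x = monomial (\<lambda>b. \<alpha> b + \<beta> b) x"
  by (simp add: monomial_def power_add prod.distrib)

lemma poly_space_mult:
  assumes "p \<in> poly_space m" "q \<in> poly_space n"
  shows "(\<lambda>x. p x * q x) \<in> poly_space (m + n)"
  using assms(1)
proof (induction p rule: poly_space_induct)
  case zero
  then show ?case by (simp add: poly_space_zero)
next
  case (add p p')
  then show ?case by (simp add: distrib_right poly_space_add)
next
  case (monomial c \<alpha>)
  show ?case
    using assms(2)
  proof (induction q rule: poly_space_induct)
    case zero
    then show ?case by (simp add: poly_space_zero)
  next
    case (add p p')
    then show ?case by (simp add: distrib_left poly_space_add)
  next
    case (monomial d \<beta>)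
    have "(\<lambda>b. \<alpha> b + \<beta> b) \<in> multi_indices (m + n)"
      using \<open>\<alpha> \<in> _\<close> monomial by (auto simp: multi_indices_def sum.distrib)
    then have "(\<lambda>x. (c * d) * monomial (\<lambda>b. \<alpha> b + \<beta> b) x) \<in> poly_space (m + n)"
      by (intro poly_space_cmult monomial_in_poly_space)
    then show ?case by (simp add: monomial_mult[symmetric] mult_ac)
  qed
qed

lemma poly_space_const: "0 \<le> m \<Longrightarrow> (\<lambda>x. c) \<in> poly_space m"
  using poly_space_cmult[OF monomial_in_poly_space[of "\<lambda>_. 0" m], of c]
  by (simp add: multi_indices_def monomial_def)

lemma poly_space_coord:
  fixes b :: "'a::euclidean_space"
  assumes "b \<in> Basis"
  shows "(\<lambda>x. x \<bullet> b) \<in> poly_space 1"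
proof -
  let ?\<alpha> = "\<lambda>i. if i = b then 1 else (0::nat)"
  have "?\<alpha> \<in> multi_indices 1" using assms by (auto simp: multi_indices_def sum.delta simp del: of_nat_sum)
  then have "monomial ?\<alpha> \<in> poly_space 1" by (rule monomial_in_poly_space)
  moreover have "monomial ?\<alpha> = (\<lambda>x. x \<bullet> b)"
    using assms by (auto simp: monomial_def if_distrib[where f="\<lambda>k. _ ^ k"] prod.delta cong: if_cong)
  ultimately show ?thesis by simp
qed

lemma poly_space_inner: "(\<lambda>x. x \<bullet> v) \<in> poly_space 1"
proof -
  have "(\<lambda>x. \<Sum>b\<in>Basis. (v \<bullet> b) * (x \<bullet> b)) \<in> poly_space 1"
    by (intro poly_space_sum poly_space_cmult poly_space_coord)
  then show ?thesis by (simp add: euclidean_inner[of _ v] mult.commute)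
qed

lemma poly_space_power:
  assumes "p \<in> poly_space 1"
  shows "(\<lambda>x. p x ^ j) \<in> poly_space (int j)"
proof (induction j)
  case 0
  then show ?case by (simp add: poly_space_const)
next
  case (Suc j)
  then show ?case using poly_space_mult[OF assms Suc] by (simp add: algebra_simps)
qed

lemma poly_space_prod:
  assumes "finite I" "\<And>i. i \<in> I \<Longrightarrow> p i \<in> poly_space (int (m i))"
  shows "(\<lambda>x. \<Prod>i\<in>I. p i x) \<in> poly_space (int (\<Sum>i\<in>I. m i))"
  using assms
proof (induction I)
  case empty
  then show ?case by (simp add: poly_space_const)
next
  case (insert i I)
  then show ?case using poly_space_mult[of "p i" "int (m i)"] by simp
qed

text \<open>The degree is total, so it does not grow when every coordinate is replaced by an affine function.\<close>

lemma poly_space_affine: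
  assumes q: "q \<in> poly_space m" and A: "\<And>b. b \<in> Basis \<Longrightarrow> (\<lambda>x. A x \<bullet> b) \<in> poly_space 1"
  shows "(\<lambda>x. q (A x)) \<in> poly_space m"
  using q
proof (induction q rule: poly_space_induct)
  case (monomial c \<alpha>)
  have "(\<lambda>x. \<Prod>b\<in>Basis. (A x \<bullet> b) ^ \<alpha> b) \<in> poly_space (int (\<Sum>b\<in>Basis. \<alpha> b))"
    by (intro poly_space_prod poly_space_power A) auto
  moreover have "int (\<Sum>b\<in>Basis. \<alpha> b) \<le> m" using monomial by (auto simp: multi_indices_def)
  ultimately have "(\<lambda>x. \<Prod>b\<in>Basis. (A x \<bullet> b) ^ \<alpha> b) \<in> poly_space m"
    using poly_space_mono by blast
  then show ?case by (auto simp: monomial_def intro: poly_space_cmult)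
qed (auto intro: poly_space_zero poly_space_add)

lemma poly_space_shift_scale:
  assumes "q \<in> poly_space m"
  shows "(\<lambda>x. q (a + t *\<^sub>R x)) \<in> poly_space m"
  using assms
  by (rule poly_space_affine)
     (auto simp: inner_add_left intro!: poly_space_add poly_space_const poly_space_cmult poly_space_inner)

text \<open>In each term of the product rule one exponent drops by one, and a term with exponent zero vanishes.\<close>

lemma poly_space_has_derivative:
  assumes "q \<in> poly_space m"
  shows "\<exists>D. (\<forall>x. (q has_derivative D x) (at x)) \<and> (\<forall>e. (\<lambda>x. D x e) \<in> poly_space (m - 1))"
  using assms
proof (induction q rule: poly_space_induct)
  case zero
  then show ?case by (intro exI[of _ "\<lambda>x e. 0"]) (auto simp: poly_space_zero)
next
  case (add p q)
  then obtain D E where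
    "\<forall>x. (p has_derivative D x) (at x)" "\<forall>e. (\<lambda>x. D x e) \<in> poly_space (m - 1)"
    "\<forall>x. (q has_derivative E x) (at x)" "\<forall>e. (\<lambda>x. E x e) \<in> poly_space (m - 1)" by auto
  then show ?case
    by (intro exI[of _ "\<lambda>x e. D x e + E x e"]) (auto intro: poly_space_add has_derivative_add)
next
  case (monomial c \<alpha>)
  define D where "D x e = c * (\<Sum>b\<in>Basis. (of_nat (\<alpha> b) * (e \<bullet> b) * (x \<bullet> b) ^ (\<alpha> b - 1)) *
      (\<Prod>j\<in>Basis - {b}. (x \<bullet> j) ^ \<alpha> j))" for x e :: 'a
  have "((\<lambda>x. c * monomial \<alpha> x) has_derivative D x) (at x)" for x
    unfolding D_def monomial_def
    by (intro has_derivative_mult_right has_derivative_prod)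
       (auto intro!: derivative_eq_intros simp: fun_eq_iff)
  moreover have "(\<lambda>x. D x e) \<in> poly_space (m - 1)" for e
    unfolding D_def
  proof (intro poly_space_cmult poly_space_sum)
    fix b :: 'a assume b: "b \<in> Basis"
    show "(\<lambda>x. real (\<alpha> b) * (e \<bullet> b) * (x \<bullet> b) ^ (\<alpha> b - 1) * (\<Prod>j\<in>Basis - {b}. (x \<bullet> j) ^ \<alpha> j))
        \<in> poly_space (m - 1)"
    proof (cases "\<alpha> b = 0")
      case True
      then show ?thesis by (simp add: poly_space_zero)
    next
      case False
      have "(\<lambda>x. (real (\<alpha> b) * (e \<bullet> b)) * ((x \<bullet> b) ^ (\<alpha> b - 1) * (\<Prod>j\<in>Basis - {b}. (x \<bullet> j) ^ \<alpha> j)))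
          \<in> poly_space (int (\<alpha> b - 1) + int (\<Sum>j\<in>Basis - {b}. \<alpha> j))"
        by (intro poly_space_cmult poly_space_mult poly_space_prod poly_space_power poly_space_inner)
           auto
      moreover have "int (\<alpha> b - 1) + int (\<Sum>j\<in>Basis - {b}. \<alpha> j) \<le> m - 1"
        using monomial False b sum.remove[of Basis b \<alpha>]
        by (auto simp: multi_indices_def simp del: of_nat_sum)
      ultimately show ?thesis using poly_space_mono by (metis (no_types, lifting) ext in_mono mult.assoc)
    qed
  qed
  ultimately show ?case by blast
qed

lemma poly_space_differentiable:
  "q \<in> poly_space m \<Longrightarrow> (q has_derivative frechet_derivative q (at x)) (at x)"
  using poly_space_has_derivative[of q m] by (metis differentiableI frechet_derivative_works)

lemma poly_space_deriv:
  assumes "q \<in> poly_space m"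
  shows "(\<lambda>x. frechet_derivative q (at x) e) \<in> poly_space (m - 1)"
proof -
  obtain D where D: "\<forall>x. (q has_derivative D x) (at x)" "\<forall>e. (\<lambda>x. D x e) \<in> poly_space (m - 1)"
    using poly_space_has_derivative[OF assms] by blast
  then have "frechet_derivative q (at x) = D x" for x using frechet_derivative_at by metis
  then show ?thesis using D by simp
qed

lemma poly_space_continuous:
  assumes "q \<in> poly_space m"
  shows "continuous_on X q"
  by (meson assms continuous_at_imp_continuous_on has_derivative_continuous
      poly_space_differentiable)

lemma poly_space_borel: "q \<in> poly_space m \<Longrightarrow> q \<in> borel_measurable borel"
  by (rule borel_measurable_continuous_onI) (rule poly_space_continuous)

lemma poly_space_line:
  assumes "q \<in> poly_space m"
  shows "real_polynomial_function (\<lambda>t. q (a + t *\<^sub>R v))"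
  using assms
proof (induction q rule: poly_space_induct)
  case (monomial c \<alpha>)
  have "real_polynomial_function (\<lambda>t. (a \<bullet> b) + t * (v \<bullet> b))" for b
    using real_polynomial_function.intros(3)[OF real_polynomial_function.intros(2)
        real_polynomial_function.intros(1)[OF bounded_linear_mult_left]] .
  then have "real_polynomial_function (\<lambda>t. \<Prod>b\<in>Basis. ((a \<bullet> b) + t * (v \<bullet> b)) ^ \<alpha> b)"
    by (intro real_polynomial_function_prod real_polynomial_function_power) auto
  then show ?case
    by (auto simp: monomial_def inner_add_left intro: real_polynomial_function.intros(4) real_polynomial_function.intros(2))
qed auto

text \<open>On every line through a the polynomial has infinitely many zeros near a.\<close>

lemma poly_space_eq_0:
  fixes q :: "'a::euclidean_space \<Rightarrow> real"
  assumes q: "q \<in> poly_space m" and "open U" "a \<in> U" and z: "\<And>x. x \<in> U \<Longrightarrow> q x = 0"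
  shows "q x = 0"
proof -
  obtain c n where p: "(\<lambda>t. q (a + t *\<^sub>R (x - a))) = (\<lambda>t. \<Sum>i\<le>n. c i * t ^ i)"
    using poly_space_line[OF q, of a "x - a"] unfolding real_polynomial_function_iff_sum by auto
  have "isCont (\<lambda>t. a + t *\<^sub>R (x - a)) 0" by (intro continuous_intros)
  then have "((\<lambda>t. a + t *\<^sub>R (x - a)) \<longlongrightarrow> a) (at 0)" unfolding isCont_def by simp
  then have "\<forall>\<^sub>F t in at 0. a + t *\<^sub>R (x - a) \<in> U"
    using \<open>open U\<close> \<open>a \<in> U\<close> by (rule topological_tendstoD)
  then obtain d where d: "0 < d" "\<And>t. t \<noteq> 0 \<Longrightarrow> dist t 0 < d \<Longrightarrow> a + t *\<^sub>R (x - a) \<in> U"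
    unfolding eventually_at by auto
  have "{t. 0 < t \<and> t < d} \<subseteq> {t. (\<Sum>i\<le>n. c i * t ^ i) = 0}"
  proof
    fix t assume "t \<in> {t. 0 < t \<and> t < d}"
    then have "q (a + t *\<^sub>R (x - a)) = 0" using d(2)[of t] z by (simp add: dist_norm)
    then show "t \<in> {t. (\<Sum>i\<le>n. c i * t ^ i) = 0}" using fun_cong[OF p, of t] by simp
  qed
  moreover have "infinite {t. 0 < t \<and> t < d}"
    using d(1) infinite_Ioo[of 0 d] by (simp add: greaterThanLessThan_def greaterThan_def lessThan_def Collect_conj_eq[symmetric])
  ultimately have "infinite {t. (\<Sum>i\<le>n. c i * t ^ i) = 0}" using finite_subset by blast
  then have "\<forall>i\<le>n. c i = 0" using polyfun_finite_roots[where c=c and n=n] by blast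
  then have "(\<Sum>i\<le>n. c i * 1 ^ i) = 0" by simp
  then show ?thesis using fun_cong[OF p, of 1] by simp
qed

section \<open>Finite-dimensional function spaces with a semi-inner product\<close>

primrec fspan :: "('x \<Rightarrow> 'b::real_vector) list \<Rightarrow> ('x \<Rightarrow> 'b) set" where
  "fspan [] = {\<lambda>x. 0}"
| "fspan (b # bs) = {\<lambda>x. c *\<^sub>R b x + v x |c v. v \<in> fspan bs}"

text \<open>Finite dimension is witnessed by a spanning list, along which Gram--Schmidt proceeds by induction.\<close>

definition finite_dim :: "('x \<Rightarrow> 'b::real_vector) set \<Rightarrow> bool" where
  "finite_dim V \<longleftrightarrow> (\<exists>bs. V = fspan bs)"

lemma fspan_zero: "(\<lambda>x. 0) \<in> fspan bs"
proof (induction bs)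
  case (Cons b bs)
  then show ?case by (auto intro!: exI[of _ "0::real"] exI[of _ "\<lambda>x. 0"])
qed simp

lemma fspan_append: "fspan (as @ bs) = {\<lambda>x. u x + v x |u v. u \<in> fspan as \<and> v \<in> fspan bs}"
proof (induction as)
  case (Cons a as)
  show ?case
  proof (intro set_eqI iffI)
    fix w assume "w \<in> fspan ((a # as) @ bs)"
    then obtain c g where "g \<in> fspan (as @ bs)" "w = (\<lambda>x. c *\<^sub>R a x + g x)" by auto
    moreover from this obtain u v where "u \<in> fspan as" "v \<in> fspan bs" "g = (\<lambda>x. u x + v x)"
      using Cons by blast
    ultimately have "w = (\<lambda>x. (c *\<^sub>R a x + u x) + v x)" "(\<lambda>x. c *\<^sub>R a x + u x) \<in> fspan (a # as)"
      by (auto simp: add.assoc)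
    then show "w \<in> {\<lambda>x. u x + v x |u v. u \<in> fspan (a # as) \<and> v \<in> fspan bs}"
      using \<open>v \<in> fspan bs\<close>
      by (intro CollectI exI[of _ "\<lambda>x. c *\<^sub>R a x + u x"] exI[of _ v] conjI)
  next
    fix w assume "w \<in> {\<lambda>x. u x + v x |u v. u \<in> fspan (a # as) \<and> v \<in> fspan bs}"
    then obtain c u v where uv: "u \<in> fspan as" "v \<in> fspan bs"
      and w: "w = (\<lambda>x. c *\<^sub>R a x + (u x + v x))"
      by (auto simp: add.assoc)
    have "(\<lambda>x. u x + v x) \<in> fspan (as @ bs)" using Cons uv by blast
    then show "w \<in> fspan ((a # as) @ bs)" using w by auto
  qed
qed auto

lemma fspan_map:
  assumes "L (\<lambda>x. 0) = (\<lambda>x. 0)"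
    and "\<And>c u v. L (\<lambda>x. c *\<^sub>R u x + v x) = (\<lambda>x. c *\<^sub>R L u x + L v x)"
  shows "fspan (map L bs) = L ` fspan bs"
proof (induction bs)
  case (Cons b bs)
  show ?case
  proof (intro set_eqI iffI)
    fix w assume "w \<in> fspan (map L (b # bs))"
    then obtain c v where "v \<in> fspan bs" "w = (\<lambda>x. c *\<^sub>R L b x + L v x)" using Cons by auto
    then show "w \<in> L ` fspan (b # bs)" by (auto simp: assms(2)[symmetric])
  next
    fix w assume "w \<in> L ` fspan (b # bs)"
    then obtain c v where "v \<in> fspan bs" "w = L (\<lambda>x. c *\<^sub>R b x + v x)" by auto
    then show "w \<in> fspan (map L (b # bs))" using Cons by (auto simp: assms(2))
  qed
qed (simp add: assms(1))

lemma finite_dim_add: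
  "finite_dim U \<Longrightarrow> finite_dim V \<Longrightarrow> finite_dim {\<lambda>x. u x + v x |u v. u \<in> U \<and> v \<in> V}"
  unfolding finite_dim_def using fspan_append[symmetric] by blast

lemma finite_dim_image:
  assumes "finite_dim V" "L (\<lambda>x. 0) = (\<lambda>x. 0)"
    and "\<And>c u v. L (\<lambda>x. c *\<^sub>R u x + v x) = (\<lambda>x. c *\<^sub>R L u x + L v x)"
  shows "finite_dim (L ` V)"
  using assms(1) fspan_map[of L, OF assms(2,3), symmetric] unfolding finite_dim_def by blast

lemma finite_dim_zero: "finite_dim {\<lambda>x. 0}"
  unfolding finite_dim_def by (intro exI[of _ "[]"]) simp

text \<open>Polynomial spaces arise from smaller spaces by such sums: scalar polynomials from constants times
  monomials, vector polynomials from scalar ones times basis vectors.\<close>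

lemma finite_dim_combinations:
  assumes "finite I" "finite_dim V"
    and L: "\<And>i. L i (\<lambda>x. 0) = (\<lambda>x. 0)"
      "\<And>i c u v. L i (\<lambda>x. c *\<^sub>R u x + v x) = (\<lambda>x. c *\<^sub>R L i u x + L i v x)"
  shows "finite_dim {\<lambda>x. \<Sum>i\<in>I. L i (v i) x |v. \<forall>i\<in>I. v i \<in> V}"
  using assms(1)
proof (induction I)
  case empty
  then show ?case by (simp add: finite_dim_zero)
next
  case (insert i I)
  have "{\<lambda>x. \<Sum>j\<in>insert i I. L j (v j) x |v. \<forall>j\<in>insert i I. v j \<in> V} =
    {\<lambda>x. u x + w x |u w. u \<in> L i ` V \<and> w \<in> {\<lambda>x. \<Sum>j\<in>I. L j (v j) x |v. \<forall>j\<in>I. v j \<in> V}}"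
    (is "?A = ?B")
  proof (intro set_eqI iffI)
    fix f assume "f \<in> ?A"
    then show "f \<in> ?B"
    proof (elim CollectE exE conjE)
      fix v assume f: "f = (\<lambda>x. \<Sum>j\<in>insert i I. L j (v j) x)" and v: "\<forall>j\<in>insert i I. v j \<in> V"
      have "f = (\<lambda>x. L i (v i) x + (\<Sum>j\<in>I. L j (v j) x))" using insert f by simp
      moreover have "L i (v i) \<in> L i ` V" using v by simp
      moreover have "\<forall>j\<in>I. v j \<in> V" using v by simp
      ultimately show ?thesis
        by (intro CollectI exI[of _ "L i (v i)"] exI[of _ "\<lambda>x. \<Sum>j\<in>I. L j (v j) x"] exI[of _ v] conjI refl)
    qed
  next
    fix f assume "f \<in> ?B"
    then show "f \<in> ?A"
    proof (elim CollectE exE conjE imageE)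
      fix u w u' v
      assume f: "f = (\<lambda>x. u x + w x)" and u: "u = L i u'" "u' \<in> V"
        and w: "w = (\<lambda>x. \<Sum>j\<in>I. L j (v j) x)" and v: "\<forall>j\<in>I. v j \<in> V"
      have "(\<Sum>j\<in>I. L j (v j) x) = (\<Sum>j\<in>I. L j ((v(i := u')) j) x)" for x
        using insert by (intro sum.cong) auto
      then have "f = (\<lambda>x. \<Sum>j\<in>insert i I. L j ((v(i := u')) j) x)" using f u w insert by simp
      moreover have "\<forall>j\<in>insert i I. (v(i := u')) j \<in> V" using u v by auto
      ultimately show ?thesis by (intro CollectI exI[of _ "v(i := u')"] conjI)
    qed
  qed
  then show ?case
    using finite_dim_add[OF finite_dim_image[of V "L i", OF assms(2) L(1) L(2)] insert.IH] by simp
qed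

lemma finite_dim_poly_space: "finite_dim (poly_space m :: ('a::euclidean_space \<Rightarrow> real) set)"
proof -
  have 1: "finite_dim (fspan [\<lambda>_. 1] :: ('a \<Rightarrow> real) set)" unfolding finite_dim_def by blast
  have 2: "fspan [\<lambda>_. 1] = {f :: 'a \<Rightarrow> real. \<exists>c. f = (\<lambda>_. c)}" by auto
  have "poly_space m = {\<lambda>x::'a. \<Sum>\<alpha>\<in>multi_indices m. v \<alpha> x * monomial \<alpha> x |v.
      \<forall>\<alpha>\<in>multi_indices m. v \<alpha> \<in> fspan [\<lambda>_. 1]}" (is "_ = ?R")
  proof (intro set_eqI iffI)
    fix q :: "'a \<Rightarrow> real" assume "q \<in> poly_space m"
    then obtain c where "q = (\<lambda>x. \<Sum>\<alpha>\<in>multi_indices m. c \<alpha> * monomial \<alpha> x)"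
      unfolding poly_space_alt by auto
    then show "q \<in> ?R" unfolding 2 by (auto intro!: exI[of _ "\<lambda>\<alpha> _. c \<alpha>"])
  next
    fix q assume "q \<in> ?R"
    then obtain v where v: "\<forall>\<alpha>\<in>multi_indices m. \<exists>c. v \<alpha> = (\<lambda>_. c)"
      and q: "q = (\<lambda>x. \<Sum>\<alpha>\<in>multi_indices m. v \<alpha> x * monomial \<alpha> x)" unfolding 2 by auto
    show "q \<in> poly_space m"
      unfolding q
    proof (rule poly_space_sum)
      fix \<alpha> assume "\<alpha> \<in> (multi_indices m :: ('a \<Rightarrow> nat) set)"
      moreover from this obtain c where "v \<alpha> = (\<lambda>_. c)" using v by blast
      ultimately show "(\<lambda>x. v \<alpha> x * monomial \<alpha> x) \<in> poly_space m"
        using poly_space_cmult[OF monomial_in_poly_space[of \<alpha> m], of c] by simp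
    qed
  qed
  moreover have "finite_dim ?R"
    by (rule finite_dim_combinations[OF finite_multi_indices 1, where L="\<lambda>\<alpha> v x. v x * monomial \<alpha> x"])
       (auto simp: algebra_simps)
  ultimately show ?thesis by simp
qed

lemma finite_dim_poly_fields: "finite_dim (poly_fields m :: ('a::euclidean_space \<Rightarrow> 'a) set)"
proof -
  have "poly_fields m = {\<lambda>x::'a. \<Sum>b\<in>Basis. v b x *\<^sub>R b |v. \<forall>b\<in>Basis. v b \<in> poly_space m}"
    (is "_ = ?R")
  proof (intro set_eqI iffI)
    fix \<phi> :: "'a \<Rightarrow> 'a" assume "\<phi> \<in> poly_fields m"
    then show "\<phi> \<in> ?R" unfolding poly_fields_def
      by (auto simp: euclidean_representation intro!: exI[of _ "\<lambda>b x. \<phi> x \<bullet> b"])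
  next
    fix \<phi> assume "\<phi> \<in> ?R"
    then show "\<phi> \<in> poly_fields m" unfolding poly_fields_def by auto
  qed
  moreover have "finite_dim {\<lambda>x::'a. \<Sum>b\<in>Basis. (\<lambda>b v x. v x *\<^sub>R b) b (v b) x |v.
      \<forall>b\<in>Basis. v b \<in> poly_space m}"
    by (rule finite_dim_combinations[OF finite_Basis finite_dim_poly_space])
       (auto simp: algebra_simps)
  ultimately show ?thesis by simp
qed

lemma finite_dim_RT_space: "finite_dim (RT_space m :: ('a::euclidean_space \<Rightarrow> 'a) set)"
proof -
  let ?L = "\<lambda>(q::'a \<Rightarrow> real) x. q x *\<^sub>R x"
  have "RT_space m = {\<lambda>x::'a. \<phi> x + w x |\<phi> w. \<phi> \<in> poly_fields m \<and> w \<in> ?L ` poly_space m}"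
    unfolding RT_space_def by (intro set_eqI iffI) (auto 4 3)
  moreover have "finite_dim (?L ` poly_space m)"
    by (rule finite_dim_image[OF finite_dim_poly_space]) (auto simp: algebra_simps)
  ultimately show ?thesis using finite_dim_add[OF finite_dim_poly_fields] by simp
qed

text \<open>The form is allowed to be degenerate: the gradient form and the products on faces vanish on
  some nonzero polynomials.\<close>

locale semi_inner_space =
  fixes V :: "('x \<Rightarrow> 'b::real_vector) set" and B :: "('x \<Rightarrow> 'b) \<Rightarrow> ('x \<Rightarrow> 'b) \<Rightarrow> real"
  assumes V_zero: "(\<lambda>x. 0) \<in> V"
    and V_add: "u \<in> V \<Longrightarrow> v \<in> V \<Longrightarrow> (\<lambda>x. u x + v x) \<in> V"
    and V_scale: "u \<in> V \<Longrightarrow> (\<lambda>x. c *\<^sub>R u x) \<in> V"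
    and B_sym: "u \<in> V \<Longrightarrow> v \<in> V \<Longrightarrow> B u v = B v u"
    and B_add: "u \<in> V \<Longrightarrow> v \<in> V \<Longrightarrow> w \<in> V \<Longrightarrow> B (\<lambda>x. u x + v x) w = B u w + B v w"
    and B_scale: "u \<in> V \<Longrightarrow> w \<in> V \<Longrightarrow> B (\<lambda>x. c *\<^sub>R u x) w = c * B u w"
    and B_nonneg: "u \<in> V \<Longrightarrow> 0 \<le> B u u"
begin

lemma V_diff: "u \<in> V \<Longrightarrow> v \<in> V \<Longrightarrow> (\<lambda>x. u x - v x) \<in> V"
  using V_add[OF _ V_scale[of v "-1"], of u] by simp

lemma V_sum: "(\<And>i. i \<in> I \<Longrightarrow> u i \<in> V) \<Longrightarrow> (\<lambda>x. \<Sum>i\<in>I. u i x) \<in> V"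
  by (induction I rule: infinite_finite_induct) (auto simp: V_zero V_add)

lemma V_fspan: "set bs \<subseteq> V \<Longrightarrow> fspan bs \<subseteq> V"
  by (induction bs) (auto simp: V_zero intro: V_add V_scale)

lemma B_zero: "w \<in> V \<Longrightarrow> B (\<lambda>x. 0) w = 0"
  using B_scale[OF V_zero, of w 0] by simp

lemma B_diff:
  assumes "u \<in> V" "v \<in> V" "w \<in> V"
  shows "B (\<lambda>x. u x - v x) w = B u w - B v w"
  using B_add[OF assms(1) V_scale[OF assms(2), of "-1"] assms(3)] B_scale[OF assms(2,3), of "-1"]
  by simp

lemma B_sum:
  assumes "\<And>i. i \<in> I \<Longrightarrow> u i \<in> V" "w \<in> V"
  shows "B (\<lambda>x. \<Sum>i\<in>I. u i x) w = (\<Sum>i\<in>I. B (u i) w)"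
  using assms(1)
  by (induction I rule: infinite_finite_induct) (simp_all add: B_zero assms(2) B_add V_sum)

lemma B_quadratic:
  assumes "u \<in> V" "v \<in> V"
  shows "B (\<lambda>x. u x + t *\<^sub>R v x) (\<lambda>x. u x + t *\<^sub>R v x) = B u u + 2 * t * B u v + t\<^sup>2 * B v v"
proof -
  let ?w = "\<lambda>x. u x + t *\<^sub>R v x"
  have w: "?w \<in> V" using assms by (intro V_add V_scale)
  have "B ?w ?w = B u ?w + t * B v ?w"
    using B_add[OF assms(1) V_scale[OF assms(2)] w] B_scale[OF assms(2) w] by simp
  moreover have "B ?w u = B u u + t * B v u"
    using B_add[OF assms(1) V_scale[OF assms(2)] assms(1)] B_scale[OF assms(2,1)] by simp
  moreover have "B ?w v = B u v + t * B v v"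
    using B_add[OF assms(1) V_scale[OF assms(2)] assms(2)] B_scale[OF assms(2,2)] by simp
  ultimately show ?thesis
    using B_sym[OF assms(1) w] B_sym[OF assms(2) w] B_sym[OF assms]
    by (simp add: algebra_simps power2_eq_square)
qed

lemma cauchy_schwarz:
  assumes u: "u \<in> V" and v: "v \<in> V"
  shows "(B u v)\<^sup>2 \<le> B u u * B v v"
proof -
  have q: "0 \<le> B u u + 2 * t * B u v + t\<^sup>2 * B v v" for t
    unfolding B_quadratic[OF u v, symmetric] by (intro B_nonneg V_add V_scale u v)
  show ?thesis
  proof (cases "B v v = 0")
    case True
    show ?thesis
    proof (cases "B u v = 0")
      case False
      then have "2 * (- (B u u + 1) / (2 * B u v)) * B u v = - (B u u + 1)" by simp
      then show ?thesis using q[of "- (B u u + 1) / (2 * B u v)"] True by simp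
    qed (simp add: True)
  next
    case False
    then have "0 < B v v" using B_nonneg[OF v] by simp
    then show ?thesis using q[of "- B u v / B v v"]
      by (simp add: field_simps power2_eq_square)
  qed
qed

lemma null_left: "u \<in> V \<Longrightarrow> v \<in> V \<Longrightarrow> B u u = 0 \<Longrightarrow> B u v = 0"
  using cauchy_schwarz[of u v] by simp

lemma null_right: "u \<in> V \<Longrightarrow> v \<in> V \<Longrightarrow> B v v = 0 \<Longrightarrow> B u v = 0"
  using cauchy_schwarz[of u v] by simp

abbreviation residual :: "nat \<Rightarrow> (nat \<Rightarrow> 'x \<Rightarrow> 'b) \<Rightarrow> ('x \<Rightarrow> 'b) \<Rightarrow> 'x \<Rightarrow> 'b" where
  "residual n e v \<equiv> \<lambda>x. v x - (\<Sum>i<n. B v (e i) *\<^sub>R e i x)"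

lemma residual_orthogonal:
  assumes e: "\<And>i. i < n \<Longrightarrow> e i \<in> V"
    "\<And>i j. i < n \<Longrightarrow> j < n \<Longrightarrow> B (e i) (e j) = (if i = j then 1 else 0)"
    and v: "v \<in> V" and j: "j < n"
  shows "B (residual n e v) (e j) = 0"
proof -
  have sV: "(\<lambda>x. \<Sum>i<n. B v (e i) *\<^sub>R e i x) \<in> V" by (intro V_sum V_scale e(1)) simp
  have "B (\<lambda>x. \<Sum>i<n. B v (e i) *\<^sub>R e i x) (e j) = (\<Sum>i<n. B v (e i) * B (e i) (e j))"
    using e(1) j by (subst B_sum) (auto simp: B_scale intro: V_scale)
  then have "B (residual n e v) (e j) = B v (e j) - (\<Sum>i<n. B v (e i) * B (e i) (e j))"
    using B_diff[OF v sV e(1)[OF j]] by simp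
  also have "(\<Sum>i<n. B v (e i) * B (e i) (e j)) = (\<Sum>i<n. if i = j then B v (e j) else 0)"
    using e(2) j by (intro sum.cong) auto
  finally show ?thesis using j by simp
qed

text \<open>Gram--Schmidt for a form that may be degenerate: a vector whose residual is null
  is not adjoined to the family.\<close>

lemma orthonormal_family:
  assumes "set bs \<subseteq> V"
  shows "\<exists>n e. (\<forall>i<n. e i \<in> V) \<and>
    (\<forall>i<n. \<forall>j<n. B (e i) (e j) = (if i = j then 1 else 0)) \<and>
    (\<forall>v\<in>fspan bs. B (residual n e v) (residual n e v) = 0)"
  using assms
proof (induction bs)
  case Nil
  then show ?case
    by (intro exI[of _ "0::nat"]) (auto simp: B_zero V_zero)
next
  case (Cons b bs)
  then have "set bs \<subseteq> V" by simp
  from Cons.IH[OF this] obtain n e where e': "\<forall>i<n. e i \<in> V"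
    and on': "\<forall>i<n. \<forall>j<n. B (e i) (e j) = (if i = j then 1 else 0)"
    and null': "\<forall>v\<in>fspan bs. B (residual n e v) (residual n e v) = 0"
    by blast
  note e = e'[rule_format] and on = on'[rule_format] and null = null'[rule_format]
  have b: "b \<in> V" and bs: "fspan bs \<subseteq> V" using Cons.prems V_fspan by auto
  define b' where "b' = residual n e b"
  have res: "residual n e v \<in> V" if "v \<in> V" for v
    using that e by (intro V_diff V_sum V_scale) auto
  have b': "b' \<in> V" unfolding b'_def by (rule res[OF b])
  have split: "residual n e (\<lambda>x. c *\<^sub>R b x + w x) = (\<lambda>x. residual n e w x + c *\<^sub>R b' x)"
    if w: "w \<in> V" for c w
  proof
    fix x
    have "B (\<lambda>x. c *\<^sub>R b x + w x) (e i) = c * B b (e i) + B w (e i)" if "i < n" for i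
      using that e by (simp add: B_add B_scale V_scale b w)
    then have "(\<Sum>i<n. B (\<lambda>x. c *\<^sub>R b x + w x) (e i) *\<^sub>R e i x) =
        (\<Sum>i<n. c *\<^sub>R (B b (e i) *\<^sub>R e i x) + B w (e i) *\<^sub>R e i x)"
      by (intro sum.cong) (auto simp: algebra_simps)
    then show "residual n e (\<lambda>x. c *\<^sub>R b x + w x) x = residual n e w x + c *\<^sub>R b' x"
      by (simp add: b'_def sum.distrib scaleR_sum_right algebra_simps)
  qed
  show ?case
  proof (cases "B b' b' = 0")
    case True
    have "B (residual n e v) (residual n e v) = 0" if "v \<in> fspan (b # bs)" for v
    proof -
      obtain c w where v: "v = (\<lambda>x. c *\<^sub>R b x + w x)" "w \<in> fspan bs" using \<open>v \<in> _\<close> by auto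
      then have w: "w \<in> V" using bs by auto
      show ?thesis
        unfolding v(1) split[OF w]
        using B_quadratic[OF res[OF w] b', of c] null[OF v(2)] True null_right[OF res[OF w] b' True]
        by simp
    qed
    then show ?thesis using e on by (intro exI[of _ n] exI[of _ e] conjI allI impI ballI)
  next
    case False
    define s where "s = sqrt (B b' b')"
    have s: "s > 0" "s * s = B b' b'" using False B_nonneg[OF b'] by (auto simp: s_def)
    define f where "f = (\<lambda>i. if i = n then (\<lambda>x. (1 / s) *\<^sub>R b' x) else e i)"
    have f: "f i \<in> V" if "i < Suc n" for i
      using that e V_scale[OF b'] by (auto simp: f_def)
    have orth: "B b' (e j) = 0" if "j < n" for j
      unfolding b'_def by (rule residual_orthogonal) (use e on b that in auto)
    have fn: "B (f n) u = B b' u / s" if "u \<in> V" for u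
      using that by (simp add: f_def B_scale[OF b'])
    have ortho: "B (f i) (f j) = (if i = j then 1 else 0)" if ij: "i < Suc n" "j < Suc n" for i j
    proof -
      consider "i < n" "j < n" | "i = n" "j < n" | "i < n" "j = n" | "i = n" "j = n"
        using ij by linarith
      then show ?thesis
      proof cases
        case 1
        then show ?thesis using on by (simp add: f_def)
      next
        case 2
        then show ?thesis using fn[of "e j"] e orth by (simp add: f_def)
      next
        case 3
        then show ?thesis using fn[of "e i"] e orth B_sym[OF f[of i] f[of n]] by (simp add: f_def)
      next
        case 4
        have "B b' (f n) = s * s / s" using fn[OF b'] B_sym[OF b' f[of n]] unfolding s(2) by simp
        then have "B b' (f n) = s" using s(1) by simp
        then show ?thesis using 4 fn[OF f[of n]] s(1) by simp
      qed
    qed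
    have "B (residual (Suc n) f v) (residual (Suc n) f v) = 0" if "v \<in> fspan (b # bs)" for v
    proof -
      obtain c w where v: "v = (\<lambda>x. c *\<^sub>R b x + w x)" "w \<in> fspan bs" using \<open>v \<in> _\<close> by auto
      then have w: "w \<in> V" using bs by auto
      then have vV: "v \<in> V" unfolding v(1) by (intro V_add V_scale b)
      have rv: "(\<lambda>x. residual n e v x + (\<Sum>i<n. B v (e i) *\<^sub>R e i x)) = v" by simp
      have sumV: "(\<lambda>x. \<Sum>i<n. B v (e i) *\<^sub>R e i x) \<in> V" using e by (intro V_sum V_scale) auto
      have "B v b' = B (residual n e v) b' + B (\<lambda>x. \<Sum>i<n. B v (e i) *\<^sub>R e i x) b'"
        using B_add[OF res[OF vV] sumV b'] unfolding rv .
      also have "B (\<lambda>x. \<Sum>i<n. B v (e i) *\<^sub>R e i x) b' = 0"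
        using e orth B_sym[OF b'] b' by (subst B_sum) (auto simp: B_scale intro: V_scale)
      also have "B (residual n e v) b' = B (residual n e w) b' + c * B b' b'"
        unfolding v(1) split[OF w] by (simp add: B_add B_scale res[OF w] b' V_scale)
      also have "B (residual n e w) b' = 0"
        by (rule null_left[OF res[OF w] b' null[OF v(2)]])
      finally have "B v b' = c * B b' b'" by simp
      moreover have "B v (f n) = B v b' / s"
        using fn[OF vV] B_sym[OF vV f[of n]] B_sym[OF vV b'] by simp
      ultimately have "B v (f n) = c * (s * s) / s" unfolding s(2) by (simp only:)
      then have Bvf: "B v (f n) = c * s" using s(1) by simp
      have "residual (Suc n) f v = residual n e w"
      proof
        fix x
        have "B v (f n) *\<^sub>R f n x = c *\<^sub>R b' x" unfolding Bvf using s(1) by (simp add: f_def)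
        moreover have "residual n e v x = residual n e w x + c *\<^sub>R b' x"
          using fun_cong[OF split[OF w, of c], of x] unfolding v(1) .
        moreover have "(\<Sum>i<n. B v (f i) *\<^sub>R f i x) = (\<Sum>i<n. B v (e i) *\<^sub>R e i x)"
          by (intro sum.cong) (auto simp: f_def)
        moreover have "residual (Suc n) f v x =
            (v x - (\<Sum>i<n. B v (f i) *\<^sub>R f i x)) - B v (f n) *\<^sub>R f n x"
          by (simp add: algebra_simps)
        ultimately show "residual (Suc n) f v x = residual n e w x"
          by (metis (no_types, lifting) add_diff_cancel_right')
      qed
      then show ?thesis using null[OF v(2)] by simp
    qed
    then show ?thesis using f ortho by (intro exI[of _ "Suc n"] exI[of _ f] conjI allI impI ballI)
  qed
qed

lemma finite_dim_orthonormal_family: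
  assumes "finite_dim V"
  obtains n e where "\<And>i. i < n \<Longrightarrow> e i \<in> V"
    "\<And>i j. i < n \<Longrightarrow> j < n \<Longrightarrow> B (e i) (e j) = (if i = j then 1 else 0)"
    "\<And>v. v \<in> V \<Longrightarrow> B (residual n e v) (residual n e v) = 0"
proof -
  obtain bs where bs: "V = fspan bs" using assms unfolding finite_dim_def by blast
  have "set bs \<subseteq> fspan bs"
  proof (induction bs)
    case (Cons b bs)
    have "b \<in> fspan (b # bs)"
      using fspan_zero[of bs] by (auto intro!: exI[of _ "1::real"] exI[of _ "\<lambda>x. 0"])
    moreover have "fspan bs \<subseteq> fspan (b # bs)" by (force intro: exI[of _ "0::real"])
    ultimately show ?case using Cons by auto
  qed simp
  then show thesis using orthonormal_family[of bs] that bs by blast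
qed

text \<open>Coefficients of the representing vector in an orthonormal family are the values of the
  functional there; on the residuals, which are null, the functional vanishes.\<close>

lemma riesz:
  assumes "finite_dim V"
    and add: "\<And>u v. u \<in> V \<Longrightarrow> v \<in> V \<Longrightarrow> l (\<lambda>x. u x + v x) = l u + l v"
    and scale: "\<And>c u. u \<in> V \<Longrightarrow> l (\<lambda>x. c *\<^sub>R u x) = c * l u"
    and null: "\<And>u. u \<in> V \<Longrightarrow> B u u = 0 \<Longrightarrow> l u = 0"
  shows "\<exists>u\<in>V. \<forall>w\<in>V. B u w = l w"
proof -
  obtain n e where e: "\<And>i. i < n \<Longrightarrow> e i \<in> V"
    "\<And>i j. i < n \<Longrightarrow> j < n \<Longrightarrow> B (e i) (e j) = (if i = j then 1 else 0)"
    "\<And>v. v \<in> V \<Longrightarrow> B (residual n e v) (residual n e v) = 0"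
    using finite_dim_orthonormal_family[OF assms(1)] by blast
  have sum: "l (\<lambda>x. \<Sum>i\<in>I. u i x) = (\<Sum>i\<in>I. l (u i))"
    if "finite I" "\<And>i. i \<in> I \<Longrightarrow> u i \<in> V" for I :: "nat set" and u
    using that
    by (induction I) (use scale[OF V_zero, of 0] in \<open>simp_all add: add V_sum\<close>)
  show ?thesis
  proof (intro bexI[of _ "\<lambda>x. \<Sum>i<n. l (e i) *\<^sub>R e i x"] ballI)
    fix w assume w: "w \<in> V"
    have S: "(\<lambda>x. \<Sum>i<n. B w (e i) *\<^sub>R e i x) \<in> V" using e(1) by (intro V_sum V_scale) auto
    have R: "residual n e w \<in> V" by (rule V_diff[OF w S])
    have "l w = l (\<lambda>x. residual n e w x + (\<Sum>i<n. B w (e i) *\<^sub>R e i x))" by simp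
    also have "\<dots> = l (residual n e w) + l (\<lambda>x. \<Sum>i<n. B w (e i) *\<^sub>R e i x)"
      by (rule add[OF R S])
    also have "l (residual n e w) = 0" by (rule null[OF R e(3)[OF w]])
    also have "l (\<lambda>x. \<Sum>i<n. B w (e i) *\<^sub>R e i x) = (\<Sum>i<n. B w (e i) * l (e i))"
      using e(1) by (subst sum) (auto intro!: V_scale sum.cong simp: scale)
    also have "\<dots> = (\<Sum>i<n. l (e i) * B (e i) w)"
      using e(1) w by (intro sum.cong) (auto simp: B_sym)
    also have "\<dots> = B (\<lambda>x. \<Sum>i<n. l (e i) *\<^sub>R e i x) w"
      using e(1) w by (subst B_sum) (auto simp: B_scale intro: V_scale)
    finally show "B (\<lambda>x. \<Sum>i<n. l (e i) *\<^sub>R e i x) w = l w" by simp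
  qed (use e(1) in \<open>auto intro!: V_sum V_scale\<close>)
qed

lemma riesz_unique:
  assumes "finite_dim V"
    and add: "\<And>u v. u \<in> V \<Longrightarrow> v \<in> V \<Longrightarrow> l (\<lambda>x. u x + v x) = l u + l v"
    and scale: "\<And>c u. u \<in> V \<Longrightarrow> l (\<lambda>x. c *\<^sub>R u x) = c * l u"
    and definite: "\<And>u. u \<in> V \<Longrightarrow> B u u = 0 \<Longrightarrow> u = (\<lambda>x. 0)"
  shows "\<exists>!u. u \<in> V \<and> (\<forall>w\<in>V. B u w = l w)"
proof -
  have "l (\<lambda>x. 0) = 0" using scale[OF V_zero, of 0] by simp
  then have "\<exists>u\<in>V. \<forall>w\<in>V. B u w = l w" using definite by (intro riesz assms(1) add scale) auto
  moreover have "u = v" if "u \<in> V" "\<forall>w\<in>V. B u w = l w" "v \<in> V" "\<forall>w\<in>V. B v w = l w" for u v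
  proof -
    have d: "(\<lambda>x. u x - v x) \<in> V" using that by (intro V_diff)
    then have "B (\<lambda>x. u x - v x) (\<lambda>x. u x - v x) = 0" using that by (simp add: B_diff)
    then have "(\<lambda>x. u x - v x) = (\<lambda>x. 0)" using definite d by blast
    then show ?thesis by (auto simp: fun_eq_iff)
  qed
  ultimately show ?thesis by blast
qed

end

section \<open>Integration over hyperplanes and cones\<close>

lemma nn_integral_lborel_affine:
  fixes f :: "'a::euclidean_space \<Rightarrow> ennreal"
  assumes [measurable]: "f \<in> borel_measurable borel" and c: "c \<noteq> 0"
  shows "(\<integral>\<^sup>+x. f x \<partial>lborel) = ennreal (\<bar>c\<bar> ^ DIM('a)) * (\<integral>\<^sup>+x. f (t + c *\<^sub>R x) \<partial>lborel)"
  by (subst lborel_affine[OF c, of t])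
     (simp add: nn_integral_density nn_integral_distr nn_integral_cmult)

lemma nn_integral_lborel_shift:
  fixes f :: "'a::euclidean_space \<Rightarrow> ennreal"
  assumes "f \<in> borel_measurable borel"
  shows "(\<integral>\<^sup>+x. f (t + x) \<partial>lborel) = (\<integral>\<^sup>+x. f x \<partial>lborel)"
  using nn_integral_lborel_affine[OF assms, of 1 t] by simp

lemma nn_integral_power_01:
  "(\<integral>\<^sup>+t. ennreal (t ^ k) * indicator {0..1::real} t \<partial>lborel) = ennreal (1 / real (Suc k))"
proof -
  have D: "DERIV (\<lambda>t. t ^ Suc k / real (Suc k)) t :> t ^ k" for t :: real
    by (auto intro!: derivative_eq_intros simp del: of_nat_Suc power_Suc)
  have "(\<integral>\<^sup>+t. ennreal (t ^ k) * indicator {0..1::real} t \<partial>lborel) =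
      ennreal ((\<lambda>t. t ^ Suc k / real (Suc k)) 1 - (\<lambda>t. t ^ Suc k / real (Suc k)) (0::real))"
    by (rule nn_integral_FTC_Icc) (use D in auto)
  then show ?thesis by simp
qed

locale unit_normal =
  fixes n :: "'a::euclidean_space"
  assumes norm_n: "norm n = 1"
begin

definition hplane :: "real \<Rightarrow> 'a set" where "hplane c = {x. n \<bullet> x = c}"
definition proj :: "real \<Rightarrow> 'a \<Rightarrow> 'a" where "proj c x = x - (n \<bullet> x - c) *\<^sub>R n"
abbreviation \<mu> :: "real \<Rightarrow> 'a measure" where "\<mu> c \<equiv> hyperplane_measure (hplane c)"

lemma n_inner_n: "n \<bullet> n = 1"
  using norm_n by (simp add: norm_eq_1)

lemma inner_proj: "n \<bullet> proj c x = c"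
  by (simp add: proj_def inner_diff_right n_inner_n)

lemma proj_in_hplane: "proj c x \<in> hplane c"
  by (simp add: hplane_def inner_proj)

lemma proj_measurable [measurable]: "proj c \<in> borel_measurable borel"
  unfolding proj_def by measurable

lemma closed_hplane: "closed (hplane c)"
  unfolding hplane_def by (rule closed_hyperplane)

lemma closest_point_hplane: "closest_point (hplane c) = proj c"
proof
  fix x
  have "dist x (proj c x) \<le> dist x z" if "z \<in> hplane c" for z
  proof -
    have "dist x (proj c x) = \<bar>n \<bullet> x - c\<bar>" by (simp add: dist_norm proj_def norm_n)
    also have "n \<bullet> x - c = n \<bullet> (x - z)" using that by (simp add: hplane_def inner_diff_right)
    also have "\<bar>n \<bullet> (x - z)\<bar> \<le> norm (x - z)"
      using Cauchy_Schwarz_ineq2[of n "x - z"] by (simp add: norm_n)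
    finally show ?thesis by (simp add: dist_norm)
  qed
  then show "closest_point (hplane c) x = proj c x"
    using closest_point_unique[of "hplane c" "proj c x" x]
    by (simp add: closed_hplane proj_in_hplane) (simp add: hplane_def convex_hyperplane)
qed

lemma infdist_hplane: "infdist x (hplane c) = \<bar>n \<bullet> x - c\<bar>"
  using setdist_closest_point[OF closed_hplane, of c x] proj_in_hplane[of c x]
  by (auto simp: infdist_eq_setdist closest_point_hplane dist_norm proj_def norm_n)

lemma sets_\<mu> [measurable_cong, simp]: "sets (\<mu> c) = sets borel"
  by (simp add: hyperplane_measure_def)

lemma space_\<mu> [simp]: "space (\<mu> c) = UNIV"
  by (simp add: hyperplane_measure_def)

lemma nn_integral_\<mu>:
  assumes [measurable]: "f \<in> borel_measurable borel"
  shows "(\<integral>\<^sup>+y. f y \<partial>\<mu> c) = (\<integral>\<^sup>+x. f (proj c x) * indicator {x. \<bar>n \<bullet> x - c\<bar> \<le> 1/2} x \<partial>lborel)"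
proof -
  have [measurable]: "proj c \<in> measurable (restrict_space lborel A) borel" for A
    by (rule measurable_restrict_space1) simp
  have "{x. infdist x (hplane c) \<le> 1/2} = {x. \<bar>n \<bullet> x - c\<bar> \<le> 1/2}" by (simp add: infdist_hplane)
  then show ?thesis
    unfolding hyperplane_measure_def closest_point_hplane
    by (subst nn_integral_distr) (simp_all add: nn_integral_restrict_space)
qed

lemma AE_\<mu>: "AE y in \<mu> c. n \<bullet> y = c"
proof -
  have "proj c \<in> measurable (restrict_space lborel A) borel" for A
    by (rule measurable_restrict_space1) simp
  then show ?thesis
    unfolding hyperplane_measure_def closest_point_hplane
    by (subst AE_distr_iff) (auto simp: inner_proj)
qed

text \<open>The measure averages over a slab of width one.  Exchanges of the order of integration and a
  translation along n leave, for each x, the length of an interval of length one.\<close>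

lemma nn_integral_lborel_hplanes:
  assumes [measurable]: "f \<in> borel_measurable borel"
  shows "(\<integral>\<^sup>+x. f x \<partial>lborel) = (\<integral>\<^sup>+s. (\<integral>\<^sup>+y. f (y + s *\<^sub>R n) \<partial>\<mu> c) \<partial>lborel)"
proof -
  let ?I = "\<lambda>x. indicator {x. \<bar>n \<bullet> x - c\<bar> \<le> 1/2} x :: ennreal"
  have "(\<integral>\<^sup>+s. (\<integral>\<^sup>+y. f (y + s *\<^sub>R n) \<partial>\<mu> c) \<partial>lborel)
      = (\<integral>\<^sup>+s. (\<integral>\<^sup>+x. f (proj c x + s *\<^sub>R n) * ?I x \<partial>lborel) \<partial>lborel)"
    by (simp add: nn_integral_\<mu>)
  also have "\<dots> = (\<integral>\<^sup>+x. (\<integral>\<^sup>+s. f (proj c x + s *\<^sub>R n) * ?I x \<partial>lborel) \<partial>lborel)"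
    by (rule lborel_pair.Fubini') (simp add: split_beta')
  also have "\<dots> = (\<integral>\<^sup>+x. (\<integral>\<^sup>+s. f (x + s *\<^sub>R n) * ?I x \<partial>lborel) \<partial>lborel)"
  proof (rule nn_integral_cong)
    fix x
    have "(\<integral>\<^sup>+s. f (proj c x + s *\<^sub>R n) * ?I x \<partial>lborel) =
        (\<integral>\<^sup>+s. f (proj c x + ((n \<bullet> x - c) + s) *\<^sub>R n) * ?I x \<partial>lborel)"
      by (subst nn_integral_real_affine[where c=1 and t="n \<bullet> x - c"]) auto
    also have "\<dots> = (\<integral>\<^sup>+s. f (x + s *\<^sub>R n) * ?I x \<partial>lborel)"
      by (simp add: proj_def algebra_simps)
    finally show "(\<integral>\<^sup>+s. f (proj c x + s *\<^sub>R n) * ?I x \<partial>lborel) = \<dots>" .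
  qed
  also have "\<dots> = (\<integral>\<^sup>+s. (\<integral>\<^sup>+x. f (x + s *\<^sub>R n) * ?I x \<partial>lborel) \<partial>lborel)"
    by (rule lborel_pair.Fubini') (simp add: split_beta')
  also have "\<dots> = (\<integral>\<^sup>+s. (\<integral>\<^sup>+x. f x * ?I (x - s *\<^sub>R n) \<partial>lborel) \<partial>lborel)"
  proof (rule nn_integral_cong)
    fix s
    show "(\<integral>\<^sup>+x. f (x + s *\<^sub>R n) * ?I x \<partial>lborel) = (\<integral>\<^sup>+x. f x * ?I (x - s *\<^sub>R n) \<partial>lborel)"
      using nn_integral_lborel_shift[of "\<lambda>x. f x * ?I (x - s *\<^sub>R n)" "s *\<^sub>R n"]
      by (simp add: add.commute)
  qed
  also have "\<dots> = (\<integral>\<^sup>+x. (\<integral>\<^sup>+s. f x * ?I (x - s *\<^sub>R n) \<partial>lborel) \<partial>lborel)"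
    by (rule lborel_pair.Fubini') (simp add: split_beta')
  also have "\<dots> = (\<integral>\<^sup>+x. f x \<partial>lborel)"
  proof (rule nn_integral_cong)
    fix x
    have "?I (x - s *\<^sub>R n) = indicator {n \<bullet> x - c - 1/2 .. n \<bullet> x - c + 1/2} s" for s
      by (auto simp: indicator_def inner_diff_right n_inner_n abs_if field_simps)
    then show "(\<integral>\<^sup>+s. f x * ?I (x - s *\<^sub>R n) \<partial>lborel) = f x"
      by (simp add: nn_integral_cmult)
  qed
  finally show ?thesis by simp
qed

text \<open>After slicing, the integrand does not depend on the height.\<close>

lemma nn_integral_cylinder:
  assumes [measurable]: "f \<in> borel_measurable borel" and "0 \<le> w"
  shows "(\<integral>\<^sup>+x. f (proj c x) * indicator {x. \<bar>n \<bullet> x - c\<bar> \<le> w} x \<partial>lborel) =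
    ennreal (2 * w) * (\<integral>\<^sup>+y. f y \<partial>\<mu> c)"
proof -
  have "(\<integral>\<^sup>+x. f (proj c x) * indicator {x. \<bar>n \<bullet> x - c\<bar> \<le> w} x \<partial>lborel) =
    (\<integral>\<^sup>+s. (\<integral>\<^sup>+y. f (proj c (y + s *\<^sub>R n)) * indicator {x. \<bar>n \<bullet> x - c\<bar> \<le> w} (y + s *\<^sub>R n) \<partial>\<mu> c) \<partial>lborel)"
    by (rule nn_integral_lborel_hplanes) measurable
  also have "\<dots> = (\<integral>\<^sup>+s. (\<integral>\<^sup>+y. f y * indicator {-w..w} s \<partial>\<mu> c) \<partial>lborel)"
  proof (rule nn_integral_cong, rule nn_integral_cong_AE)
    fix s :: real
    show "AE y in \<mu> c. f (proj c (y + s *\<^sub>R n)) * indicator {x. \<bar>n \<bullet> x - c\<bar> \<le> w} (y + s *\<^sub>R n) =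
        f y * indicator {-w..w} s"
      using AE_\<mu>[of c]
    proof eventually_elim
      case (elim y)
      then have "proj c (y + s *\<^sub>R n) = y" "n \<bullet> (y + s *\<^sub>R n) - c = s"
        by (simp_all add: proj_def inner_add_right n_inner_n)
      then show ?case by (simp add: indicator_def abs_le_iff) linarith
    qed
  qed
  also have "\<dots> = (\<integral>\<^sup>+s. (\<integral>\<^sup>+y. f y \<partial>\<mu> c) * indicator {-w..w} s \<partial>lborel)"
    by (intro nn_integral_cong nn_integral_multc) measurable
  also have "\<dots> = (\<integral>\<^sup>+y. f y \<partial>\<mu> c) * emeasure lborel {-w..w}"
    by (rule nn_integral_cmult_indicator) simp
  also have "\<dots> = ennreal (2 * w) * (\<integral>\<^sup>+y. f y \<partial>\<mu> c)"
    using \<open>0 \<le> w\<close> by (simp add: mult.commute)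
  finally show ?thesis .
qed

lemma nn_integral_\<mu>_shift:
  assumes [measurable]: "f \<in> borel_measurable borel"
  shows "(\<integral>\<^sup>+y. f (y + s *\<^sub>R n) \<partial>\<mu> c) = (\<integral>\<^sup>+y. f y \<partial>\<mu> (c + s))"
proof -
  have "(\<integral>\<^sup>+y. f y \<partial>\<mu> (c + s)) =
      (\<integral>\<^sup>+x. f (proj (c + s) x) * indicator {x. \<bar>n \<bullet> x - (c + s)\<bar> \<le> 1/2} x \<partial>lborel)"
    by (rule nn_integral_\<mu>) measurable
  also have "\<dots> = (\<integral>\<^sup>+x. f (proj (c + s) (s *\<^sub>R n + x)) *
      indicator {x. \<bar>n \<bullet> x - (c + s)\<bar> \<le> 1/2} (s *\<^sub>R n + x) \<partial>lborel)"
    by (rule nn_integral_lborel_shift[symmetric]) measurable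
  also have "\<dots> = (\<integral>\<^sup>+x. f (proj c x + s *\<^sub>R n) * indicator {x. \<bar>n \<bullet> x - c\<bar> \<le> 1/2} x \<partial>lborel)"
  proof (rule nn_integral_cong)
    fix x
    have "proj (c + s) (s *\<^sub>R n + x) = proj c x + s *\<^sub>R n"
      by (simp add: proj_def inner_add_right n_inner_n algebra_simps)
    moreover have "n \<bullet> (s *\<^sub>R n + x) - (c + s) = n \<bullet> x - c"
      by (simp add: inner_add_right n_inner_n)
    ultimately show "f (proj (c + s) (s *\<^sub>R n + x)) *
        indicator {x. \<bar>n \<bullet> x - (c + s)\<bar> \<le> 1/2} (s *\<^sub>R n + x) =
      f (proj c x + s *\<^sub>R n) * indicator {x. \<bar>n \<bullet> x - c\<bar> \<le> 1/2} x"
      unfolding indicator_def mem_Collect_eq by (simp only:)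
  qed
  also have "\<dots> = (\<integral>\<^sup>+y. f (y + s *\<^sub>R n) \<partial>\<mu> c)"
    by (rule nn_integral_\<mu>[symmetric]) measurable
  finally show ?thesis by simp
qed

text \<open>Dilation about a by t maps the slab of width one that defines one measure to a slab of width t
  around the other hyperplane; one of the factors in \<open>t ^ DIM('a)\<close> compensates for that width.\<close>

lemma nn_integral_\<mu>_dilation:
  assumes [measurable]: "f \<in> borel_measurable borel" and t: "0 < t" and c: "c = n \<bullet> a + \<delta>"
  shows "(\<integral>\<^sup>+y. f y \<partial>\<mu> (n \<bullet> a + t * \<delta>)) =
    ennreal (t ^ (DIM('a) - 1)) * (\<integral>\<^sup>+y. f (a + t *\<^sub>R (y - a)) \<partial>\<mu> c)"
proof -
  let ?c = "n \<bullet> a + t * \<delta>"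
  have "ennreal t * (\<integral>\<^sup>+y. f y \<partial>\<mu> ?c) =
      (\<integral>\<^sup>+z. f (proj ?c z) * indicator {z. \<bar>n \<bullet> z - ?c\<bar> \<le> t / 2} z \<partial>lborel)"
    using nn_integral_cylinder[of f "t / 2" ?c] t by simp
  also have "\<dots> = ennreal (t ^ DIM('a)) * (\<integral>\<^sup>+x. f (proj ?c ((a - t *\<^sub>R a) + t *\<^sub>R x)) *
      indicator {z. \<bar>n \<bullet> z - ?c\<bar> \<le> t / 2} ((a - t *\<^sub>R a) + t *\<^sub>R x) \<partial>lborel)"
    using t by (subst nn_integral_lborel_affine[where c=t and t="a - t *\<^sub>R a"]) auto
  also have "\<dots> = ennreal (t ^ DIM('a)) * (\<integral>\<^sup>+x. f (a + t *\<^sub>R (proj c x - a)) *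
      indicator {x. \<bar>n \<bullet> x - c\<bar> \<le> 1 / 2} x \<partial>lborel)"
  proof (rule arg_cong2[where f="(*)", OF refl], rule nn_integral_cong)
    fix x
    have *: "n \<bullet> ((a - t *\<^sub>R a) + t *\<^sub>R x) - ?c = t * (n \<bullet> x - c)"
      by (simp add: c inner_add_right inner_diff_right algebra_simps)
    have "\<bar>t * (n \<bullet> x - c)\<bar> \<le> t / 2 \<longleftrightarrow> \<bar>n \<bullet> x - c\<bar> \<le> 1 / 2"
      using t mult_le_cancel_left_pos[OF t, of "\<bar>n \<bullet> x - c\<bar>" "1/2"] by (simp add: abs_mult)
    moreover have "proj ?c ((a - t *\<^sub>R a) + t *\<^sub>R x) = a + t *\<^sub>R (proj c x - a)"
      unfolding proj_def * by (simp add: algebra_simps)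
    ultimately show "f (proj ?c ((a - t *\<^sub>R a) + t *\<^sub>R x)) *
        indicator {z. \<bar>n \<bullet> z - ?c\<bar> \<le> t / 2} ((a - t *\<^sub>R a) + t *\<^sub>R x) =
      f (a + t *\<^sub>R (proj c x - a)) * indicator {x. \<bar>n \<bullet> x - c\<bar> \<le> 1 / 2} x"
      unfolding indicator_def mem_Collect_eq * by simp
  qed
  also have "\<dots> = ennreal (t ^ DIM('a)) * (\<integral>\<^sup>+y. f (a + t *\<^sub>R (y - a)) \<partial>\<mu> c)"
    by (subst nn_integral_\<mu>) simp_all
  also have "t ^ DIM('a) = t * t ^ (DIM('a) - 1)"
    using DIM_positive[where 'a='a] by (metis Suc_pred' power_Suc)
  finally have "ennreal t * (\<integral>\<^sup>+y. f y \<partial>\<mu> ?c) =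
      ennreal t * (ennreal (t ^ (DIM('a) - 1)) * (\<integral>\<^sup>+y. f (a + t *\<^sub>R (y - a)) \<partial>\<mu> c))"
    using t by (simp add: ennreal_mult mult.assoc)
  then show ?thesis using t by (simp add: ennreal_mult_cancel_left)
qed

text \<open>The hyperplane at distance \<open>t * \<delta>\<close> from a is the dilate by t of the one at distance \<open>\<delta>\<close>.\<close>

lemma nn_integral_polar:
  assumes [measurable]: "f \<in> borel_measurable borel" and \<delta>: "0 < \<delta>" and c: "c = n \<bullet> a + \<delta>"
    and f0: "\<And>x. n \<bullet> (x - a) \<le> 0 \<Longrightarrow> f x = 0"
  shows "(\<integral>\<^sup>+x. f x \<partial>lborel) = (\<integral>\<^sup>+t. ennreal (\<delta> * t ^ (DIM('a) - 1)) *
    (\<integral>\<^sup>+y. f (a + t *\<^sub>R (y - a)) \<partial>\<mu> c) * indicator {0<..} t \<partial>lborel)"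
proof -
  have "(\<integral>\<^sup>+x. f x \<partial>lborel) = (\<integral>\<^sup>+s. (\<integral>\<^sup>+y. f (y + s *\<^sub>R n) \<partial>\<mu> c) \<partial>lborel)"
    by (rule nn_integral_lborel_hplanes) measurable
  also have "\<dots> = (\<integral>\<^sup>+s. (\<integral>\<^sup>+y. f y \<partial>\<mu> (c + s)) \<partial>lborel)"
    by (simp add: nn_integral_\<mu>_shift)
  also have "\<dots> = ennreal \<delta> * (\<integral>\<^sup>+t. (\<integral>\<^sup>+y. f y \<partial>\<mu> (n \<bullet> a + t * \<delta>)) \<partial>lborel)"
  proof -
    have [measurable]: "(\<lambda>s. \<integral>\<^sup>+y. f (y + s *\<^sub>R n) \<partial>\<mu> c) \<in> borel_measurable borel"
      by (simp add: nn_integral_\<mu>) measurable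
    then have "(\<lambda>s. \<integral>\<^sup>+y. f y \<partial>\<mu> (c + s)) \<in> borel_measurable borel"
      by (simp add: nn_integral_\<mu>_shift)
    from nn_integral_real_affine[OF this, of \<delta> "-\<delta>"] show ?thesis
      using \<delta> by (simp add: c algebra_simps)
  qed
  also have "\<dots> = (\<integral>\<^sup>+t. ennreal \<delta> * (\<integral>\<^sup>+y. f y \<partial>\<mu> (n \<bullet> a + t * \<delta>)) \<partial>lborel)"
  proof (rule nn_integral_cmult[symmetric])
    have [measurable]: "(\<lambda>s. \<integral>\<^sup>+y. f (y + s *\<^sub>R n) \<partial>\<mu> (n \<bullet> a)) \<in> borel_measurable borel"
      by (simp add: nn_integral_\<mu>) measurable
    have "(\<lambda>t. \<integral>\<^sup>+y. f (y + (t * \<delta>) *\<^sub>R n) \<partial>\<mu> (n \<bullet> a)) \<in> borel_measurable borel"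
      by measurable
    then show "(\<lambda>t. \<integral>\<^sup>+y. f y \<partial>\<mu> (n \<bullet> a + t * \<delta>)) \<in> borel_measurable lborel"
      by (simp add: nn_integral_\<mu>_shift)
  qed
  also have "\<dots> = (\<integral>\<^sup>+t. ennreal (\<delta> * t ^ (DIM('a) - 1)) *
    (\<integral>\<^sup>+y. f (a + t *\<^sub>R (y - a)) \<partial>\<mu> c) * indicator {0<..} t \<partial>lborel)"
  proof (rule nn_integral_cong)
    fix t :: real
    show "ennreal \<delta> * (\<integral>\<^sup>+y. f y \<partial>\<mu> (n \<bullet> a + t * \<delta>)) = ennreal (\<delta> * t ^ (DIM('a) - 1)) *
      (\<integral>\<^sup>+y. f (a + t *\<^sub>R (y - a)) \<partial>\<mu> c) * indicator {0<..} t"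
    proof (cases "0 < t")
      case True
      then show ?thesis
        using nn_integral_\<mu>_dilation[OF assms(1) True c] \<delta> by (simp add: ennreal_mult mult.assoc)
    next
      case False
      then have "t * \<delta> \<le> 0" using \<delta> by (simp add: mult_le_0_iff)
      have "(\<integral>\<^sup>+y. f y \<partial>\<mu> (n \<bullet> a + t * \<delta>)) = (\<integral>\<^sup>+y. 0 \<partial>\<mu> (n \<bullet> a + t * \<delta>))"
        using AE_\<mu>
      proof (intro nn_integral_cong_AE, eventually_elim)
        case (elim y)
        then show ?case using f0[of y] \<open>t * \<delta> \<le> 0\<close> by (simp add: inner_diff_right)
      qed
      then show ?thesis using False by simp
    qed
  qed
  finally show ?thesis .
qed

lemma finite_\<mu>:
  assumes "bounded F" "F \<in> sets borel"
  shows "emeasure (\<mu> c) F < \<infinity>"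
proof -
  have [measurable]: "F \<in> sets borel" by fact
  obtain R where R: "\<And>x. x \<in> F \<Longrightarrow> norm x \<le> R" using assms(1) unfolding bounded_iff by blast
  have "emeasure (\<mu> c) F = (\<integral>\<^sup>+y. indicator F y \<partial>\<mu> c)" using assms by simp
  also have "\<dots> = (\<integral>\<^sup>+x. indicator F (proj c x) * indicator {x. \<bar>n \<bullet> x - c\<bar> \<le> 1/2} x \<partial>lborel)"
    by (rule nn_integral_\<mu>) measurable
  also have "\<dots> \<le> (\<integral>\<^sup>+x. indicator (cball (0::'a) (R + 1)) x \<partial>lborel)"
  proof (rule nn_integral_mono)
    fix x
    have "norm x \<le> R + 1" if "proj c x \<in> F" "\<bar>n \<bullet> x - c\<bar> \<le> 1/2"
    proof -
      have "norm (proj c x + (n \<bullet> x - c) *\<^sub>R n) \<le> norm (proj c x) + norm ((n \<bullet> x - c) *\<^sub>R n)"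
        by (rule norm_triangle_ineq)
      then show ?thesis using that R[of "proj c x"] by (simp add: norm_n) (simp add: proj_def)
    qed
    then show "indicator F (proj c x) * indicator {x. \<bar>n \<bullet> x - c\<bar> \<le> 1/2} x
        \<le> (indicator (cball (0::'a) (R + 1)) x :: ennreal)"
      by (auto simp: indicator_def)
  qed
  also have "\<dots> = emeasure lborel (cball (0::'a) (R + 1))" by simp
  also have "\<dots> < \<infinity>" by (rule emeasure_lborel_cball_finite)
  finally show ?thesis .
qed

text \<open>For a homogeneous integrand the radial integral in polar coordinates is that of a power of t.\<close>

lemma nn_integral_cone:
  assumes F: "F \<subseteq> hplane c" and [measurable]: "F \<in> sets borel"
    and \<delta>: "0 < \<delta>" and c: "c = n \<bullet> a + \<delta>"
    and P: "P = {a + t *\<^sub>R (y - a) |t y. 0 < t \<and> t < 1 \<and> y \<in> F}" and [measurable]: "P \<in> sets borel"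
    and [measurable]: "g \<in> borel_measurable borel"
    and hom: "\<And>t y. 0 < t \<Longrightarrow> t < 1 \<Longrightarrow> y \<in> F \<Longrightarrow> g (a + t *\<^sub>R (y - a)) = t ^ j * (g y :: real)"
  shows "(\<integral>\<^sup>+x. ennreal (g x) * indicator P x \<partial>lborel) =
    ennreal (\<delta> / (real j + DIM('a))) * (\<integral>\<^sup>+y. ennreal (g y) * indicator F y \<partial>\<mu> c)"
proof -
  have ray: "n \<bullet> (y - a) = \<delta>" if "n \<bullet> y = c" for y using that c by (simp add: inner_diff_right)
  have P_iff: "a + t *\<^sub>R (y - a) \<in> P \<longleftrightarrow> t < 1 \<and> y \<in> F" if "n \<bullet> y = c" "0 < t" for t y
  proof
    assume "a + t *\<^sub>R (y - a) \<in> P"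
    then obtain t' y' where *: "a + t *\<^sub>R (y - a) = a + t' *\<^sub>R (y' - a)" "0 < t'" "t' < 1" "y' \<in> F"
      unfolding P by auto
    then have "n \<bullet> (t *\<^sub>R (y - a)) = n \<bullet> (t' *\<^sub>R (y' - a))" by simp
    moreover have "n \<bullet> y' = c" using * F by (auto simp: hplane_def)
    ultimately have "t = t'" using ray[OF that(1)] ray[of y'] \<delta> by simp
    then show "t < 1 \<and> y \<in> F" using * that(2) by simp
  next
    assume "t < 1 \<and> y \<in> F"
    then show "a + t *\<^sub>R (y - a) \<in> P" using that(2) unfolding P by blast
  qed
  have "(\<integral>\<^sup>+x. ennreal (g x) * indicator P x \<partial>lborel) =
    (\<integral>\<^sup>+t. ennreal (\<delta> * t ^ (DIM('a) - 1)) *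
      (\<integral>\<^sup>+y. ennreal (g (a + t *\<^sub>R (y - a))) * indicator P (a + t *\<^sub>R (y - a)) \<partial>\<mu> c) *
      indicator {0<..} t \<partial>lborel)"
  proof (rule nn_integral_polar[OF _ \<delta> c])
    fix x assume x: "n \<bullet> (x - a) \<le> 0"
    have "x \<notin> P"
    proof
      assume "x \<in> P"
      then obtain t y where "x = a + t *\<^sub>R (y - a)" "0 < t" "y \<in> F" unfolding P by auto
      then show False using x ray[of y] F \<delta> by (auto simp: hplane_def mult_le_0_iff)
    qed
    then show "ennreal (g x) * indicator P x = 0" by simp
  qed measurable
  also have "\<dots> = (\<integral>\<^sup>+t. ennreal \<delta> * (\<integral>\<^sup>+y. ennreal (g y) * indicator F y \<partial>\<mu> c) *
      (ennreal (t ^ (DIM('a) - 1 + j)) * indicator {0..1} t) \<partial>lborel)"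
  proof (rule nn_integral_cong_AE)
    have "AE t in lborel. t \<noteq> (0::real) \<and> t \<noteq> 1"
      using AE_lborel_singleton[of "0::real"] AE_lborel_singleton[of "1::real"] by eventually_elim simp
    then show "AE t in lborel. ennreal (\<delta> * t ^ (DIM('a) - 1)) *
      (\<integral>\<^sup>+y. ennreal (g (a + t *\<^sub>R (y - a))) * indicator P (a + t *\<^sub>R (y - a)) \<partial>\<mu> c) *
      indicator {0<..} t = ennreal \<delta> * (\<integral>\<^sup>+y. ennreal (g y) * indicator F y \<partial>\<mu> c) *
      (ennreal (t ^ (DIM('a) - 1 + j)) * indicator {0..1} t)"
    proof eventually_elim
      case (elim t)
      consider "t < 0" | "0 < t" "t < 1" | "1 < t" using elim by linarith
      then show ?case
      proof cases
        case 2
        have "(\<integral>\<^sup>+y. ennreal (g (a + t *\<^sub>R (y - a))) * indicator P (a + t *\<^sub>R (y - a)) \<partial>\<mu> c) =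
            (\<integral>\<^sup>+y. ennreal (t ^ j) * (ennreal (g y) * indicator F y) \<partial>\<mu> c)"
        proof (rule nn_integral_cong_AE)
          show "AE y in \<mu> c. ennreal (g (a + t *\<^sub>R (y - a))) * indicator P (a + t *\<^sub>R (y - a)) =
              ennreal (t ^ j) * (ennreal (g y) * indicator F y)"
            using AE_\<mu>[of c]
          proof eventually_elim
            fix y assume y: "n \<bullet> y = c"
            show "ennreal (g (a + t *\<^sub>R (y - a))) * indicator P (a + t *\<^sub>R (y - a)) =
                ennreal (t ^ j) * (ennreal (g y) * indicator F y)"
              using P_iff[OF y 2(1)] 2 hom[OF 2, of y]
              by (cases "y \<in> F") (simp_all add: ennreal_mult')
          qed
        qed
        also have "\<dots> = ennreal (t ^ j) * (\<integral>\<^sup>+y. ennreal (g y) * indicator F y \<partial>\<mu> c)"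
          by (rule nn_integral_cmult) measurable
        finally show ?thesis unfolding power_add using 2 \<delta>
          by (simp add: ennreal_mult mult_ac)
      next
        case 3
        have "(\<integral>\<^sup>+y. ennreal (g (a + t *\<^sub>R (y - a))) * indicator P (a + t *\<^sub>R (y - a)) \<partial>\<mu> c) =
            (\<integral>\<^sup>+y. 0 \<partial>\<mu> c)"
        proof (rule nn_integral_cong_AE)
          show "AE y in \<mu> c. ennreal (g (a + t *\<^sub>R (y - a))) * indicator P (a + t *\<^sub>R (y - a)) = 0"
            using AE_\<mu>[of c]
          proof eventually_elim
            fix y assume "n \<bullet> y = c"
            then show "ennreal (g (a + t *\<^sub>R (y - a))) * indicator P (a + t *\<^sub>R (y - a)) = 0"
              using P_iff[of y t] 3 by simp
          qed
        qed
        then show ?thesis using 3 by simp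
      qed simp
    qed
  qed
  also have "\<dots> = ennreal \<delta> * (\<integral>\<^sup>+y. ennreal (g y) * indicator F y \<partial>\<mu> c) *
      (\<integral>\<^sup>+t. ennreal (t ^ (DIM('a) - 1 + j)) * indicator {0..1} t \<partial>lborel)"
    by (rule nn_integral_cmult) measurable
  also have "(\<integral>\<^sup>+t. ennreal (t ^ (DIM('a) - 1 + j)) * indicator {0..1} t \<partial>lborel) =
      ennreal (1 / (real j + DIM('a)))"
  proof -
    let ?k = "DIM('a) - 1 + j"
    have k: "real (Suc ?k) = real j + DIM('a)" using DIM_positive[where 'a='a] by simp
    show ?thesis using nn_integral_power_01[of ?k] unfolding k .
  qed
  finally show ?thesis
    using \<delta> by (simp add: mult_ac ennreal_mult[symmetric])
       (simp add: mult.assoc[symmetric] ennreal_mult[symmetric])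
qed

lemma integral_cone:
  assumes F: "F \<subseteq> hplane c" "F \<in> sets borel" "bounded F"
    and \<delta>: "0 < \<delta>" and c: "c = n \<bullet> a + \<delta>"
    and P: "P = {a + t *\<^sub>R (y - a) |t y. 0 < t \<and> t < 1 \<and> y \<in> F}" "P \<in> sets borel"
    and int: "set_integrable lborel P g" "set_integrable (\<mu> c) F g"
    and g: "g \<in> borel_measurable borel"
    and hom: "\<And>t y. 0 < t \<Longrightarrow> t < 1 \<Longrightarrow> y \<in> F \<Longrightarrow> g (a + t *\<^sub>R (y - a)) = t ^ j * (g y :: real)"
  shows "(LINT x:P|lborel. g x) = \<delta> / (real j + DIM('a)) * (LINT y:F|\<mu> c. g y)"
proof -
  have parts: "(LINT x:A|M. g x) = enn2real (\<integral>\<^sup>+x. ennreal (g x) * indicator A x \<partial>M) -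
      enn2real (\<integral>\<^sup>+x. ennreal (- g x) * indicator A x \<partial>M)"
    if "set_integrable M A g" for A and M :: "'a measure"
    using that unfolding set_lebesgue_integral_def set_integrable_def
    by (subst real_lebesgue_integral_def, assumption)
       (intro arg_cong2[where f="(-)"] arg_cong[where f=enn2real] nn_integral_cong,
        auto simp: indicator_def)
  have [measurable]: "(\<lambda>x. - g x) \<in> borel_measurable borel" using g by simp
  have pos: "enn2real (\<integral>\<^sup>+x. ennreal (h x) * indicator P x \<partial>lborel) =
    \<delta> / (real j + DIM('a)) * enn2real (\<integral>\<^sup>+y. ennreal (h y) * indicator F y \<partial>\<mu> c)"
    if "h \<in> borel_measurable borel"
      "\<And>t y. 0 < t \<Longrightarrow> t < 1 \<Longrightarrow> y \<in> F \<Longrightarrow> h (a + t *\<^sub>R (y - a)) = t ^ j * h y" for h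
    using nn_integral_cone[OF F(1,2) \<delta> c P that] \<delta> by (simp add: enn2real_mult)
  show ?thesis
    unfolding parts[OF int(1)] parts[OF int(2)]
    by (subst pos[of g], (simp_all add: g hom)[2], subst pos[of "\<lambda>x. - g x"])
       (simp_all add: g hom right_diff_distrib)
qed

end

section \<open>The L2 product on polynomial spaces\<close>

text \<open>Elements, pyramids, balls and faces are such regions; products of continuous functions are
  integrable on them.\<close>

definition finite_region :: "'a::euclidean_space measure \<Rightarrow> 'a set \<Rightarrow> bool" where
  "finite_region M X \<longleftrightarrow> sets M = sets borel \<and> X \<in> sets borel \<and> bounded X \<and> emeasure M X < \<infinity>"

lemma finite_region_lborel: "bounded X \<Longrightarrow> X \<in> sets borel \<Longrightarrow> finite_region lborel X"
  using emeasure_bounded_finite[of X] by (simp add: finite_region_def)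

lemma set_integrable_continuous:
  fixes f :: "'a::euclidean_space \<Rightarrow> 'b::{banach, second_countable_topology}"
  assumes M: "finite_region M X" and f: "continuous_on UNIV f"
  shows "set_integrable M X f"
proof -
  have "compact (f ` closure X)"
    using M f by (intro compact_continuous_image continuous_on_subset[OF f])
      (auto simp: finite_region_def compact_closure)
  then obtain K where K: "\<And>y. y \<in> f ` closure X \<Longrightarrow> norm y \<le> K"
    using compact_imp_bounded bounded_iff by metis
  have "f \<in> borel_measurable M"
    using M borel_measurable_continuous_onI[OF f] measurable_cong_sets[of M borel borel borel]
    by (auto simp: finite_region_def)
  then show ?thesis
    unfolding set_integrable_def
    using M K closure_subset[of X]
    by (intro integrableI_bounded_set_indicator[where B=K]) (auto simp: finite_region_def)
qed

abbreviation continuous_functions :: "('a::topological_space \<Rightarrow> 'b::topological_space) set" where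
  "continuous_functions \<equiv> Collect (continuous_on UNIV)"

lemma L2_integrable:
  fixes f g :: "'a::euclidean_space \<Rightarrow> 'b::euclidean_space"
  assumes "finite_region M X" "continuous_on UNIV f" "continuous_on UNIV g"
  shows "set_integrable M X (\<lambda>x. f x \<bullet> g x)"
  using assms by (intro set_integrable_continuous continuous_on_inner)

lemma L2_semi_inner:
  assumes M: "finite_region M X"
  shows "semi_inner_space (continuous_functions :: ('a::euclidean_space \<Rightarrow> 'b::euclidean_space) set)
    (L2_inner M X)"
proof
  fix u v w :: "'a \<Rightarrow> 'b" and c :: real
  assume "u \<in> continuous_functions"
  then have u: "continuous_on UNIV u" by simp
  show "0 \<le> L2_inner M X u u"
    unfolding L2_inner_def set_lebesgue_integral_def by (intro integral_nonneg_AE) auto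
  show "(\<lambda>x. c *\<^sub>R u x) \<in> continuous_functions" using u by (auto intro: continuous_intros)
  {
    assume "v \<in> continuous_functions"
    then have v: "continuous_on UNIV v" by simp
    then show "(\<lambda>x. u x + v x) \<in> continuous_functions" using u by (auto intro: continuous_intros)
    show "L2_inner M X u v = L2_inner M X v u" by (simp add: L2_inner_def inner_commute)
    assume "w \<in> continuous_functions"
    then have w: "continuous_on UNIV w" by simp
    show "L2_inner M X (\<lambda>x. u x + v x) w = L2_inner M X u w + L2_inner M X v w"
      unfolding L2_inner_def inner_add_left
      by (rule set_integral_add) (intro L2_integrable M u v w)+
  }
  show "L2_inner M X (\<lambda>x. c *\<^sub>R u x) w = c * L2_inner M X u w"
    by (simp add: L2_inner_def)
qed auto

lemma semi_inner_space_subspace: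
  assumes "semi_inner_space W B" "V \<subseteq> W"
    and "(\<lambda>x. 0) \<in> V" "\<And>u v. u \<in> V \<Longrightarrow> v \<in> V \<Longrightarrow> (\<lambda>x. u x + v x) \<in> V"
    "\<And>u c. u \<in> V \<Longrightarrow> (\<lambda>x. c *\<^sub>R u x) \<in> V"
  shows "semi_inner_space V B"
proof -
  interpret W: semi_inner_space W B by fact
  show ?thesis
    by unfold_locales
       ((rule assms(3-5) W.B_sym W.B_add W.B_scale W.B_nonneg;
         (assumption | erule subsetD[OF assms(2)])?)+)
qed

lemma poly_fields_continuous:
  assumes "\<phi> \<in> poly_fields m"
  shows "continuous_on X \<phi>"
proof -
  have "continuous_on X (\<lambda>x. \<Sum>b\<in>Basis. (\<phi> x \<bullet> b) *\<^sub>R b)"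
    using assms by (intro continuous_intros poly_space_continuous[where m=m]) (auto simp: poly_fields_def)
  then show ?thesis by (simp add: euclidean_representation)
qed

lemma poly_fields_zero: "(\<lambda>x. 0) \<in> poly_fields m"
  by (simp add: poly_fields_def poly_space_zero)

lemma poly_fields_add:
  "\<phi> \<in> poly_fields m \<Longrightarrow> \<psi> \<in> poly_fields m \<Longrightarrow> (\<lambda>x. \<phi> x + \<psi> x) \<in> poly_fields m"
  by (simp add: poly_fields_def inner_add_left poly_space_add)

lemma poly_fields_scale: "\<phi> \<in> poly_fields m \<Longrightarrow> (\<lambda>x. c *\<^sub>R \<phi> x) \<in> poly_fields m"
  by (simp add: poly_fields_def poly_space_cmult)

lemma poly_fields_diff:
  "\<phi> \<in> poly_fields m \<Longrightarrow> \<psi> \<in> poly_fields m \<Longrightarrow> (\<lambda>x. \<phi> x - \<psi> x) \<in> poly_fields m"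
  by (simp add: poly_fields_def inner_diff_left poly_space_diff)

lemma poly_fields_mono: "m \<le> m' \<Longrightarrow> poly_fields m \<subseteq> poly_fields m'"
  using poly_space_mono by (fastforce simp: poly_fields_def)

lemma poly_fields_mult:
  assumes "q \<in> poly_space m" "\<phi> \<in> poly_fields j"
  shows "(\<lambda>x. q x *\<^sub>R \<phi> x) \<in> poly_fields (m + j)"
  using assms by (auto simp: poly_fields_def poly_space_mult)

lemma poly_fields_const: "0 \<le> m \<Longrightarrow> (\<lambda>x. v) \<in> poly_fields m"
  by (simp add: poly_fields_def poly_space_const)

lemma poly_fields_id: "(\<lambda>x. x) \<in> poly_fields 1"
  by (simp add: poly_fields_def poly_space_inner)

lemma poly_fields_inner:
  assumes "\<phi> \<in> poly_fields m"
  shows "(\<lambda>x. \<phi> x \<bullet> v) \<in> poly_space m"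
proof -
  have "(\<lambda>x. \<Sum>b\<in>Basis. (v \<bullet> b) * (\<phi> x \<bullet> b)) \<in> poly_space m"
    using assms by (intro poly_space_sum poly_space_cmult) (auto simp: poly_fields_def)
  then show ?thesis by (simp add: euclidean_inner[of _ v] mult.commute)
qed

lemma RT_spaceI:
  assumes "\<phi> \<in> poly_fields m" "q \<in> poly_space m" "\<And>x. \<eta> x = \<phi> x + q x *\<^sub>R x"
  shows "\<eta> \<in> RT_space m"
  unfolding RT_space_def mem_Collect_eq
  by (intro bexI[of _ \<phi>] bexI[of _ q] ext assms)

lemma RT_spaceE:
  assumes "\<eta> \<in> RT_space m"
  obtains \<phi> q where "\<phi> \<in> poly_fields m" "q \<in> poly_space m" "\<eta> = (\<lambda>x. \<phi> x + q x *\<^sub>R x)"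
  using assms unfolding RT_space_def by blast

lemma poly_fields_subset_RT_space: "poly_fields m \<subseteq> RT_space m"
  by (rule subsetI, rule RT_spaceI[OF _ poly_space_zero]) auto

lemma RT_space_subset_poly_fields: "RT_space m \<subseteq> poly_fields (m + 1)"
proof
  fix \<eta> :: "'a \<Rightarrow> 'a" assume "\<eta> \<in> RT_space m"
  from RT_spaceE[OF this] obtain \<phi> q
    where *: "\<phi> \<in> poly_fields m" "q \<in> poly_space m" "\<eta> = (\<lambda>x. \<phi> x + q x *\<^sub>R x)" .
  have "(\<lambda>x. \<phi> x + q x *\<^sub>R x) \<in> poly_fields (m + 1)"
    using poly_fields_mult[OF *(2) poly_fields_id] poly_fields_mono[of m "m + 1"] *(1)
    by (intro poly_fields_add) auto
  then show "\<eta> \<in> poly_fields (m + 1)" using *(3) by simp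
qed

lemma RT_space_zero: "(\<lambda>x. 0) \<in> RT_space m"
  using poly_fields_subset_RT_space poly_fields_zero by blast

lemma RT_space_add:
  assumes "\<eta> \<in> RT_space m" "\<theta> \<in> RT_space m"
  shows "(\<lambda>x. \<eta> x + \<theta> x) \<in> RT_space m"
proof -
  obtain \<phi> q where 1: "\<phi> \<in> poly_fields m" "q \<in> poly_space m" "\<eta> = (\<lambda>x. \<phi> x + q x *\<^sub>R x)"
    using RT_spaceE[OF assms(1)] .
  obtain \<psi> r where 2: "\<psi> \<in> poly_fields m" "r \<in> poly_space m" "\<theta> = (\<lambda>x. \<psi> x + r x *\<^sub>R x)"
    using RT_spaceE[OF assms(2)] .
  show ?thesis
    by (rule RT_spaceI[OF poly_fields_add[OF 1(1) 2(1)] poly_space_add[OF 1(2) 2(2)]])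
       (simp add: 1(3) 2(3) algebra_simps)
qed

lemma RT_space_scale:
  assumes "\<eta> \<in> RT_space m"
  shows "(\<lambda>x. c *\<^sub>R \<eta> x) \<in> RT_space m"
proof -
  obtain \<phi> q where 1: "\<phi> \<in> poly_fields m" "q \<in> poly_space m" "\<eta> = (\<lambda>x. \<phi> x + q x *\<^sub>R x)"
    using RT_spaceE[OF assms(1)] .
  show ?thesis
    by (rule RT_spaceI[OF poly_fields_scale[OF 1(1), of c] poly_space_cmult[OF 1(2), of c]])
       (simp add: 1(3) algebra_simps)
qed

text \<open>The function vanishes almost everywhere on X, and its zero set is closed.\<close>

lemma L2_zero_on_open:
  fixes f :: "'a::euclidean_space \<Rightarrow> 'b::euclidean_space"
  assumes X: "open X" "bounded X" and f: "continuous_on UNIV f" and z: "inner_on X f f = 0"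
    and x: "x \<in> X"
  shows "f x = 0"
proof -
  have "finite_region lborel X" using X by (intro finite_region_lborel) auto
  then have "set_integrable lborel X (\<lambda>x. f x \<bullet> f x)" using f by (intro L2_integrable)
  then have "AE x in lborel. indicator X x *\<^sub>R (f x \<bullet> f x) = 0"
    using z unfolding L2_inner_def set_lebesgue_integral_def set_integrable_def
    by (subst (asm) integral_nonneg_eq_0_iff_AE) auto
  then have "AE x in lborel. x \<in> X \<longrightarrow> x \<in> {x. f x = 0}"
    by eventually_elim (auto simp: indicator_def split: if_splits)
  then have "AE x\<in>X in lebesgue. x \<in> {x. f x = 0}" by (rule AE_completion)
  moreover have "closed {x. f x = 0}"
    using f by (intro closed_Collect_eq continuous_intros)
  ultimately have "x \<in> {x. f x = 0}"
    using mem_closed_if_AE_lebesgue_open[OF X(1), of "{x. f x = 0}" x] x by blast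
  then show ?thesis by simp
qed

lemma poly_fields_eq_0:
  fixes \<phi> :: "'a::euclidean_space \<Rightarrow> 'a"
  assumes "\<phi> \<in> poly_fields m" and "open U" "U \<noteq> {}" and "\<And>x. x \<in> U \<Longrightarrow> \<phi> x = 0"
  shows "\<phi> = (\<lambda>x. 0)"
proof
  fix x
  obtain a where "a \<in> U" using assms by blast
  have "\<phi> x \<bullet> b = 0" if "b \<in> Basis" for b
    using poly_space_eq_0[of "\<lambda>x. \<phi> x \<bullet> b" m U a x] assms that \<open>a \<in> U\<close> by (auto simp: poly_fields_def)
  then show "\<phi> x = 0" using euclidean_all_zero_iff by blast
qed

lemma poly_fields_L2_definite:
  fixes \<phi> :: "'a::euclidean_space \<Rightarrow> 'a"
  assumes "\<phi> \<in> poly_fields m" and U: "open U" "U \<noteq> {}" "bounded U" and "inner_on U \<phi> \<phi> = 0"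
  shows "\<phi> = (\<lambda>x. 0)"
  using poly_fields_eq_0[OF assms(1) U(1,2)] L2_zero_on_open[OF U(1,3) poly_fields_continuous[OF assms(1)] assms(5)]
  by blast

lemma poly_space_L2_definite:
  fixes q :: "'a::euclidean_space \<Rightarrow> real"
  assumes "q \<in> poly_space m" and U: "open U" "U \<noteq> {}" "bounded U" and "inner_on U q q = 0"
  shows "q = (\<lambda>x. 0)"
proof
  fix x
  obtain a where "a \<in> U" using U by blast
  then show "q x = 0"
    using poly_space_eq_0[OF assms(1) U(1) \<open>a \<in> U\<close>]
      L2_zero_on_open[OF U(1,3) poly_space_continuous[OF assms(1)] assms(5)] by blast
qed

lemma poly_space_semi_inner:
  assumes "finite_region M X"
  shows "semi_inner_space (poly_space m) (L2_inner M X)"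
  by (rule semi_inner_space_subspace[OF L2_semi_inner[OF assms]])
     (auto simp: poly_space_zero poly_space_add poly_space_cmult poly_space_continuous)

lemma poly_fields_semi_inner:
  assumes "finite_region M X"
  shows "semi_inner_space (poly_fields m) (L2_inner M X)"
  by (rule semi_inner_space_subspace[OF L2_semi_inner[OF assms]])
     (auto simp: poly_fields_zero poly_fields_add poly_fields_scale poly_fields_continuous)

lemma RT_space_semi_inner:
  assumes "finite_region M X"
  shows "semi_inner_space (RT_space m) (L2_inner M X)"
  by (rule semi_inner_space_subspace[OF poly_fields_semi_inner[OF assms, of "m + 1"]])
     (use RT_space_subset_poly_fields in \<open>auto simp: RT_space_zero RT_space_add RT_space_scale\<close>)

lemma L2_mono:
  fixes f :: "'a::euclidean_space \<Rightarrow> 'b::euclidean_space"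
  assumes M: "finite_region M Y" and X: "X \<in> sets borel" "X \<subseteq> Y" and f: "continuous_on UNIV f"
  shows "L2_inner M X f f \<le> L2_inner M Y f f"
proof -
  have "bounded X" using M X bounded_subset by (auto simp: finite_region_def)
  moreover have "emeasure M X \<le> emeasure M Y"
    using M X by (intro emeasure_mono) (auto simp: finite_region_def)
  ultimately have "finite_region M X" using M X by (auto simp: finite_region_def)
  then have "set_integrable M X (\<lambda>x. f x \<bullet> f x)" "set_integrable M Y (\<lambda>x. f x \<bullet> f x)"
    using M f by (auto intro!: L2_integrable)
  then show ?thesis
    unfolding L2_inner_def set_lebesgue_integral_def set_integrable_def
    using X by (intro integral_mono) (auto simp: indicator_def)
qed

lemma integral_lborel_affine:
  fixes f :: "'a::euclidean_space \<Rightarrow> real"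
  assumes [measurable]: "f \<in> borel_measurable borel" and c: "c \<noteq> 0"
  shows "(\<integral>x. f x \<partial>lborel) = \<bar>c\<bar> ^ DIM('a) * (\<integral>x. f (t + c *\<^sub>R x) \<partial>lborel)"
  by (subst lborel_affine[OF c, of t]) (simp add: integral_density integral_distr)

text \<open>On the unit ball the polynomial is expanded in an orthonormal basis, whose elements are bounded on
  the ball of radius R; dilation carries the bound to every ball with the same constant.\<close>

lemma poly_space_sup_bound:
  fixes R :: real
  shows "\<exists>C>0. \<forall>q\<in>(poly_space m :: ('a::euclidean_space \<Rightarrow> real) set). \<forall>c r x. 0 < r \<longrightarrow>
    dist c x \<le> R * r \<longrightarrow> (q x)\<^sup>2 * r ^ DIM('a) \<le> C * inner_on (ball c r) q q"
proof -
  let ?B = "inner_on (ball (0::'a) 1)"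
  let ?V = "poly_space m :: ('a \<Rightarrow> real) set"
  have reg: "finite_region lborel (ball (0::'a) 1)" by (rule finite_region_lborel) auto
  interpret semi_inner_space ?V ?B by (rule poly_space_semi_inner[OF reg])
  obtain n e where e: "\<And>i. i < n \<Longrightarrow> e i \<in> ?V"
    "\<And>i j. i < n \<Longrightarrow> j < n \<Longrightarrow> ?B (e i) (e j) = (if i = j then 1 else 0)"
    "\<And>v. v \<in> ?V \<Longrightarrow> ?B (residual n e v) (residual n e v) = 0"
    using finite_dim_orthonormal_family[OF finite_dim_poly_space] by blast
  have "\<exists>K. \<forall>x\<in>cball 0 R. \<bar>e i x\<bar> \<le> K" if "i < n" for i
  proof -
    have "compact (e i ` cball 0 R)"
      by (intro compact_continuous_image poly_space_continuous[OF e(1)[OF that]]) simp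
    then show ?thesis using compact_imp_bounded bounded_iff by (metis image_eqI real_norm_def)
  qed
  then obtain K where K: "\<And>i x. i < n \<Longrightarrow> x \<in> cball 0 R \<Longrightarrow> \<bar>e i x\<bar> \<le> K i" by metis
  define S where "S = (\<Sum>i<n. \<bar>K i\<bar>)"
  have unit: "(q x)\<^sup>2 \<le> S\<^sup>2 * ?B q q" if q: "q \<in> ?V" and x: "x \<in> cball 0 R" for q x
  proof -
    have "residual n e q \<in> ?V" using q e(1) by (intro V_diff V_sum V_scale) auto
    then have "residual n e q = (\<lambda>x. 0)"
      by (rule poly_space_L2_definite) (use e(3)[OF q] in auto)
    then have "q x = (\<Sum>i<n. ?B q (e i) * e i x)" by (auto simp: fun_eq_iff)
    then have "\<bar>q x\<bar> \<le> (\<Sum>i<n. \<bar>?B q (e i) * e i x\<bar>)" by simp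
    also have "\<dots> \<le> (\<Sum>i<n. sqrt (?B q q) * \<bar>K i\<bar>)"
    proof (rule sum_mono)
      fix i assume i: "i \<in> {..<n}"
      have "(?B q (e i))\<^sup>2 \<le> ?B q q" using cauchy_schwarz[OF q e(1)] e(2) i by simp
      then have "\<bar>?B q (e i)\<bar> \<le> sqrt (?B q q)" by (simp add: real_le_rsqrt)
      moreover have "\<bar>e i x\<bar> \<le> \<bar>K i\<bar>" using K[of i x] i x by auto
      ultimately show "\<bar>?B q (e i) * e i x\<bar> \<le> sqrt (?B q q) * \<bar>K i\<bar>"
        unfolding abs_mult using B_nonneg[OF q] by (intro mult_mono) auto
    qed
    also have "\<dots> = sqrt (?B q q) * S" by (simp add: S_def sum_distrib_left)
    finally have "\<bar>q x\<bar>\<^sup>2 \<le> (sqrt (?B q q) * S)\<^sup>2" by (intro power_mono) auto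
    then show ?thesis using B_nonneg[OF q] by (simp add: power_mult_distrib mult.commute)
  qed
  have "(q x)\<^sup>2 * r ^ DIM('a) \<le> (S\<^sup>2 + 1) * inner_on (ball c r) q q"
    if q: "q \<in> ?V" and r: "0 < r" and x: "dist c x \<le> R * r" for q c r x
  proof -
    define p where "p = (\<lambda>y. q (c + r *\<^sub>R y))"
    have p: "p \<in> ?V" unfolding p_def by (rule poly_space_shift_scale[OF q])
    have qm [measurable]: "q \<in> borel_measurable borel" by (rule poly_space_borel[OF q])
    have [measurable]: "(\<lambda>x. indicator (ball c r) x *\<^sub>R (q x \<bullet> q x)) \<in> borel_measurable borel"
      by (intro borel_measurable_scaleR borel_measurable_indicator borel_measurable_inner qm) simp
    have "inner_on (ball c r) q q = r ^ DIM('a) * (\<integral>y. indicator (ball c r) (c + r *\<^sub>R y) *\<^sub>R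
        (q (c + r *\<^sub>R y) \<bullet> q (c + r *\<^sub>R y)) \<partial>lborel)"
      unfolding L2_inner_def set_lebesgue_integral_def
      using r by (subst integral_lborel_affine[where c=r and t=c]) (measurable, simp_all)
    also have "\<dots> = r ^ DIM('a) * ?B p p"
      unfolding L2_inner_def set_lebesgue_integral_def p_def
      using r by (intro arg_cong2[where f="(*)"] refl Bochner_Integration.integral_cong)
        (auto simp: indicator_def dist_norm)
    finally have eq: "inner_on (ball c r) q q = r ^ DIM('a) * ?B p p" .
    have "norm (x - c) / r \<le> R"
      using x r by (simp add: dist_norm norm_minus_commute divide_le_eq)
    then have "(1 / r) *\<^sub>R (x - c) \<in> cball 0 R" using r by (simp del: scaleR_right_diff_distrib)
    from unit[OF p this] have "(q x)\<^sup>2 \<le> S\<^sup>2 * ?B p p" using r by (simp add: p_def)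
    also have "\<dots> \<le> (S\<^sup>2 + 1) * ?B p p" using B_nonneg[OF p] by (simp add: algebra_simps)
    finally have "(q x)\<^sup>2 * r ^ DIM('a) \<le> ((S\<^sup>2 + 1) * ?B p p) * r ^ DIM('a)"
      using r by (intro mult_right_mono) auto
    then show ?thesis unfolding eq by (simp add: mult_ac)
  qed
  moreover have "0 < S\<^sup>2 + 1" by (simp add: add_nonneg_pos)
  ultimately show ?thesis by blast
qed

lemma poly_fields_sup_bound:
  fixes R :: real
  shows "\<exists>C>0. \<forall>\<phi>\<in>(poly_fields m :: ('a::euclidean_space \<Rightarrow> 'a) set). \<forall>c r x. 0 < r \<longrightarrow>
    dist c x \<le> R * r \<longrightarrow> (\<phi> x \<bullet> \<phi> x) * r ^ DIM('a) \<le> C * inner_on (ball c r) \<phi> \<phi>"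
proof -
  obtain C where C: "0 < C" "\<And>q c r x. q \<in> (poly_space m :: ('a \<Rightarrow> real) set) \<Longrightarrow> 0 < r \<Longrightarrow>
    dist c x \<le> R * r \<Longrightarrow> (q x)\<^sup>2 * r ^ DIM('a) \<le> C * inner_on (ball c r) q q"
    using poly_space_sup_bound[of m R] by metis
  have "(\<phi> x \<bullet> \<phi> x) * r ^ DIM('a) \<le> C * inner_on (ball c r) \<phi> \<phi>"
    if \<phi>: "\<phi> \<in> poly_fields m" and r: "0 < r" and x: "dist c x \<le> R * r" for \<phi> :: "'a \<Rightarrow> 'a" and c r x
  proof -
    have reg: "finite_region lborel (ball c r)" by (rule finite_region_lborel) auto
    have b: "(\<lambda>x. \<phi> x \<bullet> b) \<in> poly_space m" if "b \<in> Basis" for b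
      using \<phi> that by (simp add: poly_fields_def)
    have "(\<phi> x \<bullet> \<phi> x) * r ^ DIM('a) = (\<Sum>b\<in>Basis. (\<phi> x \<bullet> b)\<^sup>2 * r ^ DIM('a))"
      by (subst euclidean_inner) (simp add: power2_eq_square sum_distrib_right)
    also have "\<dots> \<le> (\<Sum>b\<in>Basis. C * inner_on (ball c r) (\<lambda>x. \<phi> x \<bullet> b) (\<lambda>x. \<phi> x \<bullet> b))"
      by (intro sum_mono C(2) b r x)
    also have "\<dots> = C * inner_on (ball c r) \<phi> \<phi>"
    proof -
      have "inner_on (ball c r) \<phi> \<phi> =
          (LINT x:ball c r|lborel. \<Sum>b\<in>Basis. (\<phi> x \<bullet> b) \<bullet> (\<phi> x \<bullet> b))"
        unfolding L2_inner_def by (subst euclidean_inner) simp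
      also have "\<dots> = (\<Sum>b\<in>Basis. inner_on (ball c r) (\<lambda>x. \<phi> x \<bullet> b) (\<lambda>x. \<phi> x \<bullet> b))"
        unfolding L2_inner_def set_lebesgue_integral_def scaleR_sum_right
        by (rule Bochner_Integration.integral_sum)
           (rule L2_integrable[OF reg poly_space_continuous[OF b] poly_space_continuous[OF b],
              unfolded set_integrable_def])
      finally show ?thesis by (simp add: sum_distrib_left)
    qed
    finally show ?thesis .
  qed
  then show ?thesis using C(1) by blast
qed

section \<open>Star-shaped polytopes with simplicial faces\<close>

text \<open>The apex a lies off all face hyperplanes, so that no face is seen edge-on from it.\<close>

locale star_polytope =
  fixes T :: "'a::euclidean_space set" and \<F> :: "'a set set" and a :: 'a
  assumes open_T: "open T" and bounded_T: "bounded T" and star: "star_shaped T a"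
    and finite_faces: "finite \<F>" and frontier_T: "frontier T = (\<Union>F\<in>\<F>. closure F)"
    and disjoint_faces: "pairwise disjnt \<F>"
    and simplicial: "\<And>F. F \<in> \<F> \<Longrightarrow> \<exists>S. (int DIM('a) - 1) simplex S \<and> F = rel_interior S"
    and apex_off: "\<And>F. F \<in> \<F> \<Longrightarrow> 0 < infdist a (affine hull F)"
begin

definition \<delta> :: "'a set \<Rightarrow> real" where "\<delta> F = infdist a (affine hull F)"

text \<open>The unit normal of the face hyperplane that points away from a.\<close>

definition \<nu> :: "'a set \<Rightarrow> 'a" where
  "\<nu> F = (SOME n. norm n = 1 \<and> affine hull F = {x. n \<bullet> x = n \<bullet> a + \<delta> F})"

abbreviation level :: "'a set \<Rightarrow> real" where "level F \<equiv> \<nu> F \<bullet> a + \<delta> F"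

lemma \<delta>_pos: "F \<in> \<F> \<Longrightarrow> 0 < \<delta> F"
  by (simp add: \<delta>_def apex_off)

lemma a_in_T: "a \<in> T"
  using star by (simp add: star_shaped_def)

lemma face_simplex:
  assumes "F \<in> \<F>"
  shows "(int DIM('a) - 1) simplex closure F" "F = rel_interior (closure F)"
    "convex F" "F \<noteq> {}" "aff_dim F = int DIM('a) - 1"
proof -
  obtain S where S: "(int DIM('a) - 1) simplex S" "F = rel_interior S" using simplicial[OF assms] by blast
  have conv: "convex S" and cl: "closed S"
    using S(1) convex_simplex closed_simplex by auto
  have "closure F = S" using convex_closure_rel_interior[OF conv] cl S(2) by simp
  then show "(int DIM('a) - 1) simplex closure F" "F = rel_interior (closure F)" using S by simp_all
  show "convex F" using S(2) convex_rel_interior[OF conv] by simp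
  show "aff_dim F = int DIM('a) - 1"
    using S aff_dim_simplex[OF S(1)] rel_interior_aff_dim[OF conv] by simp
  then show "F \<noteq> {}" using DIM_positive[where 'a='a] by (auto simp: aff_dim_empty_eq)
qed

lemma bounded_face: "F \<in> \<F> \<Longrightarrow> bounded (closure F)"
  using compact_imp_bounded compact_simplex face_simplex(1) by blast

lemma \<nu>:
  assumes "F \<in> \<F>"
  shows norm_\<nu>: "norm (\<nu> F) = 1" and affine_hull_face: "affine hull F = {x. \<nu> F \<bullet> x = level F}"
proof -
  obtain b c where b: "b \<noteq> 0" "affine hull F = {x. b \<bullet> x = c}"
    using face_simplex(5)[OF assms] aff_dim_eq_hyperplane[of F] DIM_positive[where 'a='a]
    by (auto simp: of_nat_diff)
  define s where "s = (if b \<bullet> a < c then 1 else - 1 :: real)"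
  define n where "n = (s / norm b) *\<^sub>R b"
  have n: "norm n = 1" using b(1) by (simp add: n_def s_def)
  interpret unit_normal n by unfold_locales (rule n)
  have hull: "affine hull F = {x. n \<bullet> x = s / norm b * c}"
    using b by (auto simp: n_def s_def)
  then have eq: "affine hull F = hplane (s / norm b * c)" by (simp add: hplane_def)
  have "\<delta> F = \<bar>n \<bullet> a - s / norm b * c\<bar>" by (simp add: \<delta>_def eq infdist_hplane)
  also have "\<dots> = s / norm b * c - n \<bullet> a"
    using b(1) by (simp add: n_def s_def field_simps abs_if divide_less_cancel)
  finally have "affine hull F = {x. n \<bullet> x = n \<bullet> a + \<delta> F}" using hull by simp
  then have "norm (\<nu> F) = 1 \<and> affine hull F = {x. \<nu> F \<bullet> x = level F}"
    unfolding \<nu>_def using n by (intro someI_ex[where P="\<lambda>n. norm n = 1 \<and> affine hull F = {x. n \<bullet> x = n \<bullet> a + \<delta> F}"]) blast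
  then show "norm (\<nu> F) = 1" "affine hull F = {x. \<nu> F \<bullet> x = level F}" by auto
qed

lemma closure_face_level: "F \<in> \<F> \<Longrightarrow> y \<in> closure F \<Longrightarrow> \<nu> F \<bullet> (y - a) = \<delta> F"
  using affine_hull_face[of F] hull_subset[of F affine] closure_mono[of F "affine hull F"]
  by (auto simp: inner_diff_right closed_hyperplane)

lemma face_level: "F \<in> \<F> \<Longrightarrow> y \<in> F \<Longrightarrow> \<nu> F \<bullet> (y - a) = \<delta> F"
  using closure_face_level closure_subset by blast

lemma face_openin: "F \<in> \<F> \<Longrightarrow> openin (top_of_set {x. \<nu> F \<bullet> x = level F}) F"
  using face_simplex(2,3)[of F] openin_rel_interior[of "closure F"] affine_hull_face[of F]
  by simp

lemma face_borel: "F \<in> \<F> \<Longrightarrow> F \<in> sets borel"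
  using face_openin[of F] closed_hyperplane[of "\<nu> F" "level F"] unfolding openin_open
  by (metis borel_closed borel_open sets.Int)

lemma face_subset_frontier: "F \<in> \<F> \<Longrightarrow> closure F \<subseteq> frontier T"
  using frontier_T by auto

lemma frontier_not_in_T: "y \<in> frontier T \<Longrightarrow> y \<notin> T"
  using open_T by (simp add: frontier_def interior_open)

lemma frontier_in_closure: "y \<in> frontier T \<Longrightarrow> y \<in> closure T"
  by (simp add: frontier_def)

text \<open>Otherwise a whole segment of the ray would lie on the frontier, hence on finitely many
  hyperplanes that each meet the ray at most once.\<close>

lemma ray_in_T:
  assumes y: "y \<in> closure T" and s: "0 \<le> s" "s < 1"
  shows "a + s *\<^sub>R (y - a) \<in> T"
proof (rule ccontr)
  assume not: "a + s *\<^sub>R (y - a) \<notin> T"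
  have cl: "a + t *\<^sub>R (y - a) \<in> closure T" if "0 \<le> t" "t \<le> 1" for t
  proof -
    have "(\<lambda>x. a + t *\<^sub>R (x - a)) ` closure T \<subseteq> closure T"
    proof (rule image_closure_subset)
      show "(\<lambda>x. a + t *\<^sub>R (x - a)) ` T \<subseteq> closure T"
      proof clarify
        fix x assume "x \<in> T"
        then have "closed_segment a x \<subseteq> T" using star by (simp add: star_shaped_def)
        moreover have "a + t *\<^sub>R (x - a) \<in> closed_segment a x"
          using that unfolding closed_segment_def by (auto simp: algebra_simps intro!: exI[of _ t])
        ultimately show "a + t *\<^sub>R (x - a) \<in> closure T" using closure_subset by blast
      qed
    qed (auto intro!: continuous_intros)
    then show ?thesis using y by blast
  qed
  have "a + t *\<^sub>R (y - a) \<notin> T" if t: "s \<le> t" for t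
  proof
    assume "a + t *\<^sub>R (y - a) \<in> T"
    then have sub: "closed_segment a (a + t *\<^sub>R (y - a)) \<subseteq> T" using star by (simp add: star_shaped_def)
    show False
    proof (cases "t = 0")
      case True
      then show False using not a_in_T s t by simp
    next
      case False
      then have "a + s *\<^sub>R (y - a) = (1 - s / t) *\<^sub>R a + (s / t) *\<^sub>R (a + t *\<^sub>R (y - a))"
        by (simp add: algebra_simps)
      then have "a + s *\<^sub>R (y - a) \<in> closed_segment a (a + t *\<^sub>R (y - a))"
        unfolding closed_segment_def using s t False by (auto intro!: exI[of _ "s / t"])
      then show False using sub not by blast
    qed
  qed
  then have "a + t *\<^sub>R (y - a) \<in> frontier T" if "t \<in> {s..1}" for t
    using cl[of t] that s open_T by (auto simp: frontier_def interior_open)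
  then have "{s..1} \<subseteq> (\<Union>F\<in>\<F>. {t. a + t *\<^sub>R (y - a) \<in> closure F})"
    using frontier_T by blast
  moreover have "finite {t. a + t *\<^sub>R (y - a) \<in> closure F}" if F: "F \<in> \<F>" for F
  proof -
    have "t = \<delta> F / (\<nu> F \<bullet> (y - a))" if "a + t *\<^sub>R (y - a) \<in> closure F" for t
    proof -
      have "t * (\<nu> F \<bullet> (y - a)) = \<delta> F" using closure_face_level[OF F that] by simp
      moreover from this have "\<nu> F \<bullet> (y - a) \<noteq> 0" using \<delta>_pos[OF F] by auto
      ultimately show ?thesis by (simp add: eq_divide_eq)
    qed
    then have "{t. a + t *\<^sub>R (y - a) \<in> closure F} \<subseteq> {\<delta> F / (\<nu> F \<bullet> (y - a))}" by blast
    then show ?thesis using finite_subset by blast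
  qed
  ultimately have "finite {s..1}" using finite_faces by (meson finite_UN finite_subset)
  then show False using s infinite_Icc[of s 1] by simp
qed

text \<open>The nearer of two frontier points on a ray from the apex would belong to the open set T.\<close>

lemma frontier_ray_unique:
  assumes "y \<in> frontier T" "y' \<in> frontier T" "y' = a + s *\<^sub>R (y - a)" "0 < s"
  shows "y' = y"
proof -
  have "\<not> s < 1"
    using ray_in_T[OF frontier_in_closure[OF assms(1)], of s] assms frontier_not_in_T by auto
  moreover have "\<not> 1 < s"
  proof
    assume "1 < s"
    moreover have "y = a + (1 / s) *\<^sub>R (y' - a)" using assms(3,4) by simp
    ultimately show False
      using ray_in_T[OF frontier_in_closure[OF assms(2)], of "1 / s"] assms frontier_not_in_T by auto
  qed
  ultimately have "s = 1" by simp
  then show ?thesis using assms(3) by simp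
qed

abbreviation pyr :: "'a set \<Rightarrow> 'a set" where "pyr F \<equiv> pyramid a F"

text \<open>The affine function that is 0 at the apex and 1 on the base.\<close>

definition height :: "'a set \<Rightarrow> 'a \<Rightarrow> real" where "height F x = \<nu> F \<bullet> (x - a) / \<delta> F"

lemma height_ray: "F \<in> \<F> \<Longrightarrow> y \<in> closure F \<Longrightarrow> height F (a + t *\<^sub>R (y - a)) = t"
  using \<delta>_pos[of F] closure_face_level[of F y] by (simp add: height_def)

lemma hull_cone:
  assumes "convex Y" "Y \<noteq> {}"
  shows "convex hull (insert a Y) = {a + t *\<^sub>R (y - a) |t y. 0 \<le> t \<and> t \<le> 1 \<and> y \<in> Y}"
proof (intro set_eqI iffI)
  fix x assume "x \<in> convex hull (insert a Y)"
  then obtain u v y where "0 \<le> u" "0 \<le> v" "u + v = 1" "y \<in> Y" "x = u *\<^sub>R a + v *\<^sub>R y"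
    using assms by (auto simp: convex_hull_insert hull_same)
  moreover from this have "u = 1 - v" by simp
  ultimately have "x = a + v *\<^sub>R (y - a)" "0 \<le> v" "v \<le> 1" "y \<in> Y" by (auto simp: algebra_simps)
  then show "x \<in> {a + t *\<^sub>R (y - a) |t y. 0 \<le> t \<and> t \<le> 1 \<and> y \<in> Y}" by blast
next
  fix x assume "x \<in> {a + t *\<^sub>R (y - a) |t y. 0 \<le> t \<and> t \<le> 1 \<and> y \<in> Y}"
  then obtain t y where "x = a + t *\<^sub>R (y - a)" "0 \<le> t" "t \<le> 1" "y \<in> Y" by blast
  then have "x = (1 - t) *\<^sub>R a + t *\<^sub>R y" "0 \<le> 1 - t" "0 \<le> t" "(1 - t) + t = 1"
    "y \<in> convex hull Y"
    using hull_subset[of Y convex] by (auto simp: algebra_simps)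
  then show "x \<in> convex hull (insert a Y)"
    unfolding convex_hull_insert[OF assms(2)] by blast
qed

text \<open>Interior points of the hull lie strictly between the parallel hyperplanes through the apex and the
  base.  Between them the radial projection to the base is continuous, so that the cone is open.\<close>

lemma pyramid_cone:
  assumes F: "F \<in> \<F>"
  shows "pyr F = {a + t *\<^sub>R (y - a) |t y. 0 < t \<and> t < 1 \<and> y \<in> F}" (is "_ = ?C")
proof
  have d: "0 < \<delta> F" by (rule \<delta>_pos[OF F])
  note hull = hull_cone[OF face_simplex(3,4)[OF F]]
  show "pyr F \<subseteq> ?C"
  proof
    fix x assume "x \<in> pyr F"
    then obtain e where e: "0 < e" "ball x e \<subseteq> convex hull (insert a F)"
      unfolding pyramid_def mem_interior by blast
    have bound: "0 \<le> \<nu> F \<bullet> (z - a) \<and> \<nu> F \<bullet> (z - a) \<le> \<delta> F" if "z \<in> convex hull (insert a F)" for z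
      using that d face_level[OF F] unfolding hull by (auto simp: mult_left_le_one_le)
    have n: "\<nu> F \<bullet> \<nu> F = 1" using norm_\<nu>[OF F] by (simp add: norm_eq_1)
    have "x + (e / 2) *\<^sub>R \<nu> F \<in> ball x e" "x - (e / 2) *\<^sub>R \<nu> F \<in> ball x e"
      using e(1) norm_\<nu>[OF F] by (auto simp: dist_norm)
    then have "\<nu> F \<bullet> (x + (e / 2) *\<^sub>R \<nu> F - a) \<le> \<delta> F" "0 \<le> \<nu> F \<bullet> (x - (e / 2) *\<^sub>R \<nu> F - a)"
      using e(2) bound by blast+
    then have strict: "0 < \<nu> F \<bullet> (x - a)" "\<nu> F \<bullet> (x - a) < \<delta> F"
      using e(1) n by (auto simp: inner_add_right inner_diff_right)
    have "x \<in> convex hull (insert a F)" using \<open>x \<in> pyr F\<close> interior_subset unfolding pyramid_def by blast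
    then obtain t y where x: "x = a + t *\<^sub>R (y - a)" "0 \<le> t" "t \<le> 1" "y \<in> F" unfolding hull by blast
    then have "\<nu> F \<bullet> (x - a) = t * \<delta> F" using face_level[OF F] by simp
    then have "0 < t" "t < 1" using strict d x by (auto simp: zero_less_mult_iff)
    then show "x \<in> ?C" using x by blast
  qed
  show "?C \<subseteq> pyr F"
    unfolding pyramid_def
  proof (rule interior_maximal)
    show "?C \<subseteq> convex hull (insert a F)" unfolding hull by force
    obtain O' where O': "open O'" "F = {x. \<nu> F \<bullet> x = level F} \<inter> O'"
      using face_openin[OF F] unfolding openin_open by blast
    define U where "U = {x. 0 < \<nu> F \<bullet> (x - a)} \<inter> {x. \<nu> F \<bullet> (x - a) < \<delta> F}"
    define f where "f x = a + (\<delta> F / (\<nu> F \<bullet> (x - a))) *\<^sub>R (x - a)" for x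
    have "open U" unfolding U_def by (intro open_Int open_Collect_less continuous_intros)
    moreover have "continuous_on U f" unfolding f_def U_def by (intro continuous_intros) auto
    ultimately have "open (U \<inter> f -` O')" using O'(1) continuous_open_preimage by blast
    moreover have "?C = U \<inter> f -` O'"
    proof (intro set_eqI iffI)
      fix x assume "x \<in> ?C"
      then obtain t y where x: "x = a + t *\<^sub>R (y - a)" "0 < t" "t < 1" "y \<in> F" by blast
      then have "\<nu> F \<bullet> (x - a) = t * \<delta> F" using face_level[OF F] by simp
      then have "x \<in> U" "f x = y" using x d by (auto simp: U_def f_def)
      then show "x \<in> U \<inter> f -` O'" using x O'(2) by auto
    next
      fix x assume x: "x \<in> U \<inter> f -` O'"
      define t where "t = \<nu> F \<bullet> (x - a) / \<delta> F"
      have t: "0 < t" "t < 1" using x d by (auto simp: t_def U_def)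
      have "\<nu> F \<bullet> (f x - a) = \<delta> F" using x by (auto simp: f_def U_def)
      then have "\<nu> F \<bullet> f x = level F" by (simp add: inner_diff_right)
      then have "f x \<in> F" using x O'(2) by auto
      moreover have "x = a + t *\<^sub>R (f x - a)" using x d by (auto simp: f_def t_def U_def)
      ultimately show "x \<in> ?C" using t by blast
    qed
    ultimately show "open ?C" by simp
  qed
qed

lemma open_pyramid: "open (pyr F)"
  by (simp add: pyramid_def)

lemma convex_pyramid: "convex (pyr F)"
  by (simp add: pyramid_def convex_interior)

lemma pyramid_nonempty:
  assumes "F \<in> \<F>"
  shows "pyr F \<noteq> {}"
proof -
  obtain y where "y \<in> F" using face_simplex(4)[OF assms] by blast
  then have "a + (1/2) *\<^sub>R (y - a) \<in> pyr F"
    unfolding pyramid_cone[OF assms] by (intro CollectI exI[of _ "1/2"] exI[of _ y]) simp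
  then show ?thesis by blast
qed

lemma closure_pyramid_hull:
  assumes F: "F \<in> \<F>"
  shows "closure (pyr F) = convex hull (insert a (closure F))"
proof -
  have "closure (pyr F) = closure (convex hull (insert a F))"
    using convex_closure_interior[of "convex hull (insert a F)"] pyramid_nonempty[OF F]
    by (simp add: pyramid_def)
  also have "\<dots> = convex hull (insert a (closure F))"
  proof
    have "compact (insert a (closure F))" using bounded_face[OF F] by (simp add: compact_eq_bounded_closed)
    then have "closed (convex hull (insert a (closure F)))"
      by (intro compact_imp_closed compact_convex_hull)
    moreover have "convex hull (insert a F) \<subseteq> convex hull (insert a (closure F))"
      using closure_subset by (intro hull_mono) blast
    ultimately show "closure (convex hull (insert a F)) \<subseteq> convex hull (insert a (closure F))"
      by (rule closure_minimal[rotated])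
    have "insert a F \<subseteq> convex hull (insert a F)" by (rule hull_subset)
    then have "insert a (closure F) \<subseteq> closure (convex hull (insert a F))"
      by (meson closure_mono closure_subset insert_subset subset_iff)
    then show "convex hull (insert a (closure F)) \<subseteq> closure (convex hull (insert a F))"
      by (intro hull_minimal convex_closure convex_convex_hull)
  qed
  finally show ?thesis .
qed

lemma closure_pyramid:
  assumes F: "F \<in> \<F>"
  shows "closure (pyr F) = {a + t *\<^sub>R (y - a) |t y. 0 \<le> t \<and> t \<le> 1 \<and> y \<in> closure F}"
  unfolding closure_pyramid_hull[OF F]
  using hull_cone[of "closure F"] face_simplex(3,4)[OF F] convex_closure by auto

lemma pyramid_subset: "F \<in> \<F> \<Longrightarrow> pyr F \<subseteq> T"
  unfolding pyramid_cone using ray_in_T face_subset_frontier[of F] closure_subset[of F] frontier_in_closure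
  by fastforce

lemma bounded_pyramid: "F \<in> \<F> \<Longrightarrow> bounded (pyr F)"
  using pyramid_subset bounded_T bounded_subset by blast

text \<open>A common point lies on a ray that meets the frontier in both faces, hence in a common point of
  these.\<close>

lemma pyramids_disjoint:
  assumes "F \<in> \<F>" "G \<in> \<F>" "F \<noteq> G"
  shows "pyr F \<inter> pyr G = {}"
proof (rule ccontr)
  assume "pyr F \<inter> pyr G \<noteq> {}"
  then obtain s t y z where *: "0 < s" "y \<in> F" "0 < t" "z \<in> G" "a + s *\<^sub>R (y - a) = a + t *\<^sub>R (z - a)"
    unfolding pyramid_cone[OF assms(1)] pyramid_cone[OF assms(2)] by blast
  have "z = a + (1 / t) *\<^sub>R (t *\<^sub>R (z - a))" using * by simp
  also have "\<dots> = a + (s / t) *\<^sub>R (y - a)" using *(5) by (metis add_left_cancel mult.commute mult.right_neutral scaleR_scaleR times_divide_eq_right)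
  finally have "z = y"
    using *(1-4) assms face_subset_frontier closure_subset
    by (intro frontier_ray_unique[of y z "s / t"]) auto
  then show False using * disjoint_faces assms by (auto simp: pairwise_def disjnt_def)
qed

lemma faces_nonempty: "\<F> \<noteq> {}"
proof -
  have "frontier T \<noteq> {}"
    using bounded_T open_T a_in_T frontier_eq_empty[of T] not_bounded_UNIV by (auto simp: )
  then show ?thesis using frontier_T by auto
qed

text \<open>The last point of a ray from the apex in the closure of T is a frontier point, hence lies on a
  face.\<close>

lemma closure_T_cover: "closure T = (\<Union>F\<in>\<F>. closure (pyr F))"
proof
  show "(\<Union>F\<in>\<F>. closure (pyr F)) \<subseteq> closure T" using pyramid_subset closure_mono by blast
  show "closure T \<subseteq> (\<Union>F\<in>\<F>. closure (pyr F))"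
  proof
    fix x assume x: "x \<in> closure T"
    show "x \<in> (\<Union>F\<in>\<F>. closure (pyr F))"
    proof (cases "x = a")
      case True
      obtain F y where "F \<in> \<F>" "y \<in> closure F"
        using faces_nonempty face_simplex(4) closure_subset by fastforce
      then have "a + 0 *\<^sub>R (y - a) \<in> closure (pyr F)" unfolding closure_pyramid[OF \<open>F \<in> \<F>\<close>] by force
      then show ?thesis using True \<open>F \<in> \<F>\<close> by auto
    next
      case False
      define f where "f s = a + s *\<^sub>R (x - a)" for s :: real
      have cont: "continuous_on UNIV f" unfolding f_def by (intro continuous_intros)
      \<comment> \<open>parameters of the part of the ray in the closure; the largest one gives the frontier point\<close>
      define A where "A = {0..} \<inter> f -` closure T"
      have clA: "closed A" unfolding A_def by (intro closed_Int closed_vimage cont) auto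
      obtain K where K: "\<And>z. z \<in> closure T \<Longrightarrow> dist a z \<le> K"
        using bounded_closure[OF bounded_T] bounded_any_center[where a=a] by metis
      have "\<bar>s\<bar> \<le> K / norm (x - a)" if "s \<in> A" for s
      proof -
        have "dist a (f s) \<le> K" using that K by (auto simp: A_def)
        then have "\<bar>s\<bar> * norm (x - a) \<le> K" by (simp add: f_def dist_norm del: scaleR_right_diff_distrib)
        then show ?thesis using False by (simp add: le_divide_eq)
      qed
      then have "bounded A" unfolding bounded_iff by (metis real_norm_def)
      moreover have one: "1 \<in> A" using x by (simp add: A_def f_def)
      ultimately obtain s where s: "s \<in> A" "\<And>t. t \<in> A \<Longrightarrow> t \<le> s"
        using compact_attains_sup[of A] clA by (metis compact_eq_bounded_closed empty_iff)
      have s1: "1 \<le> s" by (rule s(2)[OF one])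
      have "f s \<notin> T"
      proof
        assume "f s \<in> T"
        moreover have "open (f -` T)" by (rule open_vimage[OF open_T cont])
        ultimately obtain e where e: "0 < e" "ball s e \<subseteq> f -` T" by (meson open_contains_ball vimageI)
        then have "f (s + e / 2) \<in> T" by (auto simp: dist_norm subset_iff)
        then have "s + e / 2 \<in> A" using s1 e closure_subset by (auto simp: A_def)
        then show False using s(2) e by fastforce
      qed
      then have "f s \<in> frontier T" using s(1) open_T by (simp add: A_def frontier_def interior_open)
      then obtain F where F: "F \<in> \<F>" "f s \<in> closure F" using frontier_T by blast
      have "x = a + (1 / s) *\<^sub>R (f s - a)" using s1 by (simp add: f_def)
      then have "x \<in> closure (pyr F)"
        unfolding closure_pyramid[OF F(1)] using s1 F(2)
        by (intro CollectI exI[of _ "1 / s"] exI[of _ "f s"]) auto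
      then show ?thesis using F(1) by blast
    qed
  qed
qed

lemma pyramid_frontier_null: "F \<in> \<F> \<Longrightarrow> AE x in lborel. x \<notin> closure (pyr F) - pyr F"
proof (rule AE_not_in)
  assume F: "F \<in> \<F>"
  have "frontier (pyr F) = closure (pyr F) - pyr F"
    by (simp add: frontier_def interior_open open_pyramid)
  then have "negligible (closure (pyr F) - pyr F)"
    using negligible_convex_frontier[OF convex_pyramid, of F] by simp
  then have "closure (pyr F) - pyr F \<in> null_sets lebesgue" by (simp add: negligible_iff_null_sets)
  moreover have "closure (pyr F) - pyr F \<in> sets lborel" using open_pyramid by auto
  ultimately show "closure (pyr F) - pyr F \<in> null_sets lborel" using null_sets_completion_iff by blast
qed

lemma AE_pyramids: "AE x in lborel. x \<in> closure T \<longrightarrow> (\<exists>F\<in>\<F>. x \<in> pyr F)"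
proof -
  have "AE x in lborel. \<forall>F\<in>\<F>. x \<notin> closure (pyr F) - pyr F"
    using finite_faces pyramid_frontier_null by (intro AE_finite_allI)
  then show ?thesis by eventually_elim (use closure_T_cover in blast)
qed

lemma sum_indicator_pyramids:
  assumes "x \<in> pyr F" "F \<in> \<F>"
  shows "(\<Sum>G\<in>\<F>. indicator (pyr G) x *\<^sub>R f G) = (f F :: 'b::real_vector)"
proof -
  have "(\<Sum>G\<in>\<F>. indicator (pyr G) x *\<^sub>R f G) = (\<Sum>G\<in>\<F>. if G = F then f F else 0)"
    using assms pyramids_disjoint[of F] by (intro sum.cong) (auto simp: indicator_def)
  then show ?thesis using assms finite_faces by simp
qed

lemma region_T: "finite_region lborel T"
  using bounded_T open_T by (intro finite_region_lborel) auto

lemma region_pyramid: "F \<in> \<F> \<Longrightarrow> finite_region lborel (pyr F)"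
  using bounded_pyramid open_pyramid by (intro finite_region_lborel) auto

lemma integral_T_pyramids:
  fixes f :: "'a \<Rightarrow> real"
  assumes f: "continuous_on UNIV f"
  shows "(LINT x:T|lborel. f x) = (\<Sum>F\<in>\<F>. LINT x:pyr F|lborel. f x)"
proof -
  have [measurable]: "f \<in> borel_measurable borel" by (rule borel_measurable_continuous_onI[OF f])
  have [measurable]: "T \<in> sets borel" "pyr F \<in> sets borel" for F using open_T open_pyramid by auto
  have "(LINT x:T|lborel. f x) = (\<integral>x. (\<Sum>F\<in>\<F>. indicator (pyr F) x *\<^sub>R f x) \<partial>lborel)"
    unfolding set_lebesgue_integral_def
  proof (rule integral_cong_AE)
    show "AE x in lborel. indicator T x *\<^sub>R f x = (\<Sum>F\<in>\<F>. indicator (pyr F) x *\<^sub>R f x)"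
      using AE_pyramids
    proof eventually_elim
      case (elim x)
      show ?case
      proof (cases "\<exists>F\<in>\<F>. x \<in> pyr F")
        case True
        then obtain F where F: "F \<in> \<F>" "x \<in> pyr F" by blast
        then have "x \<in> T" using pyramid_subset by blast
        then show ?thesis using sum_indicator_pyramids[OF F(2,1), of "\<lambda>_. f x"] by simp
      next
        case False
        then have "x \<notin> T" using elim closure_subset by blast
        then show ?thesis using False by (auto intro!: sum.neutral[symmetric])
      qed
    qed
  qed measurable
  also have "\<dots> = (\<Sum>F\<in>\<F>. LINT x:pyr F|lborel. f x)"
    unfolding set_lebesgue_integral_def
    using set_integrable_continuous[OF region_pyramid f]
    by (intro Bochner_Integration.integral_sum) (auto simp: set_integrable_def)
  finally show ?thesis .
qed

lemma unit_normal_\<nu>: "F \<in> \<F> \<Longrightarrow> unit_normal (\<nu> F)"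
  by unfold_locales (rule norm_\<nu>)

lemma face_measure_eq:
  assumes "F \<in> \<F>"
  shows "face_measure F = hyperplane_measure (unit_normal.hplane (\<nu> F) (level F))"
    and "F \<subseteq> unit_normal.hplane (\<nu> F) (level F)"
proof -
  interpret unit_normal "\<nu> F" by (rule unit_normal_\<nu>[OF assms])
  show "face_measure F = \<mu> (level F)"
    by (simp add: affine_hull_face[OF assms] hplane_def)
  show "F \<subseteq> hplane (level F)"
    using hull_subset[of F affine] by (simp add: affine_hull_face[OF assms] hplane_def)
qed

lemma region_face:
  assumes "F \<in> \<F>"
  shows "finite_region (face_measure F) F"
proof -
  interpret unit_normal "\<nu> F" by (rule unit_normal_\<nu>[OF assms])
  have "bounded F" using bounded_face[OF assms] bounded_subset[OF _ closure_subset] by blast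
  then show ?thesis
    using finite_\<mu>[of F] face_borel[OF assms]
    unfolding finite_region_def face_measure_eq(1)[OF assms] by simp
qed

lemma integral_pyramid_homogeneous:
  fixes g :: "'a \<Rightarrow> real"
  assumes F: "F \<in> \<F>" and g: "continuous_on UNIV g"
    and hom: "\<And>t y. 0 < t \<Longrightarrow> g (a + t *\<^sub>R (y - a)) = t ^ j * g y"
  shows "(LINT x:pyr F|lborel. g x) = \<delta> F / (real j + DIM('a)) * (LINT y:F|face_measure F. g y)"
proof -
  interpret unit_normal "\<nu> F" by (rule unit_normal_\<nu>[OF F])
  show ?thesis
    unfolding face_measure_eq(1)[OF F]
  proof (rule integral_cone[OF face_measure_eq(2)[OF F] face_borel[OF F] _ \<delta>_pos[OF F] refl
      pyramid_cone[OF F]])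
    show "bounded F" using bounded_face[OF F] bounded_subset[OF _ closure_subset] by blast
    show "set_integrable lborel (pyr F) g" by (rule set_integrable_continuous[OF region_pyramid[OF F] g])
    show "set_integrable (\<mu> (level F)) F g"
      using set_integrable_continuous[OF region_face[OF F] g] unfolding face_measure_eq(1)[OF F] .
    show "g \<in> borel_measurable borel" by (rule borel_measurable_continuous_onI[OF g])
  qed (use open_pyramid hom in auto)
qed

text \<open>Leaving T through a point of a face along the normal, the segment from the apex still
  crosses that face.\<close>

lemma outward_normal_eq:
  assumes F: "F \<in> \<F>"
  shows "outward_normal T F = \<nu> F"
  unfolding outward_normal_def
proof (rule the_equality)
  have n: "\<nu> F \<bullet> \<nu> F = 1" using norm_\<nu>[OF F] by (simp add: norm_eq_1)
  obtain O' where O': "open O'" "F = {x. \<nu> F \<bullet> x = level F} \<inter> O'"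
    using face_openin[OF F] unfolding openin_open by blast
  define f where "f x = a + (\<delta> F / (\<nu> F \<bullet> (x - a))) *\<^sub>R (x - a)" for x
  have d: "0 < \<delta> F" by (rule \<delta>_pos[OF F])
  have near: "\<forall>\<^sub>F t in at_right 0. f (x + (s * t) *\<^sub>R \<nu> F) \<in> F \<and> \<bar>t\<bar> < \<delta> F" if x: "x \<in> F" for x and s :: real
  proof -
    have lx: "\<nu> F \<bullet> (x - a) = \<delta> F" by (rule face_level[OF F x])
    have "((\<lambda>t. \<nu> F \<bullet> (x + (s * t) *\<^sub>R \<nu> F - a)) \<longlongrightarrow> \<nu> F \<bullet> (x + (s * 0) *\<^sub>R \<nu> F - a)) (at_right 0)"
      by (intro tendsto_intros)
    then have lim: "((\<lambda>t. \<nu> F \<bullet> (x + (s * t) *\<^sub>R \<nu> F - a)) \<longlongrightarrow> \<delta> F) (at_right 0)" using lx by simp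
    have "((\<lambda>t. f (x + (s * t) *\<^sub>R \<nu> F)) \<longlongrightarrow> a + (\<delta> F / \<delta> F) *\<^sub>R (x + (s * 0) *\<^sub>R \<nu> F - a)) (at_right 0)"
      unfolding f_def using lim d by (intro tendsto_intros) auto
    then have "((\<lambda>t. f (x + (s * t) *\<^sub>R \<nu> F)) \<longlongrightarrow> x) (at_right 0)" using d by simp
    then have "\<forall>\<^sub>F t in at_right 0. f (x + (s * t) *\<^sub>R \<nu> F) \<in> O'"
      using O' x by (intro topological_tendstoD) auto
    moreover have "\<forall>\<^sub>F t in at_right 0. 0 < \<nu> F \<bullet> (x + (s * t) *\<^sub>R \<nu> F - a)"
      using lim d by (rule order_tendstoD(1))
    moreover have "\<forall>\<^sub>F t in at_right (0::real). t < \<delta> F" using d by (auto intro: eventually_at_rightI[of 0 "\<delta> F"])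
    moreover have "\<forall>\<^sub>F t in at_right (0::real). 0 < t" by (simp add: eventually_at_right_less)
    ultimately show ?thesis
    proof eventually_elim
      case (elim t)
      then have "\<nu> F \<bullet> (f (x + (s * t) *\<^sub>R \<nu> F) - a) = \<delta> F" by (simp add: f_def)
      then have "\<nu> F \<bullet> f (x + (s * t) *\<^sub>R \<nu> F) = level F" by (simp add: inner_diff_right)
      then have "f (x + (s * t) *\<^sub>R \<nu> F) \<in> F" using elim(1) by (subst O'(2)) simp
      then show ?case using elim by simp
    qed
  qed
  have inside: "\<forall>\<^sub>F t in at_right 0. x - t *\<^sub>R \<nu> F \<in> T" if x: "x \<in> F" for x
    using near[OF x, of "-1"] eventually_at_right_less[of 0]
  proof eventually_elim
    case (elim t)
    define w where "w = x - t *\<^sub>R \<nu> F"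
    have w: "\<nu> F \<bullet> (w - a) = \<delta> F - t"
      using face_level[OF F x] n by (simp add: w_def inner_diff_right)
    then have "w = a + ((\<delta> F - t) / \<delta> F) *\<^sub>R (f w - a)" using elim d by (simp add: f_def)
    moreover have "f w \<in> F" using elim by (simp add: w_def)
    moreover have "0 < (\<delta> F - t) / \<delta> F" "(\<delta> F - t) / \<delta> F < 1" using elim d by (auto simp: field_simps)
    ultimately have "w \<in> pyr F" unfolding pyramid_cone[OF F] by blast
    then show ?case using pyramid_subset[OF F] by (auto simp: w_def)
  qed
  have outside: "\<forall>\<^sub>F t in at_right 0. x + t *\<^sub>R \<nu> F \<notin> T" if x: "x \<in> F" for x
    using near[OF x, of 1] eventually_at_right_less[of 0]
  proof eventually_elim
    case (elim t)
    define w where "w = x + t *\<^sub>R \<nu> F"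
    have w: "\<nu> F \<bullet> (w - a) = \<delta> F + t"
      using face_level[OF F x] n by (simp add: w_def inner_diff_right inner_add_right)
    have "f w \<in> F" using elim by (simp add: w_def)
    then have "f w \<notin> T" using frontier_not_in_T face_subset_frontier[OF F] closure_subset by blast
    moreover have "f w \<in> T" if "w \<in> T"
      using ray_in_T[of w "\<delta> F / (\<delta> F + t)"] closure_subset that elim d
      by (auto simp: f_def w field_simps)
    ultimately show ?case by (auto simp: w_def)
  qed
  show "norm (\<nu> F) = 1 \<and> (\<forall>x\<in>F. \<forall>y\<in>F. \<nu> F \<bullet> (x - y) = 0) \<and>
    (\<forall>x\<in>F. \<forall>\<^sub>F t in at_right 0. x - t *\<^sub>R \<nu> F \<in> T \<and> x + t *\<^sub>R \<nu> F \<notin> T)"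
  proof (intro conjI ballI)
    fix x y assume "x \<in> F" "y \<in> F"
    then show "\<nu> F \<bullet> (x - y) = 0"
      using face_level[OF F, of x] face_level[OF F, of y] by (simp add: inner_diff_right)
  qed (use norm_\<nu>[OF F] inside outside in \<open>auto simp: eventually_conj_iff\<close>)
  fix m
  assume m: "norm m = 1 \<and> (\<forall>x\<in>F. \<forall>y\<in>F. m \<bullet> (x - y) = 0) \<and>
    (\<forall>x\<in>F. \<forall>\<^sub>F t in at_right 0. x - t *\<^sub>R m \<in> T \<and> x + t *\<^sub>R m \<notin> T)"
  obtain x where x: "x \<in> F" using face_simplex(4)[OF F] by blast
  have "m \<bullet> (y - x) = 0" if "y \<in> F" for y using m x that by blast
  then have "F \<subseteq> {y. m \<bullet> y = m \<bullet> x}" by (auto simp: inner_diff_right)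
  then have "affine hull F \<subseteq> {y. m \<bullet> y = m \<bullet> x}" by (intro hull_minimal affine_hyperplane)
  then have hp: "m \<bullet> y = m \<bullet> x" if "\<nu> F \<bullet> y = level F" for y
    using that affine_hull_face[OF F] by blast
  have "x + (m - (m \<bullet> \<nu> F) *\<^sub>R \<nu> F) \<in> {y. \<nu> F \<bullet> y = level F}"
    using face_level[OF F x] n
    by (simp add: inner_add_right inner_diff_right inner_commute[of m] algebra_simps)
  then have "m \<bullet> (m - (m \<bullet> \<nu> F) *\<^sub>R \<nu> F) = 0"
    using hp[of "x + (m - (m \<bullet> \<nu> F) *\<^sub>R \<nu> F)"] by (simp add: inner_add_right[of m])
  then have sq: "(m \<bullet> \<nu> F)\<^sup>2 = 1" using m by (simp add: inner_diff_right norm_eq_1 power2_eq_square)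
  have "(m - (m \<bullet> \<nu> F) *\<^sub>R \<nu> F) \<bullet> (m - (m \<bullet> \<nu> F) *\<^sub>R \<nu> F) = 0"
    using sq n m by (simp add: inner_diff_right inner_diff_left norm_eq_1 power2_eq_square inner_commute)
  then have "m = (m \<bullet> \<nu> F) *\<^sub>R \<nu> F" by simp
  moreover have "m \<bullet> \<nu> F = 1 \<or> m \<bullet> \<nu> F = -1" using sq by (simp add: power2_eq_1_iff)
  moreover have "m \<noteq> - \<nu> F"
  proof
    assume "m = - \<nu> F"
    then have "\<forall>\<^sub>F t in at_right 0. x + t *\<^sub>R \<nu> F \<in> T \<and> x - t *\<^sub>R \<nu> F \<notin> T" using m x by auto
    then have "\<forall>\<^sub>F t in at_right (0::real). False" using inside[OF x] by eventually_elim simp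
    then show False by simp
  qed
  ultimately show "m = \<nu> F" by auto
qed

end

section \<open>The divergence theorem\<close>

lemma poly_space_lipschitz:
  fixes q :: "'a::euclidean_space \<Rightarrow> real"
  assumes q: "q \<in> poly_space m" and X: "convex X" "compact X"
  shows "\<exists>L. L-lipschitz_on X q"
proof -
  have "\<exists>K. \<forall>x\<in>X. \<bar>frechet_derivative q (at x) b\<bar> \<le> K" for b
  proof -
    have "compact ((\<lambda>x. frechet_derivative q (at x) b) ` X)"
      by (intro compact_continuous_image poly_space_continuous[OF poly_space_deriv[OF q]] X)
    from compact_imp_bounded[OF this] obtain K
      where "\<forall>y\<in>(\<lambda>x. frechet_derivative q (at x) b) ` X. norm y \<le> K" unfolding bounded_iff ..
    then show ?thesis by auto
  qed
  then obtain K where K: "\<And>b x. x \<in> X \<Longrightarrow> \<bar>frechet_derivative q (at x) b\<bar> \<le> K b" by metis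
  have "(\<Sum>b\<in>Basis. \<bar>K b\<bar>)-lipschitz_on X q"
  proof (rule bounded_derivative_imp_lipschitz[OF _ X(1)])
    fix x assume x: "x \<in> X"
    show "(q has_derivative frechet_derivative q (at x)) (at x within X)"
      using poly_space_differentiable[OF q] has_derivative_at_withinI by blast
    have "onorm (frechet_derivative q (at x)) \<le> (\<Sum>b\<in>Basis. norm (frechet_derivative q (at x) b))"
      using poly_space_differentiable[OF q] has_derivative_bounded_linear onorm_componentwise by blast
    also have "\<dots> \<le> (\<Sum>b\<in>Basis. \<bar>K b\<bar>)"
    proof (rule sum_mono)
      fix b :: 'a
      show "norm (frechet_derivative q (at x) b) \<le> \<bar>K b\<bar>" using K[OF x, of b] by simp
    qed
    finally show "onorm (frechet_derivative q (at x)) \<le> (\<Sum>b\<in>Basis. \<bar>K b\<bar>)" .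
  qed (auto intro: sum_nonneg)
  then show ?thesis by blast
qed

text \<open>Every segment is cut by the cover into finitely many closed pieces.\<close>

lemma lipschitz_on_finite_closed_cover:
  fixes f :: "'a::real_normed_vector \<Rightarrow> 'b::metric_space"
  assumes I: "finite I" and cl: "\<And>i. i \<in> I \<Longrightarrow> closed (U i)"
    and lip: "\<And>i. i \<in> I \<Longrightarrow> L-lipschitz_on (U i) f" and L: "0 \<le> L" and cover: "UNIV = (\<Union>i\<in>I. U i)"
  shows "L-lipschitz_on UNIV f"
proof (rule lipschitz_onI)
  fix x y :: 'a
  define \<gamma> where "\<gamma> s = x + s *\<^sub>R (y - x)" for s :: real
  have cont: "continuous_on UNIV \<gamma>" unfolding \<gamma>_def by (intro continuous_intros)
  have "(L * dist x y)-lipschitz_on {0..1} (\<lambda>s. f (\<gamma> s))"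
  proof (rule lipschitz_on_closed_Union[where I=I and U="\<lambda>i. \<gamma> -` U i"])
    fix i assume i: "i \<in> I"
    show "closed (\<gamma> -` U i)" by (rule closed_vimage[OF cl[OF i] cont])
    show "(L * dist x y)-lipschitz_on (\<gamma> -` U i) (\<lambda>s. f (\<gamma> s))"
    proof (rule lipschitz_onI)
      fix s t assume "s \<in> \<gamma> -` U i" "t \<in> \<gamma> -` U i"
      then have "dist (f (\<gamma> s)) (f (\<gamma> t)) \<le> L * dist (\<gamma> s) (\<gamma> t)"
        by (intro lipschitz_onD[OF lip[OF i]]) auto
      also have "dist (\<gamma> s) (\<gamma> t) = \<bar>s - t\<bar> * norm (y - x)"
        by (simp add: \<gamma>_def dist_norm scaleR_diff_left[symmetric] del: scaleR_right_diff_distrib)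
      finally show "dist (f (\<gamma> s)) (f (\<gamma> t)) \<le> L * dist x y * dist s t"
        by (simp add: dist_norm norm_minus_commute mult_ac)
    qed (use L in simp)
    next
    show "{0..1} \<subseteq> (\<Union>i\<in>I. \<gamma> -` U i)" using cover by blast
  qed (use I L in auto)
  from lipschitz_onD[OF this, of 0 1] show "dist (f x) (f y) \<le> L * dist x y"
    by (simp add: \<gamma>_def)
qed (rule L)

text \<open>Difference quotients of a function with bounded support have integral zero, by
  translation invariance; Lipschitz continuity allows to pass to the limit.\<close>

lemma integral_derivative_zero:
  fixes f :: "'a::euclidean_space \<Rightarrow> real"
  assumes lip: "L-lipschitz_on UNIV f" and supp: "\<And>x. R < norm x \<Longrightarrow> f x = 0"
    and D [measurable]: "D \<in> borel_measurable borel"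
    and lim: "AE x in lborel. ((\<lambda>s. (f (x + s *\<^sub>R e) - f x) / s) \<longlongrightarrow> D x) (at 0)"
  shows "(\<integral>x. D x \<partial>lborel) = 0"
proof -
  have cont: "continuous_on UNIV f" by (rule lipschitz_on_continuous_on[OF lip])
  have [measurable]: "f \<in> borel_measurable borel" by (rule borel_measurable_continuous_onI[OF cont])
  have "set_integrable lborel (cball 0 R) f"
    by (rule set_integrable_continuous[OF finite_region_lborel cont]) auto
  moreover have "(\<lambda>x. indicator (cball 0 R) x *\<^sub>R f x) = f" using supp by (auto simp: indicator_def fun_eq_iff)
  ultimately have int: "integrable lborel f" unfolding set_integrable_def by (simp only:)
  have shift: "integrable lborel (\<lambda>x. f (x + v))" "(\<integral>x. f (x + v) \<partial>lborel) = (\<integral>x. f x \<partial>lborel)" for v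
  proof -
    have d: "distr lborel borel ((+) v) = lborel" by (rule lborel_distr_plus)
    have "integrable (distr lborel borel ((+) v)) f" using int by (simp add: d)
    then show "integrable lborel (\<lambda>x. f (x + v))"
      by (subst (asm) integrable_distr_eq) (auto simp: add.commute)
    have "(\<integral>x. f x \<partial>distr lborel borel ((+) v)) = (\<integral>x. f (v + x) \<partial>lborel)"
      by (rule integral_distr) auto
    then show "(\<integral>x. f (x + v) \<partial>lborel) = (\<integral>x. f x \<partial>lborel)" by (simp add: d add.commute)
  qed
  define s where "s i = 1 / real (Suc i)" for i
  have s: "0 < s i" "s i \<le> 1" for i by (auto simp: s_def divide_le_eq)
  define Q where "Q i x = (f (x + s i *\<^sub>R e) - f x) / s i" for i x
  have L0: "0 \<le> L" by (rule lipschitz_on_nonneg[OF lip])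
  let ?w = "\<lambda>x::'a. indicator (cball 0 (\<bar>R\<bar> + norm e)) x *\<^sub>R (L * norm e)"
  have "(\<lambda>i. \<integral>x. Q i x \<partial>lborel) \<longlonglongrightarrow> (\<integral>x. D x \<partial>lborel)"
  proof (rule integral_dominated_convergence[where w = ?w])
    show "integrable lborel ?w"
      using emeasure_lborel_cball_finite[of "0::'a" "\<bar>R\<bar> + norm e"] by (intro integrable_scaleR_left) simp
    show "AE x in lborel. (\<lambda>i. Q i x) \<longlonglongrightarrow> D x"
      using lim
    proof eventually_elim
      case (elim x)
      have "s \<longlonglongrightarrow> 0" unfolding s_def by (rule LIMSEQ_Suc[OF lim_1_over_n])
      then have "filterlim s (at 0) sequentially" using s(1) by (auto simp: filterlim_at less_le)
      from filterlim_compose[OF elim this] show ?case by (simp add: Q_def)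
    qed
    fix i
    show "AE x in lborel. norm (Q i x) \<le> ?w x"
    proof (rule AE_I2)
      fix x
      show "norm (Q i x) \<le> ?w x"
      proof (cases "x \<in> cball 0 (\<bar>R\<bar> + norm e)")
        case True
        have "dist (f (x + s i *\<^sub>R e)) (f x) \<le> L * dist (x + s i *\<^sub>R e) x"
          by (rule lipschitz_onD[OF lip]) auto
        then have "\<bar>f (x + s i *\<^sub>R e) - f x\<bar> \<le> L * (s i * norm e)"
          using s(1)[of i] by (simp add: dist_norm)
        then show ?thesis using True s(1)[of i] by (simp add: Q_def divide_le_eq mult_ac)
      next
        case False
        then have "\<bar>R\<bar> + norm e < norm x" by simp
        moreover have "norm (s i *\<^sub>R e) \<le> norm e" using s[of i] by (simp add: mult_left_le_one_le)
        moreover have "norm x \<le> norm (x + s i *\<^sub>R e) + norm (s i *\<^sub>R e)"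
          using norm_triangle_ineq4[of "x + s i *\<^sub>R e" "s i *\<^sub>R e"] by simp
        ultimately have "R < norm (x + s i *\<^sub>R e)" "R < norm x"
          using norm_ge_zero[of e] by linarith+
        then show ?thesis using L0 supp by (simp add: Q_def)
      qed
    qed
  qed (auto simp: Q_def)
  moreover have "(\<integral>x. Q i x \<partial>lborel) = 0" for i
    unfolding Q_def using shift[of "s i *\<^sub>R e"] int by simp
  ultimately show ?thesis using LIMSEQ_unique[OF tendsto_const] by fastforce
qed

abbreviation pderiv_dir :: "'a \<Rightarrow> ('a::euclidean_space \<Rightarrow> real) \<Rightarrow> 'a \<Rightarrow> real" where
  "pderiv_dir e q x \<equiv> frechet_derivative q (at x) e"

lemma pderiv_dir_eq: "(q has_derivative D) (at x) \<Longrightarrow> pderiv_dir e q x = D e"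
  using frechet_derivative_at by metis

lemma pderiv_dir_add:
  assumes "p \<in> poly_space m" "q \<in> poly_space m'"
  shows "pderiv_dir e (\<lambda>x. p x + q x) x = pderiv_dir e p x + pderiv_dir e q x"
  by (rule pderiv_dir_eq)
     (intro has_derivative_add poly_space_differentiable[OF assms(1)] poly_space_differentiable[OF assms(2)])

lemma pderiv_dir_cmult:
  assumes "p \<in> poly_space m"
  shows "pderiv_dir e (\<lambda>x. c * p x) x = c * pderiv_dir e p x"
  by (rule pderiv_dir_eq) (intro has_derivative_mult_right poly_space_differentiable[OF assms])

lemma pderiv_dir_mult:
  assumes "p \<in> poly_space m" "q \<in> poly_space m'"
  shows "pderiv_dir e (\<lambda>x. p x * q x) x = p x * pderiv_dir e q x + pderiv_dir e p x * q x"
  by (rule pderiv_dir_eq)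
     (intro has_derivative_mult poly_space_differentiable[OF assms(1)] poly_space_differentiable[OF assms(2)])

context star_polytope
begin

text \<open>Both representations of x lie on the same ray, which has one frontier point only.\<close>

lemma heights_agree:
  assumes F: "F \<in> \<F>" "x \<in> closure (pyr F)" and G: "G \<in> \<F>" "x \<in> closure (pyr G)"
  shows "height F x = height G x"
proof -
  obtain t y where y: "x = a + t *\<^sub>R (y - a)" "0 \<le> t" "y \<in> closure F"
    using F closure_pyramid by blast
  obtain s z where z: "x = a + s *\<^sub>R (z - a)" "0 \<le> s" "z \<in> closure G"
    using G closure_pyramid by blast
  have ne: "y \<noteq> a" "z \<noteq> a"
    using closure_face_level[OF F(1) y(3)] closure_face_level[OF G(1) z(3)] \<delta>_pos F(1) G(1) by force+
  have "t = s"
  proof (cases "t = 0 \<or> s = 0")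
    case True
    then show ?thesis using y z ne by auto
  next
    case False
    have "z = a + (1 / s) *\<^sub>R (x - a)" using z(1) False by simp
    also have "\<dots> = a + (t / s) *\<^sub>R (y - a)" unfolding y(1) by simp
    finally have "z = y"
      using False y(2,3) z(2,3) face_subset_frontier F(1) G(1)
      by (intro frontier_ray_unique[of y z "t / s"]) auto
    then show ?thesis using y z ne by auto
  qed
  then show ?thesis using height_ray[OF F(1) y(3), of t] height_ray[OF G(1) z(3), of s] y(1) z(1) by metis
qed

text \<open>The Minkowski functional of T about the apex, replaced by 1 outside T.\<close>

definition gauge :: "'a \<Rightarrow> real" where
  "gauge x = (if \<exists>F\<in>\<F>. x \<in> closure (pyr F)
    then height (SOME F. F \<in> \<F> \<and> x \<in> closure (pyr F)) x else 1)"

lemma gauge_height: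
  assumes "F \<in> \<F>" "x \<in> closure (pyr F)"
  shows "gauge x = height F x"
proof -
  define G where "G = (SOME F. F \<in> \<F> \<and> x \<in> closure (pyr F))"
  have ex: "\<exists>F. F \<in> \<F> \<and> x \<in> closure (pyr F)" using assms by blast
  have G: "G \<in> \<F>" "x \<in> closure (pyr G)" using someI_ex[OF ex] unfolding G_def by auto
  have "gauge x = height G x" unfolding gauge_def G_def using ex by auto
  then show ?thesis using heights_agree[OF G assms] by simp
qed

lemma gauge_outside:
  assumes "x \<notin> T"
  shows "gauge x = 1"
proof (cases "x \<in> closure T")
  case True
  then have "x \<in> frontier T" using assms open_T by (simp add: frontier_def interior_open)
  then obtain F where F: "F \<in> \<F>" "x \<in> closure F" using frontier_T by blast
  have x: "x = a + 1 *\<^sub>R (x - a)" by simp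
  then have "x \<in> closure (pyr F)" using F unfolding closure_pyramid[OF F(1)]
    by (intro CollectI exI[of _ 1] exI[of _ x]) auto
  then show ?thesis using gauge_height[OF F(1)] height_ray[OF F, of 1] by simp
next
  case False
  then show ?thesis using closure_T_cover by (auto simp: gauge_def)
qed

lemma height_poly: "height F \<in> poly_space 1"
proof -
  have "(\<lambda>x. (1 / \<delta> F) * (x \<bullet> \<nu> F - a \<bullet> \<nu> F)) \<in> poly_space 1"
    by (intro poly_space_cmult poly_space_diff poly_space_inner poly_space_const) simp
  moreover have "height F = (\<lambda>x. (1 / \<delta> F) * (x \<bullet> \<nu> F - a \<bullet> \<nu> F))"
    by (rule ext) (simp add: height_def inner_diff_right inner_commute[of "\<nu> F"] inner_diff_left)
  ultimately show ?thesis by simp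
qed

lemma height_has_derivative: "(height F has_derivative (\<lambda>e. \<nu> F \<bullet> e / \<delta> F)) (at x)"
proof -
  have "((\<lambda>x. (1 / \<delta> F) * (\<nu> F \<bullet> (x - a))) has_derivative (\<lambda>e. (1 / \<delta> F) * (\<nu> F \<bullet> (e - 0)))) (at x)"
    by (intro derivative_intros)
  then show ?thesis by (simp add: height_def[abs_def])
qed

lemma deriv_homogeneous_0:
  assumes "\<And>t y. 0 \<le> t \<Longrightarrow> q (a + t *\<^sub>R (y - a)) = q y"
  shows "pderiv_dir e q x = 0"
proof -
  have "q y = q a" for y using assms[of 0 y] by simp
  then have "q = (\<lambda>_. q a)" by (rule ext)
  then show ?thesis using pderiv_dir_eq[of q "\<lambda>_. 0" x e] by (metis has_derivative_const)
qed

text \<open>For j = 0 the polynomial is constant, so that the truncated exponent is harmless.\<close>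

lemma deriv_homogeneous:
  assumes q: "q \<in> poly_space m" and hom: "\<And>t y. 0 \<le> t \<Longrightarrow> q (a + t *\<^sub>R (y - a)) = t ^ j * q y"
    and t: "0 < t"
  shows "pderiv_dir e q (a + t *\<^sub>R (y - a)) = t ^ (j - 1) * pderiv_dir e q y"
proof (cases j)
  case 0
  then have "pderiv_dir e q x = 0" for x by (intro deriv_homogeneous_0) (use hom in auto)
  then show ?thesis by simp
next
  case (Suc i)
  have 1: "((\<lambda>x. q (a + t *\<^sub>R (x - a))) has_derivative
      (\<lambda>v. frechet_derivative q (at (a + t *\<^sub>R (y - a))) (t *\<^sub>R v))) (at y)"
    by (rule has_derivative_compose[where g=q, OF _ poly_space_differentiable[OF q]])
       (auto intro!: derivative_eq_intros)
  have 2: "((\<lambda>x. t ^ j * q x) has_derivative (\<lambda>v. t ^ j * frechet_derivative q (at y) v)) (at y)"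
    by (intro has_derivative_mult_right poly_space_differentiable[OF q])
  have "(\<lambda>x. q (a + t *\<^sub>R (x - a))) = (\<lambda>x. t ^ j * q x)" using hom t by auto
  then have "pderiv_dir (t *\<^sub>R e) q (a + t *\<^sub>R (y - a)) = t ^ j * pderiv_dir e q y"
    using has_derivative_unique[OF 1] 2 by (metis (no_types, lifting))
  moreover have "pderiv_dir (t *\<^sub>R e) q (a + t *\<^sub>R (y - a)) = t * pderiv_dir e q (a + t *\<^sub>R (y - a))"
    using has_derivative_bounded_linear[OF poly_space_differentiable[OF q]]
    by (simp add: linear_simps)
  ultimately have "t * pderiv_dir e q (a + t *\<^sub>R (y - a)) = t * (t ^ (j - 1) * pderiv_dir e q y)"
    using Suc by simp
  then show ?thesis using t by simp
qed

text \<open>Integration by parts against the Lipschitz cut-off that is 1 at the apex, affine on each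
  pyramid and 0 on the frontier.\<close>

lemma integral_by_parts_gauge:
  assumes q: "q \<in> poly_space m"
  shows "(\<Sum>F\<in>\<F>. LINT x:pyr F|lborel. pderiv_dir e (\<lambda>x. (1 - height F x) * q x) x) = 0"
proof -
  define f where "f x = (1 - gauge x) * q x" for x
  define p where "p F = (\<lambda>x. (1 - height F x) * q x)" for F
  have p: "p F \<in> poly_space (1 + m)" for F
    unfolding p_def by (intro poly_space_mult poly_space_diff poly_space_const height_poly q) simp
  have fp: "f x = p F x" if "F \<in> \<F>" "x \<in> closure (pyr F)" for F x
    using gauge_height[OF that] by (simp add: f_def p_def)
  have f0: "f x = 0" if "x \<notin> T" for x using gauge_outside[OF that] by (simp add: f_def)
  have "\<exists>L. L-lipschitz_on (closure (pyr F)) (p F)" if "F \<in> \<F>" for F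
    using bounded_pyramid[OF that] convex_pyramid
    by (intro poly_space_lipschitz[OF p] convex_closure) (auto simp: compact_eq_bounded_closed)
  then obtain L where L: "\<And>F. F \<in> \<F> \<Longrightarrow> (L F)-lipschitz_on (closure (pyr F)) (p F)" by metis
  define M where "M = (\<Sum>F\<in>\<F>. \<bar>L F\<bar>)"
  have LM: "L F \<le> M" if "F \<in> \<F>" for F
    using member_le_sum[OF that, of "\<lambda>F. \<bar>L F\<bar>"] finite_faces by (simp add: M_def)
  have M0: "0 \<le> M" unfolding M_def by (intro sum_nonneg) auto
  define U where "U i = (case i of None \<Rightarrow> - T | Some F \<Rightarrow> closure (pyr F))" for i
  have lip: "M-lipschitz_on UNIV f"
  proof (rule lipschitz_on_finite_closed_cover[where I="insert None (Some ` \<F>)" and U=U])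
    show "finite (insert None (Some ` \<F>))" using finite_faces by simp
    show "UNIV = (\<Union>i\<in>insert None (Some ` \<F>). U i)"
      using closure_T_cover closure_subset[of T] by (auto simp: U_def)
    fix i assume i: "i \<in> insert None (Some ` \<F>)"
    show "closed (U i)" using open_T by (cases i) (auto simp: U_def)
    show "M-lipschitz_on (U i) f"
    proof (cases i)
      case None
      then show ?thesis using f0 M0 by (auto simp: U_def intro!: lipschitz_onI)
    next
      case (Some F)
      then have F: "F \<in> \<F>" using i by auto
      have "M-lipschitz_on (closure (pyr F)) (p F)" by (rule lipschitz_on_le[OF L[OF F] LM[OF F]])
      then show ?thesis using Some fp[OF F] by (auto simp: U_def lipschitz_on_def)
    qed
  qed (rule M0)
  obtain R where R: "\<And>x. x \<in> T \<Longrightarrow> norm x \<le> R" using bounded_T unfolding bounded_iff by blast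
  define D where "D x = (\<Sum>F\<in>\<F>. indicator (pyr F) x *\<^sub>R pderiv_dir e (p F) x)" for x
  have Dm: "D \<in> borel_measurable borel"
    unfolding D_def using open_pyramid poly_space_borel[OF poly_space_deriv[OF p]]
    by (intro borel_measurable_sum borel_measurable_scaleR borel_measurable_indicator) auto
  have "(\<integral>x. D x \<partial>lborel) = 0"
  proof (rule integral_derivative_zero[OF lip _ Dm, of R e])
    show "f x = 0" if "R < norm x" for x using R[of x] f0[of x] that by force
    show "AE x in lborel. ((\<lambda>s. (f (x + s *\<^sub>R e) - f x) / s) \<longlongrightarrow> D x) (at 0)"
      using AE_pyramids
    proof eventually_elim
      case (elim x)
      have lim: "((\<lambda>s. x + s *\<^sub>R e) \<longlongrightarrow> x) (at 0)" by (auto intro!: tendsto_eq_intros)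
      show ?case
      proof (cases "x \<in> closure T")
        case True
        then obtain F where F: "F \<in> \<F>" "x \<in> pyr F" using elim by blast
        have "((\<lambda>s. p F (x + s *\<^sub>R e)) has_derivative (\<lambda>s. pderiv_dir (s *\<^sub>R e) (p F) x)) (at 0)"
        proof -
          have "((\<lambda>s. x + s *\<^sub>R e) has_derivative (\<lambda>s. s *\<^sub>R e)) (at 0)"
            by (auto intro!: derivative_eq_intros)
          from has_derivative_compose[OF this, of "p F"] show ?thesis
            using poly_space_differentiable[OF p, of F x] by simp
        qed
        moreover have "pderiv_dir (s *\<^sub>R e) (p F) x = pderiv_dir e (p F) x * s" for s
          using has_derivative_bounded_linear[OF poly_space_differentiable[OF p]]
          by (simp add: linear_simps mult.commute)
        ultimately have "((\<lambda>s. p F (x + s *\<^sub>R e)) has_real_derivative pderiv_dir e (p F) x) (at 0)"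
          by (simp add: has_field_derivative_def)
        then have "((\<lambda>s. (p F (x + s *\<^sub>R e) - p F x) / s) \<longlongrightarrow> pderiv_dir e (p F) x) (at 0)"
          by (simp add: DERIV_def)
        moreover have "\<forall>\<^sub>F s in at 0. (p F (x + s *\<^sub>R e) - p F x) / s = (f (x + s *\<^sub>R e) - f x) / s"
          using topological_tendstoD[OF lim open_pyramid F(2)]
        proof eventually_elim
          case (elim s)
          then have "x \<in> closure (pyr F)" "x + s *\<^sub>R e \<in> closure (pyr F)"
            using F(2) closure_subset by blast+
          then show ?case using fp[OF F(1)] by simp
        qed
        ultimately have "((\<lambda>s. (f (x + s *\<^sub>R e) - f x) / s) \<longlongrightarrow> pderiv_dir e (p F) x) (at 0)"
          by (rule Lim_transform_eventually)
        moreover have "D x = pderiv_dir e (p F) x"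
          unfolding D_def by (rule sum_indicator_pyramids[OF F(2,1)])
        ultimately show ?thesis by simp
      next
        case False
        have "\<forall>\<^sub>F s in at 0. x + s *\<^sub>R e \<in> - closure T"
          using False by (intro topological_tendstoD[OF lim]) auto
        then have "\<forall>\<^sub>F s in at 0. 0 = (f (x + s *\<^sub>R e) - f x) / s"
        proof eventually_elim
          case (elim s)
          then have "x \<notin> T" "x + s *\<^sub>R e \<notin> T" using False closure_subset by blast+
          then show ?case using f0 by simp
        qed
        then have "((\<lambda>s. (f (x + s *\<^sub>R e) - f x) / s) \<longlongrightarrow> 0) (at 0)"
          by (rule Lim_transform_eventually[OF tendsto_const])
        moreover have "D x = 0"
          unfolding D_def using False pyramid_subset closure_subset
          by (intro sum.neutral) (auto simp: indicator_def dest!: subsetD)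
        ultimately show ?thesis by simp
      qed
    qed
  qed
  moreover have "(\<integral>x. D x \<partial>lborel) = (\<Sum>F\<in>\<F>. LINT x:pyr F|lborel. pderiv_dir e (p F) x)"
    unfolding D_def set_lebesgue_integral_def
  proof (rule Bochner_Integration.integral_sum)
    fix F assume "F \<in> \<F>"
    then show "integrable lborel (\<lambda>x. indicator (pyr F) x *\<^sub>R pderiv_dir e (p F) x)"
      using set_integrable_continuous[OF region_pyramid poly_space_continuous[OF poly_space_deriv[OF p]]]
      by (simp add: set_integrable_def)
  qed
  ultimately show ?thesis unfolding p_def by simp
qed

text \<open>For a homogeneous polynomial all volume integrals in the preceding identity are multiples
  of face integrals, and the cut-off disappears.\<close>

lemma divergence_homogeneous:
  assumes q: "q \<in> poly_space m" and hom: "\<And>t y. 0 \<le> t \<Longrightarrow> q (a + t *\<^sub>R (y - a)) = t ^ j * q y"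
  shows "(LINT x:T|lborel. pderiv_dir e q x) =
    (\<Sum>F\<in>\<F>. (\<nu> F \<bullet> e) * (LINT x:F|face_measure F. q x))"
proof -
  let ?d = "real DIM('a)"
  have d: "0 < ?d" by simp
  let ?q' = "\<lambda>x. pderiv_dir e q x"
  have q': "?q' \<in> poly_space (m - 1)" by (rule poly_space_deriv[OF q])
  have eq: "(LINT x:pyr F|lborel. pderiv_dir e (\<lambda>x. (1 - height F x) * q x) x) =
      ((LINT x:pyr F|lborel. ?q' x) - (\<nu> F \<bullet> e) * (LINT x:F|face_measure F. q x)) / (real j + ?d)"
    if F: "F \<in> \<F>" for F
  proof -
    have dF: "0 < \<delta> F" by (rule \<delta>_pos[OF F])
    define I where "I = (LINT x:F|face_measure F. ?q' x)"
    have hq: "(\<lambda>x. height F x * ?q' x) \<in> poly_space (1 + (m - 1))"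
      by (rule poly_space_mult[OF height_poly q'])
    have "pderiv_dir e (\<lambda>x. (1 - height F x) * q x) x =
        (?q' x - height F x * ?q' x) - (\<nu> F \<bullet> e / \<delta> F) * q x" for x
    proof -
      have h1: "(\<lambda>x. 1 - height F x) \<in> poly_space 1"
        by (intro poly_space_diff poly_space_const height_poly) simp
      have "pderiv_dir e (\<lambda>x. 1 - height F x) x = - (\<nu> F \<bullet> e / \<delta> F)"
        using pderiv_dir_eq[OF has_derivative_diff[OF has_derivative_const height_has_derivative]] by simp
      then show ?thesis using pderiv_dir_mult[OF h1 q, where e=e and x=x] by (simp add: algebra_simps)
    qed
    then have "(LINT x:pyr F|lborel. pderiv_dir e (\<lambda>x. (1 - height F x) * q x) x) =
        (LINT x:pyr F|lborel. (?q' x - height F x * ?q' x) - (\<nu> F \<bullet> e / \<delta> F) * q x)" by simp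
    also have "\<dots> = (LINT x:pyr F|lborel. ?q' x) - (LINT x:pyr F|lborel. height F x * ?q' x) -
        (\<nu> F \<bullet> e / \<delta> F) * (LINT x:pyr F|lborel. q x)"
    proof -
      note i = set_integrable_continuous[OF region_pyramid[OF F] poly_space_continuous]
      show ?thesis
        using i[OF q'] i[OF hq] i[OF q] i[OF poly_space_cmult[OF q]]
        by (simp add: set_integral_diff)
    qed
    also have "(LINT x:pyr F|lborel. height F x * ?q' x) = (real (j - 1) + ?d) / (real j + ?d) *
        (LINT x:pyr F|lborel. ?q' x)"
    proof -
      have i1: "(LINT x:pyr F|lborel. ?q' x) = \<delta> F / (real (j - 1) + ?d) * I"
        unfolding I_def
        by (rule integral_pyramid_homogeneous[OF F poly_space_continuous[OF q']])
           (rule deriv_homogeneous[OF q hom])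
      have "(LINT x:pyr F|lborel. height F x * ?q' x) =
          \<delta> F / (real (j - 1 + 1) + ?d) * (LINT x:F|face_measure F. height F x * ?q' x)"
      proof (rule integral_pyramid_homogeneous[OF F poly_space_continuous[OF hq]])
        fix t :: real and y assume t: "0 < t"
        have "height F (a + t *\<^sub>R (y - a)) = t * height F y" by (simp add: height_def)
        then show "height F (a + t *\<^sub>R (y - a)) * ?q' (a + t *\<^sub>R (y - a)) =
            t ^ (j - 1 + 1) * (height F y * ?q' y)"
          using deriv_homogeneous[OF q hom t, where e=e and y=y] by simp
      qed
      also have "(LINT x:F|face_measure F. height F x * ?q' x) = I"
        unfolding I_def set_lebesgue_integral_def
        by (intro Bochner_Integration.integral_cong)
           (use height_ray[OF F, where t=1] closure_subset[of F] in \<open>auto simp: indicator_def subset_iff\<close>)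
      finally have i2: "(LINT x:pyr F|lborel. height F x * ?q' x) = \<delta> F / (real (j - 1 + 1) + ?d) * I" .
      show ?thesis
      proof (cases j)
        case 0
        have "?q' x = 0" for x by (rule deriv_homogeneous_0) (use hom 0 in auto)
        then show ?thesis by simp
      next
        case (Suc i)
        then have j: "j - 1 + 1 = j" by simp
        have "0 < real (j - 1) + ?d" using d by linarith
        then show ?thesis unfolding i1 i2 j by simp
      qed
    qed
    also have "(LINT x:pyr F|lborel. q x) = \<delta> F / (real j + ?d) * (LINT x:F|face_measure F. q x)"
      by (rule integral_pyramid_homogeneous[OF F poly_space_continuous[OF q]]) (use hom in simp)
    finally show ?thesis
    proof -
      assume *: "(LINT x:pyr F|lborel. pderiv_dir e (\<lambda>x. (1 - height F x) * q x) x) =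
        (LINT x:pyr F|lborel. ?q' x) - (real (j - 1) + ?d) / (real j + ?d) * (LINT x:pyr F|lborel. ?q' x) -
        \<nu> F \<bullet> e / \<delta> F * (\<delta> F / (real j + ?d) * (LINT x:F|face_measure F. q x))"
      show ?thesis
      proof (cases j)
        case 0
        have "?q' x = 0" for x by (rule deriv_homogeneous_0) (use hom 0 in auto)
        then show ?thesis using * dF by simp
      next
        case (Suc i)
        have "X - (real i + ?d) / (real (Suc i) + ?d) * X = X / (real (Suc i) + ?d)" for X
          using d by (simp add: field_simps)
        then show ?thesis using * dF Suc by (simp add: diff_divide_distrib)
      qed
    qed
  qed
  have "0 = (\<Sum>F\<in>\<F>. ((LINT x:pyr F|lborel. ?q' x) -
      (\<nu> F \<bullet> e) * (LINT x:F|face_measure F. q x)) / (real j + ?d))"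
    using integral_by_parts_gauge[OF q, of e] by (simp add: eq)
  also have "\<dots> = ((\<Sum>F\<in>\<F>. LINT x:pyr F|lborel. ?q' x) -
      (\<Sum>F\<in>\<F>. (\<nu> F \<bullet> e) * (LINT x:F|face_measure F. q x))) / (real j + ?d)"
    by (simp add: sum_divide_distrib[symmetric] sum_subtractf)
  finally have "(\<Sum>F\<in>\<F>. LINT x:pyr F|lborel. ?q' x) =
      (\<Sum>F\<in>\<F>. (\<nu> F \<bullet> e) * (LINT x:F|face_measure F. q x))" using d by simp
  then show ?thesis using integral_T_pyramids[OF poly_space_continuous[OF q']] by simp
qed

text \<open>Monomials in x - a are homogeneous about the apex and span all polynomials.\<close>

lemma divergence_poly:
  assumes q: "q \<in> poly_space m"
  shows "(LINT x:T|lborel. pderiv_dir e q x) =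
    (\<Sum>F\<in>\<F>. (\<nu> F \<bullet> e) * (LINT x:F|face_measure F. q x))"
proof -
  have shift: "(\<lambda>x. p (x - a)) \<in> poly_space m" if "p \<in> poly_space m" for p
    using poly_space_shift_scale[OF that, of "-a" 1] by simp
  have "(LINT x:T|lborel. pderiv_dir e (\<lambda>x. p (x - a)) x) =
      (\<Sum>F\<in>\<F>. (\<nu> F \<bullet> e) * (LINT x:F|face_measure F. p (x - a)))" if "p \<in> poly_space m" for p
    using that
  proof (induction p rule: poly_space_induct)
    case zero
    have "pderiv_dir e (\<lambda>x. 0) x = 0" for x :: 'a by (rule pderiv_dir_eq) simp
    then show ?case by simp
  next
    case (add p p')
    note s = shift[OF add.hyps(1)] shift[OF add.hyps(2)]
    note i = set_integrable_continuous[OF _ poly_space_continuous]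
    have "(LINT x:T|lborel. pderiv_dir e (\<lambda>x. p (x - a) + p' (x - a)) x) =
        (LINT x:T|lborel. pderiv_dir e (\<lambda>x. p (x - a)) x) + (LINT x:T|lborel. pderiv_dir e (\<lambda>x. p' (x - a)) x)"
      unfolding pderiv_dir_add[OF s]
      by (rule set_integral_add) (rule i[OF region_T poly_space_deriv], rule s)+
    also have "\<dots> = (\<Sum>F\<in>\<F>. (\<nu> F \<bullet> e) * (LINT x:F|face_measure F. p (x - a)) +
        (\<nu> F \<bullet> e) * (LINT x:F|face_measure F. p' (x - a)))"
      by (simp add: add.IH sum.distrib)
    also have "\<dots> = (\<Sum>F\<in>\<F>. (\<nu> F \<bullet> e) * (LINT x:F|face_measure F. p (x - a) + p' (x - a)))"
    proof (rule sum.cong[OF refl])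
      fix F assume F: "F \<in> \<F>"
      have "(LINT x:F|face_measure F. p (x - a) + p' (x - a)) =
          (LINT x:F|face_measure F. p (x - a)) + (LINT x:F|face_measure F. p' (x - a))"
        by (rule set_integral_add) (rule i[OF region_face[OF F]], rule s)+
      then show "(\<nu> F \<bullet> e) * (LINT x:F|face_measure F. p (x - a)) +
          (\<nu> F \<bullet> e) * (LINT x:F|face_measure F. p' (x - a)) =
          (\<nu> F \<bullet> e) * (LINT x:F|face_measure F. p (x - a) + p' (x - a))"
        by (simp add: distrib_left)
    qed
    finally show ?case .
  next
    case (monomial c \<alpha>)
    have "(\<lambda>x. c * monomial \<alpha> x) \<in> poly_space m"
      by (intro poly_space_cmult monomial_in_poly_space monomial)
    note s = shift[OF this]
    show ?case
    proof (rule divergence_homogeneous[OF s])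
      fix t :: real and y
      have "monomial \<alpha> (t *\<^sub>R (y - a)) = t ^ (\<Sum>b\<in>Basis. \<alpha> b) * monomial \<alpha> (y - a)"
        by (simp add: monomial_def power_mult_distrib prod.distrib power_sum)
      then show "c * monomial \<alpha> (a + t *\<^sub>R (y - a) - a) =
          t ^ (\<Sum>b\<in>Basis. \<alpha> b) * (c * monomial \<alpha> (y - a))" by simp
    qed
  qed
  from this[of "\<lambda>x. q (a + x)"] show ?thesis
    using poly_space_shift_scale[OF q, of a 1] by simp
qed

end

section \<open>Regular meshes\<close>

text \<open>The slice of the simplex through the centre of the ball, parallel to the facet, contains a disc
  of the same radius; projecting it from the opposite vertex can only enlarge it.\<close>

lemma facet_contains_disc:
  fixes \<tau> \<sigma> :: "'a::euclidean_space set"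
  assumes \<tau>: "int DIM('a) simplex \<tau>" and \<sigma>: "\<sigma> facet_of \<tau>" and r: "0 < r" and b: "ball c r \<subseteq> \<tau>"
  shows "\<exists>c'\<in>affine hull \<sigma>. affine hull \<sigma> \<inter> ball c' r \<subseteq> \<sigma>"
proof -
  obtain C where C: "\<not> affine_dependent C" "\<tau> = convex hull C"
    using \<tau> unfolding simplex_def by blast
  obtain v where v: "v \<in> C" "\<sigma> = convex hull (C - {v})" "\<sigma> \<noteq> {}"
    using \<sigma> facet_of_convex_hull_affine_independent[OF C(1)] unfolding C(2) by blast
  have v_off: "v \<notin> affine hull \<sigma>"
    using C(1) v unfolding affine_dependent_def by (simp add: affine_hull_convex_hull)
  have "aff_dim \<sigma> = int DIM('a) - 1"
    using \<sigma> aff_dim_simplex[OF \<tau>] by (simp add: facet_of_def)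
  then obtain n k where n: "n \<noteq> 0" "affine hull \<sigma> = {x. n \<bullet> x = k}"
    using aff_dim_eq_hyperplane[of \<sigma>] DIM_positive[where 'a='a] by (auto simp: of_nat_diff)
  define D where "D = k - n \<bullet> v"
  have D: "D \<noteq> 0" using v_off n(2) by (auto simp: D_def)
  have on_\<sigma>: "n \<bullet> (w - v) = D" if "w \<in> \<sigma>" for w
  proof -
    have "w \<in> affine hull \<sigma>" using that hull_subset[of \<sigma> affine] by blast
    then show ?thesis using n(2) by (simp add: D_def inner_diff_right)
  qed
  have hull: "\<exists>s w. 0 \<le> s \<and> s \<le> 1 \<and> w \<in> \<sigma> \<and> z = v + s *\<^sub>R (w - v)" if "z \<in> \<tau>" for z
  proof -
    have "\<tau> = convex hull (insert v (C - {v}))" using C(2) v(1) by (simp add: insert_absorb)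
    moreover have ne: "C - {v} \<noteq> {}" using v(2,3) convex_hull_eq_empty by blast
    ultimately have "z \<in> convex hull (insert v (C - {v}))" using that by simp
    then obtain u s w where uv: "0 \<le> u" "0 \<le> s" "u + s = 1" "w \<in> \<sigma>" "z = u *\<^sub>R v + s *\<^sub>R w"
      unfolding convex_hull_insert[OF ne] v(2) by blast
    then have u: "u = 1 - s" by simp
    have "z = v + s *\<^sub>R (w - v)" unfolding uv(5) u by (simp add: algebra_simps)
    then show ?thesis using uv by (intro exI[of _ s] exI[of _ w]) auto
  qed
  define t where "t = n \<bullet> (c - v) / D"
  have "c \<in> \<tau>" using b r by auto
  from hull[OF this] obtain s0 w0 where s0: "0 \<le> s0" "s0 \<le> 1" "w0 \<in> \<sigma>" "c = v + s0 *\<^sub>R (w0 - v)" by blast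
  have t_s0: "t = s0" using s0(4) on_\<sigma>[OF s0(3)] D by (simp add: t_def)
  \<comment> \<open>Otherwise the ball would leave the simplex through the vertex, on the side away from the facet.\<close>
  have t0: "t \<noteq> 0"
  proof
    assume "t = 0"
    then have cv: "n \<bullet> (c - v) = 0" using D by (simp add: t_def)
    define z where "z = c - (sgn D * (r / 2) / norm n) *\<^sub>R n"
    have "z \<in> ball c r" using r n(1) D by (simp add: z_def dist_norm abs_mult)
    then have "z \<in> \<tau>" using b by blast
    from hull[OF this] obtain s w where s: "0 \<le> s" "w \<in> \<sigma>" "z = v + s *\<^sub>R (w - v)" by blast
    have "n \<bullet> (z - v) = s * D" using s on_\<sigma> by simp
    moreover have "n \<bullet> (z - v) = - (sgn D * (r / 2) * norm n)"
      using cv n(1) by (simp add: z_def inner_diff_right dot_square_norm power2_eq_square)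
    ultimately have "s * D = - (sgn D * (r / 2) * norm n)" by simp
    then have "s * D * D = - (sgn D * D * ((r / 2) * norm n))" by (simp add: algebra_simps)
    then have "s * (D * D) = - (\<bar>D\<bar> * ((r / 2) * norm n))" by (simp add: abs_sgn mult_ac)
    moreover have "0 \<le> s * (D * D)" using s(1) by simp
    moreover have "0 < \<bar>D\<bar> * ((r / 2) * norm n)" using D r n(1) by simp
    ultimately show False by linarith
  qed
  then have t: "0 < t" "t \<le> 1" using s0 t_s0 by auto
  define c' where "c' = v + (1 / t) *\<^sub>R (c - v)"
  have "n \<bullet> (c - v) = t * D" using D by (simp add: t_def)
  then have "n \<bullet> c' = k" using t0 by (simp add: c'_def D_def inner_add_right)
  then have c'_in: "c' \<in> affine hull \<sigma>" using n(2) by simp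
  have "y \<in> \<sigma>" if y: "y \<in> affine hull \<sigma>" "y \<in> ball c' r" for y
  proof -
    define z where "z = v + t *\<^sub>R (y - v)"
    have "z - c = t *\<^sub>R (y - c')" using t0 by (simp add: z_def c'_def algebra_simps)
    then have "norm (z - c) = t * norm (y - c')" using t by simp
    then have "dist c z = t * dist c' y" by (simp add: dist_norm norm_minus_commute)
    also have "\<dots> \<le> 1 * dist c' y" using t by (intro mult_right_mono) auto
    finally have "z \<in> ball c r" using y by auto
    then have "z \<in> \<tau>" using b by blast
    from hull[OF this] obtain s w where s: "w \<in> \<sigma>" "z = v + s *\<^sub>R (w - v)" by blast
    have "n \<bullet> (y - v) = D" using y(1) n(2) by (simp add: D_def inner_diff_right)
    moreover have "n \<bullet> (t *\<^sub>R (y - v)) = n \<bullet> (s *\<^sub>R (w - v))" using s(2) by (simp add: z_def)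
    ultimately have "t * D = s * D" using on_\<sigma>[OF s(1)] by (simp only: inner_scaleR_right)
    then have "s = t" using D by simp
    then have "t *\<^sub>R (y - v) = t *\<^sub>R (w - v)" using s(2) by (simp add: z_def)
    then show ?thesis using t0 s(1) by simp
  qed
  then show ?thesis using c'_in by blast
qed

text \<open>Half the inradius, because the supremum over inscribed balls need not be attained.\<close>

lemma inradius_ball:
  assumes "0 < inradius X"
  shows "\<exists>c. ball c (inradius X / 2) \<subseteq> X"
proof -
  have "\<exists>r\<in>{r. \<exists>a. ball a r \<subseteq> X}. inradius X / 2 < r"
  proof (rule less_cSupE)
    show "inradius X / 2 < Sup {r. \<exists>a. ball a r \<subseteq> X}" using assms by (simp add: inradius_def)
    show "{r. \<exists>a. ball a r \<subseteq> X} \<noteq> {}"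
      by (rule ex_in_conv[THEN iffD1], rule exI[of _ "0"]) auto
  qed blast
  then obtain r a where "ball a r \<subseteq> X" "inradius X / 2 < r" by blast
  then have "ball a (inradius X / 2) \<subseteq> X" by (meson less_imp_le subset_ball subset_trans)
  then show ?thesis by blast
qed

lemma inradius_ge:
  assumes "ball c r \<subseteq> X" "bounded (X :: 'a::euclidean_space set)"
  shows "r \<le> inradius X"
  unfolding inradius_def
proof (rule cSup_upper)
  obtain K where K: "\<And>x. x \<in> X \<Longrightarrow> norm x \<le> K" using assms(2) unfolding bounded_iff by blast
  obtain b :: 'a where b: "b \<in> Basis" by (rule exE[OF ex_in_conv[THEN iffD2, OF nonempty_Basis]])
  show "bdd_above {r. \<exists>a. ball a r \<subseteq> X}"
  proof (rule bdd_aboveI[of _ "2 * \<bar>K\<bar>"], clarify)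
    fix r a assume sub: "ball a r \<subseteq> X"
    show "r \<le> 2 * \<bar>K\<bar>"
    proof (rule ccontr)
      assume r: "\<not> r \<le> 2 * \<bar>K\<bar>"
      have "a + (2 * \<bar>K\<bar>) *\<^sub>R b \<in> ball a r" "a - (2 * \<bar>K\<bar>) *\<^sub>R b \<in> ball a r" "a \<in> ball a r"
        using r b by (auto simp: dist_norm)
      then have *: "norm (a + (2 * \<bar>K\<bar>) *\<^sub>R b) \<le> K" "norm (a - (2 * \<bar>K\<bar>) *\<^sub>R b) \<le> K" "norm a \<le> K"
        using sub K by blast+
      have "norm ((a + (2 * \<bar>K\<bar>) *\<^sub>R b) - (a - (2 * \<bar>K\<bar>) *\<^sub>R b)) \<le> K + K"
        using norm_triangle_ineq4 * by (meson add_mono order_trans)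
      moreover have "(a + (2 * \<bar>K\<bar>) *\<^sub>R b) - (a - (2 * \<bar>K\<bar>) *\<^sub>R b) = (4 * \<bar>K\<bar>) *\<^sub>R b"
        by (simp add: algebra_simps flip: scaleR_add_left)
      ultimately have "4 * \<bar>K\<bar> \<le> 2 * K" using b by simp
      then have K0: "K = 0" by linarith
      have "a + (r / 2) *\<^sub>R b \<in> ball a r" using r b by (auto simp: dist_norm)
      then have "norm (a + (r / 2) *\<^sub>R b) \<le> 0" using sub K K0 by auto
      moreover have "a = 0" using *(3) K0 by simp
      ultimately show False using r b K0 by simp
    qed
  qed
qed (use assms in blast)

text \<open>The face is covered by the facets of the simplices inside T.  If each facet met it in a set that
  is nowhere dense in the hyperplane, this would contradict Baire's theorem.\<close>

lemma face_contains_facet: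
  fixes T F :: "'a::euclidean_space set"
  assumes S: "finite \<S>" "\<And>\<tau>. \<tau> \<in> \<S> \<Longrightarrow> int DIM('a) simplex \<tau>" "closure \<Omega> = \<Union>\<S>"
    and sub: "\<And>\<tau>. \<tau> \<in> \<S> \<Longrightarrow> \<exists>T\<in>\<T>. interior \<tau> \<subseteq> T"
    and T: "T \<in> \<T>" "open T" "T \<subseteq> closure \<Omega>" and disj: "pairwise disjnt \<T>"
    and F: "F \<noteq> {}" "F \<subseteq> frontier T" "openin (top_of_set {x. n \<bullet> x = k}) F" "n \<noteq> 0"
  shows "\<exists>\<tau>\<in>\<S>. interior \<tau> \<subseteq> T \<and> (\<exists>\<sigma>. \<sigma> facet_of \<tau> \<and> rel_interior \<sigma> \<inter> F \<noteq> {} \<and>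
    affine hull \<sigma> = {x. n \<bullet> x = k})"
proof -
  let ?H = "{x. n \<bullet> x = k}"
  define R where "R = {\<tau>\<in>\<S>. interior \<tau> \<subseteq> T}"
  have poly: "polytope \<tau>" "closed \<tau>" "convex \<tau>" if "\<tau> \<in> \<S>" for \<tau>
    using S(2)[OF that] simplex_imp_polytope closed_simplex convex_simplex by blast+
  have int_ne: "closure (interior \<tau>) = \<tau>" if "\<tau> \<in> \<S>" for \<tau>
  proof -
    have "aff_dim \<tau> = int DIM('a)" by (rule aff_dim_simplex[OF S(2)[OF that]])
    then have "interior \<tau> \<noteq> {}"
      using interior_rel_interior[of \<tau>] rel_interior_eq_empty[OF poly(3)[OF that]] by auto
    then show ?thesis
      using convex_closure_interior[OF poly(3)[OF that]] poly(2)[OF that] by simp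
  qed
  have finR: "finite R" using S(1) by (simp add: R_def)
  have "T \<subseteq> \<Union>R"
  proof
    fix x assume x: "x \<in> T"
    then obtain \<tau> where \<tau>: "\<tau> \<in> \<S>" "x \<in> \<tau>" using T(3) S(3) by blast
    then have "x \<in> closure (interior \<tau>)" using int_ne by simp
    then have "T \<inter> interior \<tau> \<noteq> {}" using x T(2) by (metis closure_iff_nhds_not_empty inf_commute interior_open order_refl)
    moreover obtain T' where T': "T' \<in> \<T>" "interior \<tau> \<subseteq> T'" using sub[OF \<tau>(1)] by blast
    ultimately have "T' = T" using disj T(1) by (auto simp: pairwise_def disjnt_def)
    then show "x \<in> \<Union>R" using \<tau> T' by (auto simp: R_def)
  qed
  moreover have "closed (\<Union>R)" using finR poly by (intro closed_Union) (auto simp: R_def)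
  ultimately have clT: "closure T \<subseteq> \<Union>R" by (rule closure_minimal)
  define P where "P = {\<sigma>. \<exists>\<tau>\<in>R. \<sigma> facet_of \<tau>}"
  have finP: "finite P"
  proof -
    have "finite {\<sigma>. \<sigma> facet_of \<tau>}" if "\<tau> \<in> R" for \<tau>
      using poly(1)[of \<tau>] that by (intro finite_polytope_facets) (simp add: R_def)
    then have "finite (\<Union>\<tau>\<in>R. {\<sigma>. \<sigma> facet_of \<tau>})" using finR by blast
    moreover have "P = (\<Union>\<tau>\<in>R. {\<sigma>. \<sigma> facet_of \<tau>})" by (auto simp: P_def)
    ultimately show ?thesis by simp
  qed
  have clP: "closed \<sigma>" if "\<sigma> \<in> P" for \<sigma>
  proof -
    obtain \<tau> where "\<tau> \<in> \<S>" "\<sigma> facet_of \<tau>" using \<open>\<sigma> \<in> P\<close> by (auto simp: P_def R_def)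
    then show ?thesis using poly face_of_imp_closed facet_of_imp_face_of by blast
  qed
  have FP: "F \<subseteq> \<Union>P"
  proof
    fix x assume x: "x \<in> F"
    then have "x \<in> closure T" "x \<notin> T" using F(2) T(2) by (auto simp: frontier_def interior_open)
    then obtain \<tau> where \<tau>: "\<tau> \<in> R" "x \<in> \<tau>" using clT by blast
    then have \<tau>S: "\<tau> \<in> \<S>" by (simp add: R_def)
    have "x \<notin> interior \<tau>" using \<tau>(1) \<open>x \<notin> T\<close> by (auto simp: R_def)
    moreover have "affine hull \<tau> = UNIV" using aff_dim_simplex[OF S(2)[OF \<tau>S]] aff_dim_eq_full by blast
    ultimately have "x \<in> rel_frontier \<tau>"
      using \<tau>(2) by (simp add: rel_frontier_def closure_closed poly(2)[OF \<tau>S] rel_interior_interior)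
    moreover have "rel_frontier \<tau> = \<Union>{\<sigma>. \<sigma> facet_of \<tau>}"
      by (rule rel_frontier_of_polyhedron[OF polytope_imp_polyhedron[OF poly(1)[OF \<tau>S]]])
    ultimately show "x \<in> \<Union>P" using \<tau>(1) by (auto simp: P_def)
  qed
  have "\<exists>\<sigma>\<in>P. \<not> ?H \<subseteq> closure (?H - (\<sigma> \<inter> closure F))"
  proof (rule ccontr)
    assume "\<not> ?thesis"
    then have dense: "\<And>\<sigma>. \<sigma> \<in> P \<Longrightarrow> ?H \<subseteq> closure (?H - (\<sigma> \<inter> closure F))" by blast
    have "?H \<subseteq> closure (\<Inter>((\<lambda>\<sigma>. ?H - (\<sigma> \<inter> closure F)) ` P))"
    proof (rule Baire)
      fix Y assume "Y \<in> (\<lambda>\<sigma>. ?H - (\<sigma> \<inter> closure F)) ` P"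
      then obtain \<sigma> where \<sigma>: "\<sigma> \<in> P" "Y = ?H - (\<sigma> \<inter> closure F)" by blast
      have "Y = ?H \<inter> - (\<sigma> \<inter> closure F)" using \<sigma>(2) by blast
      moreover have "open (- (\<sigma> \<inter> closure F))" by (intro open_Compl closed_Int clP[OF \<sigma>(1)] closed_closure)
      ultimately show "openin (top_of_set ?H) Y \<and> ?H \<subseteq> closure Y"
        using dense[OF \<sigma>(1)] \<sigma>(2) by (auto simp: openin_open)
    qed (use finP closed_hyperplane in \<open>auto intro: countable_finite\<close>)
    moreover have "F \<subseteq> ?H" using F(3) openin_imp_subset by blast
    moreover obtain x where x: "x \<in> F" using F(1) by blast
    ultimately have xc: "x \<in> closure (\<Inter>((\<lambda>\<sigma>. ?H - (\<sigma> \<inter> closure F)) ` P))" by blast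
    obtain O' where O': "open O'" "F = ?H \<inter> O'" using F(3) unfolding openin_open by blast
    have "P \<noteq> {}" using FP x by blast
    have "O' \<inter> \<Inter>((\<lambda>\<sigma>. ?H - (\<sigma> \<inter> closure F)) ` P) \<noteq> {}"
      using xc O' x open_Int_closure_eq_empty[OF O'(1)] by blast
    then obtain y where y: "y \<in> O'" "\<And>\<sigma>. \<sigma> \<in> P \<Longrightarrow> y \<in> ?H - (\<sigma> \<inter> closure F)" by blast
    then have "y \<in> F" using O'(2) \<open>P \<noteq> {}\<close> by blast
    then show False using y(2) FP closure_subset by blast
  qed
  then obtain \<sigma> x where \<sigma>: "\<sigma> \<in> P" "x \<in> ?H" "x \<notin> closure (?H - (\<sigma> \<inter> closure F))" by blast
  then obtain e where e: "0 < e" "ball x e \<inter> (?H - (\<sigma> \<inter> closure F)) = {}"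
    unfolding closure_approachable by (auto simp: disjoint_iff dist_commute)
  then have sub: "?H \<inter> ball x e \<subseteq> \<sigma> \<inter> closure F" by blast
  then have "x \<in> closure F" using \<sigma>(2) e(1) by auto
  then obtain y where y: "y \<in> F" "y \<in> ball x e"
    using e(1) by (metis closure_approachable dist_commute mem_ball)
  have yH: "y \<in> ?H" using y(1) F(3) openin_imp_subset by blast
  obtain \<tau> where \<tau>: "\<tau> \<in> R" "\<sigma> facet_of \<tau>" using \<sigma>(1) by (auto simp: P_def)
  then have \<tau>S: "\<tau> \<in> \<S>" by (simp add: R_def)
  have dim: "aff_dim \<sigma> = int DIM('a) - 1"
    using \<tau>(2) aff_dim_simplex[OF S(2)[OF \<tau>S]] by (simp add: facet_of_def)
  have hull: "affine hull \<sigma> = ?H"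
  proof -
    have "openin (top_of_set ?H) (?H \<inter> ball x e)" by (auto simp: openin_open)
    then have "affine hull (?H \<inter> ball x e) = affine hull ?H"
      using y yH by (intro affine_hull_affine_Int_open) (auto simp: affine_hyperplane)
    also have "affine hull ?H = ?H" by (simp add: affine_hyperplane affine_hull_eq)
    finally have "?H \<subseteq> affine hull \<sigma>" using sub hull_mono[of "?H \<inter> ball x e" \<sigma> affine] by auto
    moreover have "aff_dim ?H = int DIM('a) - 1"
      using F(4) by (simp add: aff_dim_hyperplane)
    ultimately have "?H = affine hull \<sigma>"
      using dim yH by (intro affine_dim_equal) (auto simp: affine_hyperplane)
    then show ?thesis by simp
  qed
  have "y \<in> rel_interior \<sigma>"
    unfolding mem_rel_interior_ball hull
  proof (intro conjI exI)
    show "y \<in> \<sigma>" using sub yH y(2) by blast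
    show "0 < e - dist x y" using y(2) by simp
    show "ball y (e - dist x y) \<inter> ?H \<subseteq> \<sigma>"
    proof
      fix z assume z: "z \<in> ball y (e - dist x y) \<inter> ?H"
      then have "z \<in> ball x e" using dist_triangle[of x z y] by auto
      then show "z \<in> \<sigma>" using sub z by blast
    qed
  qed
  then show ?thesis using \<tau> y hull unfolding R_def by blast
qed

text \<open>What mesh regularity provides at a single element is the disc in each face; see
  \<open>regular_element_of_mesh\<close>.\<close>

locale regular_element = star_polytope +
  fixes \<rho> h :: real
  assumes \<rho>: "0 < \<rho>" "\<rho> < 1" and h_pos: "0 < h" and h_def: "h = diameter T"
    and apex_distance: "\<And>F. F \<in> \<F> \<Longrightarrow> \<rho> * h \<le> infdist a (affine hull F)"
    and disc: "\<And>F. F \<in> \<F> \<Longrightarrow> \<exists>c\<in>affine hull F. affine hull F \<inter> ball c (\<rho>\<^sup>2 * h / 2) \<subseteq> F"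
begin

text \<open>Relative to h, the radius of a ball that fits into every pyramid.\<close>

definition \<kappa> :: real where "\<kappa> = \<rho> ^ 3 / 32"

lemma \<kappa>_pos: "0 < \<kappa>"
  using \<rho> by (simp add: \<kappa>_def)

lemma \<kappa>_bounds: "8 * \<kappa> \<le> \<rho>\<^sup>2 * \<rho> / 4" "4 * \<kappa> \<le> \<rho>" "\<kappa> \<le> \<rho>\<^sup>2 / 2" "\<kappa> < 1"
proof -
  have "\<rho>\<^sup>2 \<le> 1" using \<rho> by (simp add: power_le_one)
  then have 1: "\<rho>\<^sup>2 * \<rho> \<le> 1 * \<rho>" using \<rho> by (intro mult_right_mono) auto
  have 2: "\<rho>\<^sup>2 * \<rho> \<le> \<rho>\<^sup>2 * 1" using \<rho> by (intro mult_left_mono) auto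
  show "8 * \<kappa> \<le> \<rho>\<^sup>2 * \<rho> / 4" by (simp add: \<kappa>_def power3_eq_cube power2_eq_square)
  have "\<kappa> = \<rho>\<^sup>2 * \<rho> / 32" by (simp add: \<kappa>_def power3_eq_cube power2_eq_square)
  then show "4 * \<kappa> \<le> \<rho>" "\<kappa> \<le> \<rho>\<^sup>2 / 2" "\<kappa> < 1" using 1 2 \<rho> \<open>\<rho>\<^sup>2 \<le> 1\<close> zero_le_power2[of \<rho>] by linarith+
qed

lemma \<delta>_ge: "F \<in> \<F> \<Longrightarrow> \<rho> * h \<le> \<delta> F"
  by (simp add: \<delta>_def apex_distance)

lemma dist_closure_le: "x \<in> closure T \<Longrightarrow> y \<in> closure T \<Longrightarrow> dist x y \<le> h"
  using diameter_bounded_bound[OF bounded_closure[OF bounded_T]] bounded_T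
  by (simp add: h_def diameter_closure)

definition disc_center :: "'a set \<Rightarrow> 'a" where
  "disc_center F = (SOME c. c \<in> affine hull F \<and> affine hull F \<inter> ball c (\<rho>\<^sup>2 * h / 2) \<subseteq> F)"

lemma disc_center:
  assumes "F \<in> \<F>"
  shows "disc_center F \<in> F" "affine hull F \<inter> ball (disc_center F) (\<rho>\<^sup>2 * h / 2) \<subseteq> F"
proof -
  have "\<exists>c. c \<in> affine hull F \<and> affine hull F \<inter> ball c (\<rho>\<^sup>2 * h / 2) \<subseteq> F" using disc[OF assms] by blast
  from someI_ex[OF this]
  have *: "disc_center F \<in> affine hull F \<and> affine hull F \<inter> ball (disc_center F) (\<rho>\<^sup>2 * h / 2) \<subseteq> F"
    unfolding disc_center_def .
  then show "affine hull F \<inter> ball (disc_center F) (\<rho>\<^sup>2 * h / 2) \<subseteq> F" by blast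
  moreover have "0 < \<rho>\<^sup>2 * h / 2" using \<rho> h_pos by simp
  ultimately show "disc_center F \<in> F" using * by auto
qed

definition pyr_center :: "'a set \<Rightarrow> 'a" where
  "pyr_center F = a + (1/2) *\<^sub>R (disc_center F - a)"

lemma face_in_closure_T: "F \<in> \<F> \<Longrightarrow> y \<in> closure F \<Longrightarrow> y \<in> closure T"
  using face_subset_frontier frontier_in_closure by blast

lemma a_in_closure_T: "a \<in> closure T"
  using a_in_T closure_subset by blast

text \<open>The centre is half-way between the apex and the centre of the disc.  Projection from the apex to the
  base keeps the ball within the disc.\<close>

lemma pyramid_ball:
  assumes F: "F \<in> \<F>" and x: "x \<in> ball (pyr_center F) (\<kappa> * h)"
  shows "x \<in> pyr F" "1/4 \<le> height F x" "height F x \<le> 3/4"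
proof -
  let ?c = "disc_center F"
  have c: "?c \<in> F" by (rule disc_center[OF F])
  have d: "0 < \<delta> F" by (rule \<delta>_pos[OF F])
  define w where "w = x - pyr_center F"
  have w: "norm w < \<kappa> * h" using x by (simp add: w_def dist_norm norm_minus_commute)
  define t where "t = height F x"
  have "x - a = w + (1/2) *\<^sub>R (?c - a)" by (simp add: w_def pyr_center_def)
  then have t_eq: "t = \<nu> F \<bullet> w / \<delta> F + 1/2"
    using face_level[OF F c] d by (simp add: t_def height_def inner_add_right add_divide_distrib)
  have "\<bar>\<nu> F \<bullet> w\<bar> \<le> norm w" using Cauchy_Schwarz_ineq2[of "\<nu> F" w] norm_\<nu>[OF F] by simp
  then have "\<bar>t - 1/2\<bar> \<le> norm w / \<delta> F" using d by (simp add: t_eq divide_right_mono)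
  also have "\<dots> \<le> (\<kappa> * h) / (\<rho> * h)"
    using w \<delta>_ge[OF F] \<rho> h_pos d \<kappa>_pos by (intro frac_le) auto
  also have "\<dots> = \<kappa> / \<rho>" using h_pos by simp
  finally have tk: "\<bar>t - 1/2\<bar> \<le> \<kappa> / \<rho>" .
  have k4: "\<kappa> / \<rho> \<le> 1/4" using \<kappa>_bounds(2) \<rho> by (simp add: divide_le_eq)
  then have t: "1/4 \<le> t" "t \<le> 3/4" using tk by linarith+
  then show "1/4 \<le> height F x" "height F x \<le> 3/4" by (auto simp: t_def)
  define y where "y = a + (1 / t) *\<^sub>R (x - a)"
  have xy: "x = a + t *\<^sub>R (y - a)" using t by (simp add: y_def)
  have "\<nu> F \<bullet> (x - a) = t * \<delta> F" using d by (simp add: t_def height_def)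
  then have "\<nu> F \<bullet> (y - a) = \<delta> F" using t by (simp add: y_def)
  then have y_hull: "y \<in> affine hull F"
    unfolding affine_hull_face[OF F] by (simp add: inner_diff_right)
  have "t *\<^sub>R (y - ?c) = (x - a) - t *\<^sub>R (?c - a)" using t by (simp add: y_def algebra_simps)
  also have "\<dots> = w - (t - 1/2) *\<^sub>R (?c - a)"
    by (simp add: w_def pyr_center_def algebra_simps)
  finally have "norm (t *\<^sub>R (y - ?c)) \<le> norm w + \<bar>t - 1/2\<bar> * norm (?c - a)"
    using norm_triangle_ineq4[of w "(t - 1/2) *\<^sub>R (?c - a)"] by simp
  also have "norm (?c - a) \<le> h"
    using dist_closure_le[OF face_in_closure_T[OF F] a_in_closure_T] c closure_subset[of F]
    by (auto simp: dist_norm)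
  then have "norm w + \<bar>t - 1/2\<bar> * norm (?c - a) \<le> \<kappa> * h + \<kappa> / \<rho> * h"
    using w tk \<kappa>_pos \<rho> h_pos by (intro add_mono mult_mono) auto
  also have "\<kappa> * h \<le> \<kappa> / \<rho> * h"
  proof (rule mult_right_mono)
    have "\<kappa> * \<rho> \<le> \<kappa> * 1" using \<rho> \<kappa>_pos by (intro mult_left_mono) auto
    then show "\<kappa> \<le> \<kappa> / \<rho>" using \<rho> by (simp add: le_divide_eq)
  qed (use h_pos in simp)
  finally have le: "norm (t *\<^sub>R (y - ?c)) \<le> \<kappa> / \<rho> * h + \<kappa> / \<rho> * h" by simp
  have "norm (t *\<^sub>R (y - ?c)) = t * norm (y - ?c)" using t by simp
  with le have "t * norm (y - ?c) \<le> 2 * (\<kappa> / \<rho> * h)" by linarith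
  moreover have "1/4 * norm (y - ?c) \<le> t * norm (y - ?c)" using t by (intro mult_right_mono) auto
  ultimately have "norm (y - ?c) \<le> 8 * (\<kappa> / \<rho> * h)" by linarith
  then have "norm (y - ?c) \<le> 8 * \<kappa> / \<rho> * h" by simp
  also have "8 * \<kappa> / \<rho> \<le> \<rho>\<^sup>2 / 4" using \<kappa>_bounds(1) \<rho> by (simp add: divide_le_eq)
  then have "8 * \<kappa> / \<rho> * h \<le> \<rho>\<^sup>2 / 4 * h" using h_pos by (intro mult_right_mono) auto
  also have "\<dots> < \<rho>\<^sup>2 * h / 2" using \<rho> h_pos by simp
  finally have "y \<in> ball ?c (\<rho>\<^sup>2 * h / 2)" by (simp add: dist_norm norm_minus_commute)
  then have "y \<in> F" using disc_center(2)[OF F] y_hull by blast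
  then show "x \<in> pyr F"
    unfolding pyramid_cone[OF F] using xy t by (intro CollectI exI[of _ t] exI[of _ y]) auto
qed

end

lemma open_polytopeD:
  assumes "open_polytope X"
  shows "open X" "bounded X" "X \<noteq> {}"
proof -
  obtain K where K: "finite K" "\<forall>S\<in>K. int DIM('a) simplex S" "X = interior (\<Union>K)" and "X \<noteq> {}"
    using assms unfolding open_polytope_def by blast
  then show "open X" "X \<noteq> {}" by auto
  have "bounded (\<Union>K)" using K compact_simplex compact_imp_bounded by (intro bounded_Union) auto
  then show "bounded X" using K(3) interior_subset bounded_subset by blast
qed

text \<open>One factor \<open>\<rho>\<close> relates the element to a simplex of the submesh, the other one that simplex to its
  inradius.\<close>

lemma regular_element_of_mesh:
  fixes \<Omega> T :: "'a::euclidean_space set"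
  assumes \<rho>: "0 < \<rho>" "\<rho> < 1"
    and mesh: "polytopal_mesh \<Omega> \<T>\<^sub>h \<F>\<^sub>h \<F>" and reg: "regular_mesh \<rho> \<Omega> \<T>\<^sub>h \<F>\<^sub>h" and T: "T \<in> \<T>\<^sub>h"
    and simplicial: "\<forall>F\<in>\<F> T. \<exists>S. (int DIM('a) - 1) simplex S \<and> F = rel_interior S"
    and star: "star_shaped T x\<^sub>T"
    and apex: "\<forall>F\<in>\<F> T. \<rho> * diameter T \<le> infdist x\<^sub>T (affine hull F)"
  shows "regular_element T (\<F> T) x\<^sub>T \<rho> (diameter T)"
proof -
  have poly: "open_polytope T" and disj: "pairwise disjnt \<T>\<^sub>h" and cover: "closure \<Omega> = (\<Union>T\<in>\<T>\<^sub>h. closure T)"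
    and fin: "finite \<F>\<^sub>h" and disjF: "pairwise disjnt \<F>\<^sub>h" and sub: "\<F> T \<subseteq> \<F>\<^sub>h"
    and fr: "frontier T = (\<Union>F\<in>\<F> T. closure F)"
    using mesh T unfolding polytopal_mesh_def by auto
  note T_props = open_polytopeD[OF poly]
  have diam: "0 < diameter T"
  proof -
    obtain x e where "0 < e" "ball x e \<subseteq> T" using T_props(1,3) open_contains_ball by (metis ex_in_conv)
    moreover obtain b :: 'a where b: "b \<in> Basis"
      by (rule exE[OF ex_in_conv[THEN iffD2, OF nonempty_Basis]])
    ultimately have "x \<in> T" "x + (e / 2) *\<^sub>R b \<in> T" by (auto simp: dist_norm subset_iff)
    then have "dist x (x + (e / 2) *\<^sub>R b) \<le> diameter T"
      using diameter_bounded_bound[OF T_props(2)] by blast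
    then show ?thesis using \<open>0 < e\<close> b by (simp add: dist_norm)
  qed
  have star_polytope: "star_polytope T (\<F> T) x\<^sub>T"
  proof
    show "0 < infdist x\<^sub>T (affine hull F)" if "F \<in> \<F> T" for F
    proof -
      have "0 < \<rho> * diameter T" using \<rho> diam by simp
      then show ?thesis using apex that by (meson less_le_trans)
    qed
    show "pairwise disjnt (\<F> T)" using disjF sub pairwise_subset by blast
    show "finite (\<F> T)" using fin sub by (rule finite_subset[rotated])
  qed (use T_props star fr simplicial in auto)
  interpret star_polytope T "\<F> T" x\<^sub>T by (rule star_polytope)
  obtain \<S> where \<S>: "triangulation \<S>" "\<forall>\<tau>\<in>\<S>. int DIM('a) simplex \<tau>" "\<Union>\<S> = closure \<Omega>"
    "\<forall>\<tau>\<in>\<S>. \<exists>T\<in>\<T>\<^sub>h. interior \<tau> \<subseteq> T"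
    "\<forall>\<tau>\<in>\<S>. \<forall>\<sigma>. \<sigma> facet_of \<tau> \<longrightarrow> (\<forall>F\<in>\<F>\<^sub>h. rel_interior \<sigma> \<subseteq> F \<or> rel_interior \<sigma> \<inter> F = {})"
    "\<forall>\<tau>\<in>\<S>. \<rho> * diameter \<tau> \<le> inradius \<tau>"
    "\<forall>\<tau>\<in>\<S>. \<forall>T\<in>\<T>\<^sub>h. interior \<tau> \<subseteq> T \<longrightarrow> \<rho> * diameter T \<le> diameter \<tau>"
    using reg unfolding regular_mesh_def by (elim exE conjE) (rule that; assumption)
  have "\<exists>c\<in>affine hull F. affine hull F \<inter> ball c (\<rho>\<^sup>2 * diameter T / 2) \<subseteq> F" if F: "F \<in> \<F> T" for F
  proof -
    have "\<exists>\<tau>\<in>\<S>. interior \<tau> \<subseteq> T \<and> (\<exists>\<sigma>. \<sigma> facet_of \<tau> \<and> rel_interior \<sigma> \<inter> F \<noteq> {} \<and>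
        affine hull \<sigma> = {x. \<nu> F \<bullet> x = level F})"
    proof (rule face_contains_facet[where \<Omega>=\<Omega> and \<T>="\<T>\<^sub>h"])
      show "finite \<S>" using \<S>(1) by (simp add: triangulation_def)
      show "T \<subseteq> closure \<Omega>" using cover T closure_subset by blast
      show "F \<subseteq> frontier T" using face_subset_frontier[OF F] closure_subset by blast
      show "\<nu> F \<noteq> 0" using norm_\<nu>[OF F] by auto
    qed (use \<S> T T_props disj face_simplex(4)[OF F] face_openin[OF F] in auto)
    then obtain \<tau> \<sigma> where \<tau>: "\<tau> \<in> \<S>" "interior \<tau> \<subseteq> T" "\<sigma> facet_of \<tau>" "rel_interior \<sigma> \<inter> F \<noteq> {}"
      "affine hull \<sigma> = {x. \<nu> F \<bullet> x = level F}" by blast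
    have hull: "affine hull \<sigma> = affine hull F" using \<tau>(5) affine_hull_face[OF F] by simp
    have "\<rho> * (\<rho> * diameter T) \<le> \<rho> * diameter \<tau>"
      using \<S>(7) \<tau>(1,2) T \<rho> by (intro mult_left_mono) auto
    also have "\<dots> \<le> inradius \<tau>" using \<S>(6) \<tau>(1) by blast
    finally have inr: "\<rho>\<^sup>2 * diameter T \<le> inradius \<tau>" by (simp add: power2_eq_square mult.assoc)
    have pos: "0 < \<rho>\<^sup>2 * diameter T" using \<rho> diam by simp
    then obtain c where "ball c (inradius \<tau> / 2) \<subseteq> \<tau>" using inradius_ball[of \<tau>] inr by auto
    then have b: "ball c (\<rho>\<^sup>2 * diameter T / 2) \<subseteq> \<tau>" using inr by (meson divide_right_mono subset_ball subset_trans zero_le_numeral)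
    have "\<exists>c'\<in>affine hull \<sigma>. affine hull \<sigma> \<inter> ball c' (\<rho>\<^sup>2 * diameter T / 2) \<subseteq> \<sigma>"
      using \<S>(2) \<tau>(1,3) pos b by (intro facet_contains_disc[where \<tau>=\<tau> and c=c]) auto
    then obtain c' where c': "c' \<in> affine hull \<sigma>" "affine hull \<sigma> \<inter> ball c' (\<rho>\<^sup>2 * diameter T / 2) \<subseteq> \<sigma>" by blast
    have "affine hull \<sigma> \<inter> ball c' (\<rho>\<^sup>2 * diameter T / 2) \<subseteq> rel_interior \<sigma>"
      by (rule rel_interior_maximal[OF c'(2)]) (auto simp: openin_open)
    moreover have "rel_interior \<sigma> \<subseteq> F" using \<S>(5) \<tau>(1,3,4) F sub by blast
    ultimately show ?thesis using c'(1) hull by auto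
  qed
  then show ?thesis
    by unfold_locales (use \<rho> diam apex in auto)
qed

section \<open>Local operators\<close>

lemma L2_commute: "L2_inner M X f g = L2_inner M X g f"
  by (simp add: L2_inner_def inner_commute)

context
  fixes M :: "'a::euclidean_space measure" and X :: "'a set"
  assumes MX: "finite_region M X"
begin

interpretation L2: semi_inner_space "continuous_functions :: ('a \<Rightarrow> 'b::euclidean_space) set" "L2_inner M X"
  by (rule L2_semi_inner[OF MX])

lemma L2_add_left:
  fixes u v w :: "'a \<Rightarrow> 'b::euclidean_space"
  assumes "continuous_on UNIV u" "continuous_on UNIV v" "continuous_on UNIV w"
  shows "L2_inner M X (\<lambda>x. u x + v x) w = L2_inner M X u w + L2_inner M X v w"
  using assms L2.B_add by simp

lemma L2_diff_left:
  fixes u v w :: "'a \<Rightarrow> 'b::euclidean_space"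
  assumes "continuous_on UNIV u" "continuous_on UNIV v" "continuous_on UNIV w"
  shows "L2_inner M X (\<lambda>x. u x - v x) w = L2_inner M X u w - L2_inner M X v w"
  using assms L2.B_diff by simp

lemma L2_scale_left:
  fixes u w :: "'a \<Rightarrow> 'b::euclidean_space"
  assumes "continuous_on UNIV u" "continuous_on UNIV w"
  shows "L2_inner M X (\<lambda>x. c *\<^sub>R u x) w = c * L2_inner M X u w"
  using assms L2.B_scale by simp

lemma L2_add_right:
  fixes u v w :: "'a \<Rightarrow> 'b::euclidean_space"
  assumes "continuous_on UNIV u" "continuous_on UNIV v" "continuous_on UNIV w"
  shows "L2_inner M X w (\<lambda>x. u x + v x) = L2_inner M X w u + L2_inner M X w v"
  using L2_add_left[OF assms] by (simp add: L2_commute)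

lemma L2_scale_right:
  fixes u w :: "'a \<Rightarrow> 'b::euclidean_space"
  assumes "continuous_on UNIV u" "continuous_on UNIV w"
  shows "L2_inner M X w (\<lambda>x. c *\<^sub>R u x) = c * L2_inner M X w u"
  using L2_scale_left[OF assms] by (simp add: L2_commute)

lemma L2_nonneg:
  fixes u :: "'a \<Rightarrow> 'b::euclidean_space"
  assumes "continuous_on UNIV u"
  shows "0 \<le> L2_inner M X u u"
  using assms L2.B_nonneg by simp

lemma L2_null:
  fixes u w :: "'a \<Rightarrow> 'b::euclidean_space"
  assumes "continuous_on UNIV u" "continuous_on UNIV w" "L2_inner M X u u = 0"
  shows "L2_inner M X w u = 0"
  using assms L2.null_right by simp

text \<open>The weighted Young inequality, with which products are absorbed in all estimates below.\<close>

lemma L2_young: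
  fixes u w :: "'a \<Rightarrow> 'b::euclidean_space"
  assumes u: "continuous_on UNIV u" and w: "continuous_on UNIV w" and t: "0 < t"
  shows "2 * \<bar>L2_inner M X u w\<bar> \<le> t * L2_inner M X u u + L2_inner M X w w / t"
proof -
  have "0 \<le> L2_inner M X w w + 2 * s * L2_inner M X w u + s\<^sup>2 * L2_inner M X u u" for s
  proof -
    have "0 \<le> L2_inner M X (\<lambda>x. w x + s *\<^sub>R u x) (\<lambda>x. w x + s *\<^sub>R u x)"
      by (rule L2_nonneg) (intro continuous_intros u w)
    then show ?thesis using L2.B_quadratic[of w u s] u w by simp
  qed
  from this[of t] this[of "-t"] have
    "2 * t * L2_inner M X u w \<le> t * (t * L2_inner M X u u) + L2_inner M X w w"
    "- (2 * t * L2_inner M X u w) \<le> t * (t * L2_inner M X u u) + L2_inner M X w w"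
    using L2_commute[of M X u w] by (simp_all add: power2_eq_square mult.assoc)
  then have "2 * t * \<bar>L2_inner M X u w\<bar> \<le> t * (t * L2_inner M X u u) + L2_inner M X w w"
    by (cases "0 \<le> L2_inner M X u w") simp_all
  then show ?thesis using t by (simp add: field_simps)
qed

lemma L2_proj_exists:
  assumes f: "continuous_on UNIV f"
  shows L2_proj_in: "L2_proj M X m f \<in> poly_space m"
    and L2_proj_eq: "w \<in> poly_space m \<Longrightarrow> L2_inner M X (L2_proj M X m f) w = L2_inner M X f w"
proof -
  interpret P: semi_inner_space "poly_space m" "L2_inner M X" by (rule poly_space_semi_inner[OF MX])
  have "\<exists>u\<in>poly_space m. \<forall>w\<in>poly_space m. L2_inner M X u w = L2_inner M X f w"
  proof (rule P.riesz[OF finite_dim_poly_space])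
    fix u v :: "'a \<Rightarrow> real" and c :: real assume u: "u \<in> poly_space m"
    show "L2_inner M X f (\<lambda>x. c *\<^sub>R u x) = c * L2_inner M X f u"
      by (rule L2_scale_right[OF poly_space_continuous[OF u] f])
    show "L2_inner M X f u = 0" if "L2_inner M X u u = 0"
      by (rule L2_null[OF poly_space_continuous[OF u] f that])
    assume v: "v \<in> poly_space m"
    show "L2_inner M X f (\<lambda>x. u x + v x) = L2_inner M X f u + L2_inner M X f v"
      by (rule L2_add_right[OF poly_space_continuous[OF u] poly_space_continuous[OF v] f])
  qed
  then have "\<exists>q. q \<in> poly_space m \<and> (\<forall>w\<in>poly_space m. L2_inner M X q w = L2_inner M X f w)" by blast
  from someI_ex[OF this]
  have "L2_proj M X m f \<in> poly_space m \<and>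
      (\<forall>w\<in>poly_space m. L2_inner M X (L2_proj M X m f) w = L2_inner M X f w)"
    unfolding L2_proj_def .
  then show "L2_proj M X m f \<in> poly_space m"
    "w \<in> poly_space m \<Longrightarrow> L2_inner M X (L2_proj M X m f) w = L2_inner M X f w" by auto
qed

end

lemma grad_inner: "b \<in> Basis \<Longrightarrow> grad q x \<bullet> b = pderiv_dir b q x"
  by (simp add: grad_def)

lemma grad_poly:
  assumes "q \<in> poly_space m"
  shows "grad q \<in> poly_fields (m - 1)"
  using poly_space_deriv[OF assms] by (simp add: poly_fields_def grad_inner)

lemma grad_add:
  assumes "p \<in> poly_space m" "q \<in> poly_space m'"
  shows "grad (\<lambda>x. p x + q x) = (\<lambda>x. grad p x + grad q x)"
  by (rule ext) (simp add: grad_def pderiv_dir_add[OF assms] scaleR_add_left sum.distrib)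

lemma grad_cmult:
  assumes "q \<in> poly_space m"
  shows "grad (\<lambda>x. c * q x) = (\<lambda>x. c *\<^sub>R grad q x)"
  by (rule ext) (simp add: grad_def pderiv_dir_cmult[OF assms] scaleR_sum_right)

lemma grad_const: "grad (\<lambda>x. c) = (\<lambda>x. 0)"
proof
  fix x :: 'a
  have "pderiv_dir b (\<lambda>x. c) x = 0" for b :: 'a by (rule pderiv_dir_eq) simp
  then show "grad (\<lambda>x. c) x = 0" by (simp add: grad_def)
qed

lemma grad_zero_const:
  assumes q: "q \<in> poly_space m" and g: "grad q = (\<lambda>x. 0)"
  shows "q x = q 0"
proof -
  have "frechet_derivative q (at y) = (\<lambda>e. 0)" for y
  proof
    fix e
    have lin: "linear (frechet_derivative q (at y))"
      using poly_space_differentiable[OF q] has_derivative_linear by blast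
    have "frechet_derivative q (at y) e = frechet_derivative q (at y) (\<Sum>b\<in>Basis. (e \<bullet> b) *\<^sub>R b)"
      by (simp add: euclidean_representation)
    also have "\<dots> = (\<Sum>b\<in>Basis. (e \<bullet> b) *\<^sub>R frechet_derivative q (at y) b)"
      using lin by (simp add: linear_sum linear_cmul)
    also have "\<dots> = 0"
    proof (rule sum.neutral, rule ballI)
      fix b :: 'a assume "b \<in> Basis"
      then have "frechet_derivative q (at y) b = grad q y \<bullet> b" by (simp add: grad_inner)
      then show "(e \<bullet> b) *\<^sub>R frechet_derivative q (at y) b = 0" using g by simp
    qed
    finally show "frechet_derivative q (at y) e = 0" .
  qed
  then have "(q has_derivative (\<lambda>e. 0)) (at y within UNIV)" for y
    using poly_space_differentiable[OF q, of y] by simp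
  then show ?thesis using has_derivative_zero_constant[of UNIV q] by (metis UNIV_I convex_UNIV)
qed

lemma poly_fields_has_derivative:
  assumes "\<phi> \<in> poly_fields m"
  shows "(\<phi> has_derivative (\<lambda>e. \<Sum>b\<in>Basis. pderiv_dir e (\<lambda>x. \<phi> x \<bullet> b) x *\<^sub>R b)) (at x)"
proof -
  have "((\<lambda>x. \<Sum>b\<in>Basis. (\<phi> x \<bullet> b) *\<^sub>R b) has_derivative
      (\<lambda>e. \<Sum>b\<in>Basis. pderiv_dir e (\<lambda>x. \<phi> x \<bullet> b) x *\<^sub>R b)) (at x)"
  proof (intro has_derivative_sum has_derivative_scaleR_left)
    fix b :: 'a assume "b \<in> Basis"
    then have "(\<lambda>x. \<phi> x \<bullet> b) \<in> poly_space m" using assms by (simp add: poly_fields_def)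
    then show "((\<lambda>x. \<phi> x \<bullet> b) has_derivative frechet_derivative (\<lambda>x. \<phi> x \<bullet> b) (at x)) (at x)"
      by (rule poly_space_differentiable)
  qed
  then show ?thesis by (simp add: euclidean_representation)
qed

lemma divergence_eq:
  assumes "\<phi> \<in> poly_fields m"
  shows "divergence \<phi> x = (\<Sum>b\<in>Basis. pderiv_dir b (\<lambda>x. \<phi> x \<bullet> b) x)"
proof -
  have "frechet_derivative \<phi> (at x) b = (\<Sum>b'\<in>Basis. pderiv_dir b (\<lambda>x. \<phi> x \<bullet> b') x *\<^sub>R b')" for b
    unfolding frechet_derivative_at[OF poly_fields_has_derivative[OF assms], symmetric] ..
  then show ?thesis by (simp add: divergence_def)
qed

lemma divergence_poly_space:
  assumes "\<phi> \<in> poly_fields m"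
  shows "divergence \<phi> \<in> poly_space (m - 1)"
proof -
  have "divergence \<phi> = (\<lambda>x. \<Sum>b\<in>Basis. pderiv_dir b (\<lambda>x. \<phi> x \<bullet> b) x)"
    by (rule ext) (rule divergence_eq[OF assms])
  moreover have "(\<lambda>x. \<Sum>b\<in>Basis. pderiv_dir b (\<lambda>x. \<phi> x \<bullet> b) x) \<in> poly_space (m - 1)"
    using assms by (intro poly_space_sum poly_space_deriv) (simp add: poly_fields_def)
  ultimately show ?thesis by simp
qed

lemma divergence_add:
  assumes "\<phi> \<in> poly_fields m" "\<psi> \<in> poly_fields m"
  shows "divergence (\<lambda>x. \<phi> x + \<psi> x) = (\<lambda>x. divergence \<phi> x + divergence \<psi> x)"
proof
  fix x
  have "pderiv_dir b (\<lambda>x. \<phi> x \<bullet> b + \<psi> x \<bullet> b) x =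
      pderiv_dir b (\<lambda>x. \<phi> x \<bullet> b) x + pderiv_dir b (\<lambda>x. \<psi> x \<bullet> b) x" if "b \<in> Basis" for b
    using assms that by (intro pderiv_dir_add[of _ m _ m]) (auto simp: poly_fields_def)
  then show "divergence (\<lambda>x. \<phi> x + \<psi> x) x = divergence \<phi> x + divergence \<psi> x"
    by (simp add: divergence_eq[OF poly_fields_add[OF assms]] divergence_eq[OF assms(1)]
        divergence_eq[OF assms(2)] inner_add_left sum.distrib)
qed

lemma divergence_scale:
  assumes "\<phi> \<in> poly_fields m"
  shows "divergence (\<lambda>x. c *\<^sub>R \<phi> x) = (\<lambda>x. c * divergence \<phi> x)"
proof
  fix x
  have "pderiv_dir b (\<lambda>x. c * (\<phi> x \<bullet> b)) x = c * pderiv_dir b (\<lambda>x. \<phi> x \<bullet> b) x" if "b \<in> Basis" for b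
    using assms that by (intro pderiv_dir_cmult[of _ m]) (auto simp: poly_fields_def)
  then show "divergence (\<lambda>x. c *\<^sub>R \<phi> x) x = c * divergence \<phi> x"
    by (simp add: divergence_eq[OF poly_fields_scale[OF assms]] divergence_eq[OF assms] sum_distrib_left)
qed

context star_polytope
begin

text \<open>The divergence theorem applied to \<open>p * (\<phi> \<bullet> b)\<close> in each coordinate direction b.\<close>

lemma green:
  assumes p: "p \<in> poly_space i" and \<phi>: "\<phi> \<in> poly_fields j"
  shows "inner_on T (grad p) \<phi> = - inner_on T p (divergence \<phi>) +
    (\<Sum>F\<in>\<F>. inner_face F p (\<lambda>x. \<phi> x \<bullet> \<nu> F))"
proof -
  have c: "(\<lambda>x. \<phi> x \<bullet> b) \<in> poly_space j" if "b \<in> Basis" for b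
    using \<phi> that by (simp add: poly_fields_def)
  have pc: "(\<lambda>x. p x * (\<phi> x \<bullet> b)) \<in> poly_space (i + j)" if "b \<in> Basis" for b
    by (rule poly_space_mult[OF p c[OF that]])
  note cont = poly_space_continuous
  have "inner_on T (grad p) \<phi> + inner_on T p (divergence \<phi>) =
      (LINT x:T|lborel. grad p x \<bullet> \<phi> x + p x * divergence \<phi> x)"
    unfolding L2_inner_def inner_real_def
    by (intro set_integral_add(2)[symmetric] set_integrable_continuous[OF region_T] continuous_on_inner
        continuous_on_mult poly_fields_continuous[OF grad_poly[OF p]] poly_fields_continuous[OF \<phi>]
        cont[OF p] cont[OF divergence_poly_space[OF \<phi>]])
  also have "\<dots> = (LINT x:T|lborel. \<Sum>b\<in>Basis. pderiv_dir b (\<lambda>x. p x * (\<phi> x \<bullet> b)) x)"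
  proof -
    have "grad p x \<bullet> \<phi> x + p x * divergence \<phi> x =
        (\<Sum>b\<in>Basis. pderiv_dir b (\<lambda>x. p x * (\<phi> x \<bullet> b)) x)" for x
    proof -
      have "grad p x \<bullet> \<phi> x = (\<Sum>b\<in>Basis. pderiv_dir b p x * (\<phi> x \<bullet> b))"
        by (subst euclidean_inner) (simp add: grad_inner)
      moreover have "pderiv_dir b (\<lambda>x. p x * (\<phi> x \<bullet> b)) x =
          p x * pderiv_dir b (\<lambda>x. \<phi> x \<bullet> b) x + pderiv_dir b p x * (\<phi> x \<bullet> b)" if "b \<in> Basis" for b
        by (rule pderiv_dir_mult[OF p c[OF that]])
      ultimately show ?thesis
        by (simp add: divergence_eq[OF \<phi>] sum_distrib_left sum.distrib)
    qed
    then show ?thesis by simp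
  qed
  also have "\<dots> = (\<Sum>b\<in>Basis. LINT x:T|lborel. pderiv_dir b (\<lambda>x. p x * (\<phi> x \<bullet> b)) x)"
    unfolding set_lebesgue_integral_def scaleR_sum_right
    by (rule Bochner_Integration.integral_sum)
       (rule set_integrable_continuous[OF region_T cont[OF poly_space_deriv[OF pc]], unfolded set_integrable_def])
  also have "\<dots> = (\<Sum>b\<in>Basis. \<Sum>F\<in>\<F>. (\<nu> F \<bullet> b) * (LINT x:F|face_measure F. p x * (\<phi> x \<bullet> b)))"
    by (intro sum.cong refl divergence_poly[OF pc])
  also have "\<dots> = (\<Sum>F\<in>\<F>. \<Sum>b\<in>Basis. (\<nu> F \<bullet> b) * (LINT x:F|face_measure F. p x * (\<phi> x \<bullet> b)))"
    by (rule sum.swap)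
  also have "\<dots> = (\<Sum>F\<in>\<F>. inner_face F p (\<lambda>x. \<phi> x \<bullet> \<nu> F))"
  proof (rule sum.cong[OF refl])
    fix F assume F: "F \<in> \<F>"
    have "inner_face F p (\<lambda>x. \<phi> x \<bullet> \<nu> F) =
        (LINT x:F|face_measure F. \<Sum>b\<in>Basis. (\<nu> F \<bullet> b) * (p x * (\<phi> x \<bullet> b)))"
      unfolding L2_inner_def inner_real_def
      by (subst euclidean_inner) (simp add: sum_distrib_left mult_ac)
    also have "\<dots> = (\<Sum>b\<in>Basis. LINT x:F|face_measure F. (\<nu> F \<bullet> b) * (p x * (\<phi> x \<bullet> b)))"
      unfolding set_lebesgue_integral_def scaleR_sum_right
      by (rule Bochner_Integration.integral_sum)
         (rule set_integrable_continuous[OF region_face[OF F] cont[OF poly_space_cmult[OF pc]],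
           unfolded set_integrable_def])
    finally show "(\<Sum>b\<in>Basis. (\<nu> F \<bullet> b) * (LINT x:F|face_measure F. p x * (\<phi> x \<bullet> b))) =
        inner_face F p (\<lambda>x. \<phi> x \<bullet> \<nu> F)" by simp
  qed
  finally show ?thesis by simp
qed

end

text \<open>One vector of unknowns v on one element.\<close>

locale hho_element = star_polytope T \<F> a
  for T :: "'a::euclidean_space set" and \<F> :: "'a set set" and a :: 'a +
  fixes k :: nat and l :: int and \<omega> :: "'a set \<Rightarrow> real" and v :: "'a dofs"
  assumes l: "l \<in> {int k - 1, int k, int k + 1}" and v: "v \<in> local_space k l \<F>"
begin

abbreviation "vT \<equiv> elem_val l \<omega> \<F> v"
abbreviation "r \<equiv> pot_rec k l \<omega> T \<F> v"
abbreviation "G \<equiv> grad_rec k l \<omega> T \<F> v"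
abbreviation "\<delta>T \<equiv> delta_elem k l \<omega> T \<F> v"
abbreviation "\<delta>F F \<equiv> delta_face k l \<omega> T \<F> F v"

lemma T_open_nonempty: "open T" "T \<noteq> {}" "bounded T"
  using open_T a_in_T bounded_T by auto

lemma vF_poly: "F \<in> \<F> \<Longrightarrow> snd v F \<in> poly_space (int k)"
  using v by (simp add: local_space_def)

lemma vT_poly: "vT \<in> poly_space (int k + 1)"
proof (cases "l = -1")
  case True
  have "(\<lambda>x. \<Sum>F\<in>\<F>. \<omega> F * snd v F x) \<in> poly_space (int k)"
    by (intro poly_space_sum poly_space_cmult vF_poly)
  then show ?thesis using True poly_space_mono[of "int k" "int k + 1"] by (auto simp: elem_val_def)
next
  case False
  then have "vT \<in> poly_space l" using v by (simp add: elem_val_def local_space_def)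
  then show ?thesis using l poly_space_mono[of l "int k + 1"] by auto
qed

lemma outward: "F \<in> \<F> \<Longrightarrow> outward_normal T F = \<nu> F"
  by (rule outward_normal_eq)

text \<open>The right-hand side shared by the two reconstructions.\<close>

definition flux :: "('a \<Rightarrow> 'a) \<Rightarrow> real" where
  "flux \<phi> = - inner_on T vT (divergence \<phi>) +
    (\<Sum>F\<in>\<F>. inner_face F (snd v F) (\<lambda>x. \<phi> x \<bullet> outward_normal T F))"

lemma flux_add:
  assumes \<phi>: "\<phi> \<in> poly_fields m" and \<psi>: "\<psi> \<in> poly_fields m"
  shows "flux (\<lambda>x. \<phi> x + \<psi> x) = flux \<phi> + flux \<psi>"
proof -
  note c = poly_space_continuous
  have "inner_on T vT (divergence (\<lambda>x. \<phi> x + \<psi> x)) = inner_on T vT (divergence \<phi>) + inner_on T vT (divergence \<psi>)"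
    unfolding divergence_add[OF assms]
    by (rule L2_add_right[OF region_T c[OF divergence_poly_space[OF \<phi>]]
          c[OF divergence_poly_space[OF \<psi>]] c[OF vT_poly]])
  moreover have "inner_face F (snd v F) (\<lambda>x. (\<phi> x + \<psi> x) \<bullet> n) =
      inner_face F (snd v F) (\<lambda>x. \<phi> x \<bullet> n) + inner_face F (snd v F) (\<lambda>x. \<psi> x \<bullet> n)" if "F \<in> \<F>" for F n
    unfolding inner_add_left
    by (rule L2_add_right[OF region_face[OF that] c[OF poly_fields_inner[OF \<phi>]]
          c[OF poly_fields_inner[OF \<psi>]] c[OF vF_poly[OF that]]])
  ultimately show ?thesis by (simp add: flux_def sum.distrib)
qed

lemma flux_scale:
  assumes \<phi>: "\<phi> \<in> poly_fields m"
  shows "flux (\<lambda>x. c *\<^sub>R \<phi> x) = c * flux \<phi>"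
proof -
  note c = poly_space_continuous
  have "inner_on T vT (divergence (\<lambda>x. c *\<^sub>R \<phi> x)) = c * inner_on T vT (divergence \<phi>)"
    using L2_scale_right[OF region_T c[OF divergence_poly_space[OF \<phi>]] c[OF vT_poly], of c]
    by (simp add: divergence_scale[OF \<phi>])
  moreover have "inner_face F (snd v F) (\<lambda>x. (c *\<^sub>R \<phi> x) \<bullet> n) =
      c * inner_face F (snd v F) (\<lambda>x. \<phi> x \<bullet> n)" if "F \<in> \<F>" for F n
    using L2_scale_right[OF region_face[OF that] c[OF poly_fields_inner[OF \<phi>]] c[OF vF_poly[OF that]], of c n]
    by simp
  ultimately show ?thesis by (simp add: flux_def sum_distrib_left algebra_simps)
qed

lemma grad_rec:
  shows G_poly: "G \<in> poly_fields (int k)"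
    and G_eq: "\<phi> \<in> poly_fields (int k) \<Longrightarrow> inner_on T G \<phi> = flux \<phi>"
proof -
  interpret P: semi_inner_space "poly_fields (int k)" "inner_on T" by (rule poly_fields_semi_inner[OF region_T])
  have "\<exists>!u. u \<in> poly_fields (int k) \<and> (\<forall>w\<in>poly_fields (int k). inner_on T u w = flux w)"
  proof (rule P.riesz_unique[OF finite_dim_poly_fields])
    fix u assume "u \<in> poly_fields (int k)" "inner_on T u u = 0"
    then show "u = (\<lambda>x. 0)" using poly_fields_L2_definite T_open_nonempty by blast
  qed (rule flux_add flux_scale; assumption)+
  from theI'[OF this] have "G \<in> poly_fields (int k) \<and> (\<forall>w\<in>poly_fields (int k). inner_on T G w = flux w)"
    unfolding grad_rec_def flux_def .
  then show "G \<in> poly_fields (int k)" "\<phi> \<in> poly_fields (int k) \<Longrightarrow> inner_on T G \<phi> = flux \<phi>" by auto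
qed

text \<open>The gradient form is degenerate exactly on constants, on which the flux vanishes; the mean
  value fixes the constant.\<close>

lemma pot_rec_poly: "r \<in> poly_space (int k + 1)"
proof -
  let ?V = "poly_space (int k + 1) :: ('a \<Rightarrow> real) set"
  let ?B = "\<lambda>p q. inner_on T (grad p) (grad q)"
  note gc = poly_fields_continuous[OF grad_poly]
  interpret semi_inner_space ?V ?B
  proof
    fix u w z :: "'a \<Rightarrow> real" and c :: real assume u: "u \<in> ?V"
    show "(\<lambda>x. c *\<^sub>R u x) \<in> ?V" using poly_space_cmult[OF u] by simp
    show "0 \<le> ?B u u" by (rule L2_nonneg[OF region_T gc[OF u]])
    show "?B u w = ?B w u" by (rule L2_commute)
    {
      assume w: "w \<in> ?V"
      show "(\<lambda>x. u x + w x) \<in> ?V" by (rule poly_space_add[OF u w])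
      show "?B (\<lambda>x. c *\<^sub>R u x) w = c * ?B u w"
        using L2_scale_left[OF region_T gc[OF u] gc[OF w], of c] grad_cmult[OF u, of c] by simp
      assume z: "z \<in> ?V"
      show "?B (\<lambda>x. u x + w x) z = ?B u z + ?B w z"
        unfolding grad_add[OF u w] by (rule L2_add_left[OF region_T gc[OF u] gc[OF w] gc[OF z]])
    }
  qed (rule poly_space_zero)
  have null: "u x = u 0" if u: "u \<in> ?V" "?B u u = 0" for u x
  proof -
    have "grad u = (\<lambda>x. 0)"
      by (rule poly_fields_L2_definite[OF grad_poly[OF u(1)] T_open_nonempty u(2)])
    then show ?thesis by (rule grad_zero_const[OF u(1)])
  qed
  have "\<exists>u\<in>?V. \<forall>w\<in>?V. ?B u w = flux (grad w)"
  proof (rule riesz[OF finite_dim_poly_space])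
    fix u w and c :: real assume u: "u \<in> ?V"
    show "flux (grad (\<lambda>x. c *\<^sub>R u x)) = c * flux (grad u)"
      using flux_scale[OF grad_poly[OF u]] grad_cmult[OF u] by simp
    show "flux (grad u) = 0" if B0: "?B u u = 0"
    proof -
      have "grad u = (\<lambda>x. 0 *\<^sub>R 0)"
        using poly_fields_L2_definite[OF grad_poly[OF u(1)] T_open_nonempty B0] by simp
      then show ?thesis using flux_scale[OF poly_fields_zero, of 0] by simp
    qed
    assume w: "w \<in> ?V"
    show "flux (grad (\<lambda>x. u x + w x)) = flux (grad u) + flux (grad w)"
      unfolding grad_add[OF u w] by (rule flux_add[OF grad_poly[OF u] grad_poly[OF w]])
  qed
  then obtain u where u: "u \<in> ?V" "\<And>w. w \<in> ?V \<Longrightarrow> ?B u w = flux (grad w)" by blast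
  let ?one = "\<lambda>x::'a. 1::real"
  have one: "?one \<in> ?V" by (rule poly_space_const) simp
  note cont = poly_space_continuous
  have m: "inner_on T ?one ?one \<noteq> 0"
    using poly_space_L2_definite[OF one T_open_nonempty] by (auto simp: fun_eq_iff)
  define c where "c = - inner_on T (\<lambda>x. u x - vT x) ?one / inner_on T ?one ?one"
  have cst: "(\<lambda>x. c) \<in> ?V" by (rule poly_space_const) simp
  have ex: "\<exists>!r. r \<in> ?V \<and> (\<forall>w\<in>?V. inner_on T (grad r) (grad w) =
      - inner_on T vT (laplacian w) +
      (\<Sum>F\<in>\<F>. inner_face F (snd v F) (\<lambda>x. grad w x \<bullet> outward_normal T F))) \<and>
      inner_on T (\<lambda>x. r x - vT x) ?one = 0"
  proof (rule ex1I[of _ "\<lambda>x. u x + c"], intro conjI ballI)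
    show "(\<lambda>x. u x + c) \<in> ?V" by (rule poly_space_add[OF u(1) cst])
    fix w assume w: "w \<in> ?V"
    have "grad (\<lambda>x. u x + c) = grad u" unfolding grad_add[OF u(1) cst] grad_const by simp
    then show "inner_on T (grad (\<lambda>x. u x + c)) (grad w) = - inner_on T vT (laplacian w) +
      (\<Sum>F\<in>\<F>. inner_face F (snd v F) (\<lambda>x. grad w x \<bullet> outward_normal T F))"
      using u(2)[OF w] by (simp add: flux_def laplacian_def)
  next
    have "inner_on T (\<lambda>x. u x + c - vT x) ?one =
        inner_on T (\<lambda>x. (u x - vT x) + c *\<^sub>R ?one x) ?one" by (simp add: algebra_simps)
    also have "\<dots> = inner_on T (\<lambda>x. u x - vT x) ?one + c * inner_on T ?one ?one"
      using L2_add_left[OF region_T cont[OF poly_space_diff[OF u(1) vT_poly]] _ cont[OF one], of "\<lambda>x. c *\<^sub>R ?one x"]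
        L2_scale_left[OF region_T cont[OF one] cont[OF one], of c] by simp
    also have "\<dots> = 0" using m by (simp add: c_def)
    finally show "inner_on T (\<lambda>x. u x + c - vT x) ?one = 0" .
  next
    fix s
    assume s: "s \<in> ?V \<and> (\<forall>w\<in>?V. inner_on T (grad s) (grad w) = - inner_on T vT (laplacian w) +
      (\<Sum>F\<in>\<F>. inner_face F (snd v F) (\<lambda>x. grad w x \<bullet> outward_normal T F))) \<and>
      inner_on T (\<lambda>x. s x - vT x) ?one = 0"
    define e where "e = (\<lambda>x. s x - u x)"
    have e: "e \<in> ?V" unfolding e_def using s u(1) by (intro V_diff) auto
    have "?B e w = 0" if "w \<in> ?V" for w
      using s u that B_diff[of s u w] by (simp add: e_def flux_def laplacian_def)
    from this[OF e] have const: "e x = e 0" for x using null[OF e] by blast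
    have "e 0 = c"
    proof -
      have "0 = inner_on T (\<lambda>x. s x - vT x) ?one" using s by simp
      also have "(\<lambda>x. s x - vT x) = (\<lambda>x. (u x - vT x) + e 0 *\<^sub>R ?one x)"
        using const by (auto simp: e_def fun_eq_iff algebra_simps)
      also have "inner_on T \<dots> ?one = inner_on T (\<lambda>x. u x - vT x) ?one + e 0 * inner_on T ?one ?one"
        using L2_add_left[OF region_T cont[OF poly_space_diff[OF u(1) vT_poly]] _ cont[OF one], of "\<lambda>x. e 0 *\<^sub>R ?one x"]
          L2_scale_left[OF region_T cont[OF one] cont[OF one], of "e 0"] by simp
      finally show ?thesis using m by (simp add: c_def field_simps)
    qed
    then show "s = (\<lambda>x. u x + c)" using const by (auto simp: e_def fun_eq_iff algebra_simps)
  qed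
  from theI'[OF ex] show ?thesis unfolding pot_rec_def by blast
qed

lemma rv_cont: "continuous_on UNIV (\<lambda>x. r x - vT x)" "F \<in> \<F> \<Longrightarrow> continuous_on UNIV (\<lambda>x. r x - snd v F x)"
  using poly_space_continuous[OF pot_rec_poly] poly_space_continuous[OF vT_poly]
    poly_space_continuous[OF vF_poly] by (auto intro!: continuous_on_diff)

lemma \<delta>T_poly: "\<delta>T \<in> poly_space l"
  unfolding delta_elem_def by (rule L2_proj_in[OF region_T rv_cont(1)])

lemma \<delta>T_eq: "w \<in> poly_space l \<Longrightarrow> inner_on T \<delta>T w = inner_on T (\<lambda>x. r x - vT x) w"
  unfolding delta_elem_def by (rule L2_proj_eq[OF region_T rv_cont(1)])

lemma \<delta>F_poly: "F \<in> \<F> \<Longrightarrow> \<delta>F F \<in> poly_space (int k)"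
  unfolding delta_face_def by (rule L2_proj_in[OF region_face rv_cont(2)])

lemma \<delta>F_eq: "F \<in> \<F> \<Longrightarrow> w \<in> poly_space (int k) \<Longrightarrow>
    inner_face F (\<delta>F F) w = inner_face F (\<lambda>x. r x - snd v F x) w"
  unfolding delta_face_def by (rule L2_proj_eq[OF region_face rv_cont(2)])

text \<open>The field tested on the pyramids and the datum on the faces in the equation that defines the lifting.\<close>

definition z :: "'a \<Rightarrow> 'a" where "z = (\<lambda>x. grad r x - G x - grad \<delta>T x)"
definition g :: "'a set \<Rightarrow> 'a \<Rightarrow> real" where "g F = (\<lambda>x. \<delta>F F x - \<delta>T x)"

lemma \<delta>T_poly': "\<delta>T \<in> poly_space (int k + 1)"
  using \<delta>T_poly l poly_space_mono[of l "int k + 1"] by auto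

lemma z_poly: "z \<in> poly_fields (int k)"
  unfolding z_def using grad_poly[OF pot_rec_poly] grad_poly[OF \<delta>T_poly'] G_poly
  by (intro poly_fields_diff) auto

lemma g_poly: "F \<in> \<F> \<Longrightarrow> g F \<in> poly_space (int k + 1)"
  unfolding g_def using \<delta>F_poly[of F] poly_space_mono[of "int k" "int k + 1"] \<delta>T_poly'
  by (intro poly_space_diff) auto

text \<open>Green's formula turns the gradient of r and of the element difference into boundary terms;
  the projectors disappear because divergences of test fields lie in the element space and their
  normal components in the face spaces.\<close>

lemma consistency_identity:
  assumes \<phi>: "\<phi> \<in> poly_fields (int k)"
  shows "inner_on T z \<phi> = (\<Sum>F\<in>\<F>. inner_face F (g F) (\<lambda>x. \<phi> x \<bullet> \<nu> F))"
proof -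
  note c = poly_space_continuous and fc = poly_fields_continuous
  note gr = fc[OF grad_poly[OF pot_rec_poly]] and gd = fc[OF grad_poly[OF \<delta>T_poly']] and Gc = fc[OF G_poly]
    and \<phi>c = fc[OF \<phi>]
  have div: "divergence \<phi> \<in> poly_space l"
    using divergence_poly_space[OF \<phi>] l poly_space_mono[of "int k - 1" l] by auto
  have "inner_on T z \<phi> = inner_on T (grad r) \<phi> - inner_on T G \<phi> - inner_on T (grad \<delta>T) \<phi>"
    unfolding z_def
    by (subst L2_diff_left[OF region_T continuous_on_diff[OF gr Gc] gd \<phi>c])
       (simp add: L2_diff_left[OF region_T gr Gc \<phi>c])
  also have "\<dots> = (- inner_on T r (divergence \<phi>) + inner_on T vT (divergence \<phi>) + inner_on T \<delta>T (divergence \<phi>)) +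
      (\<Sum>F\<in>\<F>. inner_face F r (\<lambda>x. \<phi> x \<bullet> \<nu> F) - inner_face F (snd v F) (\<lambda>x. \<phi> x \<bullet> \<nu> F) -
        inner_face F \<delta>T (\<lambda>x. \<phi> x \<bullet> \<nu> F))"
    unfolding green[OF pot_rec_poly \<phi>] green[OF \<delta>T_poly' \<phi>] G_eq[OF \<phi>] flux_def
    by (simp add: sum_subtractf outward)
  also have "- inner_on T r (divergence \<phi>) + inner_on T vT (divergence \<phi>) + inner_on T \<delta>T (divergence \<phi>) = 0"
    using \<delta>T_eq[OF div] L2_diff_left[OF region_T c[OF pot_rec_poly] c[OF vT_poly] c[OF div]] by simp
  also have "(\<Sum>F\<in>\<F>. inner_face F r (\<lambda>x. \<phi> x \<bullet> \<nu> F) - inner_face F (snd v F) (\<lambda>x. \<phi> x \<bullet> \<nu> F) -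
        inner_face F \<delta>T (\<lambda>x. \<phi> x \<bullet> \<nu> F)) = (\<Sum>F\<in>\<F>. inner_face F (g F) (\<lambda>x. \<phi> x \<bullet> \<nu> F))"
  proof (rule sum.cong[OF refl])
    fix F assume F: "F \<in> \<F>"
    have n: "(\<lambda>x. \<phi> x \<bullet> \<nu> F) \<in> poly_space (int k)" by (rule poly_fields_inner[OF \<phi>])
    show "inner_face F r (\<lambda>x. \<phi> x \<bullet> \<nu> F) - inner_face F (snd v F) (\<lambda>x. \<phi> x \<bullet> \<nu> F) -
        inner_face F \<delta>T (\<lambda>x. \<phi> x \<bullet> \<nu> F) = inner_face F (g F) (\<lambda>x. \<phi> x \<bullet> \<nu> F)"
      unfolding g_def L2_diff_left[OF region_face[OF F] c[OF \<delta>F_poly[OF F]] c[OF \<delta>T_poly] c[OF n]]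
        \<delta>F_eq[OF F n] L2_diff_left[OF region_face[OF F] c[OF pot_rec_poly] c[OF vF_poly[OF F]] c[OF n]]
      by simp
  qed
  finally show ?thesis by simp
qed

text \<open>The lifting on the pyramid, before its extension by zero.\<close>

definition lift :: "'a set \<Rightarrow> 'a \<Rightarrow> 'a" where
  "lift F = (THE L. L \<in> RT_space (int k + 1) \<and>
    (\<forall>\<eta>\<in>RT_space (int k + 1). inner_on (pyr F) L \<eta> =
      - inner_on (pyr F) z \<eta> + inner_face F (g F) (\<lambda>y. \<eta> y \<bullet> outward_normal T F)))"

lemma lift:
  assumes F: "F \<in> \<F>"
  shows lift_RT: "lift F \<in> RT_space (int k + 1)"
    and lift_eq: "\<eta> \<in> RT_space (int k + 1) \<Longrightarrow> inner_on (pyr F) (lift F) \<eta> =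
      - inner_on (pyr F) z \<eta> + inner_face F (g F) (\<lambda>y. \<eta> y \<bullet> \<nu> F)"
proof -
  let ?V = "RT_space (int k + 1) :: ('a \<Rightarrow> 'a) set"
  interpret P: semi_inner_space ?V "inner_on (pyr F)" by (rule RT_space_semi_inner[OF region_pyramid[OF F]])
  have pf: "u \<in> poly_fields (int k + 1 + 1)" if "u \<in> ?V" for u using that RT_space_subset_poly_fields by blast
  note uc = poly_fields_continuous[OF pf] and un = poly_space_continuous[OF poly_fields_inner[OF pf]]
  note zc = poly_fields_continuous[OF z_poly] and gc = poly_space_continuous[OF g_poly[OF F]]
  let ?l = "\<lambda>\<eta>. - inner_on (pyr F) z \<eta> + inner_face F (g F) (\<lambda>y. \<eta> y \<bullet> outward_normal T F)"
  have "\<exists>!u. u \<in> ?V \<and> (\<forall>w\<in>?V. inner_on (pyr F) u w = ?l w)"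
  proof (rule P.riesz_unique[OF finite_dim_RT_space])
    fix u w and c :: real assume u: "u \<in> ?V"
    show "u = (\<lambda>x. 0)" if "inner_on (pyr F) u u = 0"
      using poly_fields_L2_definite[OF pf[OF u] open_pyramid pyramid_nonempty[OF F] bounded_pyramid[OF F] that] .
    show "?l (\<lambda>x. c *\<^sub>R u x) = c * ?l u"
      using L2_scale_right[OF region_pyramid[OF F] uc[OF u] zc, of c]
        L2_scale_right[OF region_face[OF F] un[OF u] gc, of c "outward_normal T F"]
      by (simp add: algebra_simps)
    assume w: "w \<in> ?V"
    show "?l (\<lambda>x. u x + w x) = ?l u + ?l w"
      using L2_add_right[OF region_pyramid[OF F] uc[OF u] uc[OF w] zc]
        L2_add_right[OF region_face[OF F] un[OF u] un[OF w] gc, of "outward_normal T F" "outward_normal T F"]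
      by (simp add: inner_add_left)
  qed
  from theI'[OF this] have "lift F \<in> ?V \<and> (\<forall>w\<in>?V. inner_on (pyr F) (lift F) w = ?l w)"
    unfolding lift_def .
  then show "lift F \<in> ?V" "\<eta> \<in> ?V \<Longrightarrow> inner_on (pyr F) (lift F) \<eta> =
      - inner_on (pyr F) z \<eta> + inner_face F (g F) (\<lambda>y. \<eta> y \<bullet> \<nu> F)"
    by (auto simp: outward[OF F])
qed

lemma lift_poly: "F \<in> \<F> \<Longrightarrow> lift F \<in> poly_fields (int k + 2)"
  using lift_RT RT_space_subset_poly_fields[of "int k + 1"] by (auto simp: add.commute)

abbreviation "S \<equiv> stab k l \<omega> T \<F> a v"

lemma stab_eq: "S x = (\<Sum>F\<in>\<F>. indicator (pyr F) x *\<^sub>R lift F x)"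
  by (simp add: stab_def lifting_def lift_def z_def g_def)

lemma stab_pyramid: "F \<in> \<F> \<Longrightarrow> x \<in> pyr F \<Longrightarrow> S x = lift F x"
  unfolding stab_eq by (rule sum_indicator_pyramids)

lemma stab_outside: "(\<And>F. F \<in> \<F> \<Longrightarrow> x \<notin> pyr F) \<Longrightarrow> S x = 0"
  unfolding stab_eq by (intro sum.neutral) (auto simp: indicator_def)

text \<open>Products with the stabilising contribution are given by a different continuous function on each
  pyramid and vanish off the pyramids.\<close>

lemma integral_stab:
  assumes q: "\<And>F. F \<in> \<F> \<Longrightarrow> continuous_on UNIV (q F)"
    and eq: "\<And>F x. F \<in> \<F> \<Longrightarrow> x \<in> pyr F \<Longrightarrow> f x = q F x"
    and z: "\<And>x. (\<And>F. F \<in> \<F> \<Longrightarrow> x \<notin> pyr F) \<Longrightarrow> f x = (0::real)"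
  shows "(LINT x:T|lborel. f x) = (\<Sum>F\<in>\<F>. LINT x:pyr F|lborel. q F x)"
proof -
  have "indicator T x *\<^sub>R f x = (\<Sum>F\<in>\<F>. indicator (pyr F) x *\<^sub>R q F x)" for x
  proof (cases "\<exists>F\<in>\<F>. x \<in> pyr F")
    case True
    then obtain F where F: "F \<in> \<F>" "x \<in> pyr F" by blast
    then have "x \<in> T" using pyramid_subset by blast
    then show ?thesis using sum_indicator_pyramids[OF F(2,1), of "\<lambda>F. q F x"] eq[OF F] by simp
  next
    case False
    then have "f x = 0" by (intro z) blast
    moreover have "(\<Sum>F\<in>\<F>. indicator (pyr F) x *\<^sub>R q F x) = 0"
      using False by (intro sum.neutral) (auto simp: indicator_def)
    ultimately show ?thesis by simp
  qed
  then have "(LINT x:T|lborel. f x) = (\<integral>x. (\<Sum>F\<in>\<F>. indicator (pyr F) x *\<^sub>R q F x) \<partial>lborel)"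
    unfolding set_lebesgue_integral_def by simp
  also have "\<dots> = (\<Sum>F\<in>\<F>. LINT x:pyr F|lborel. q F x)"
    unfolding set_lebesgue_integral_def
    using set_integrable_continuous[OF region_pyramid q]
    by (intro Bochner_Integration.integral_sum) (auto simp: set_integrable_def)
  finally show ?thesis .
qed

lemma inner_stab:
  assumes "continuous_on UNIV \<phi>"
  shows "inner_on T S \<phi> = (\<Sum>F\<in>\<F>. inner_on (pyr F) (lift F) \<phi>)"
  unfolding L2_inner_def
  by (rule integral_stab)
     (auto simp: stab_pyramid stab_outside intro!: continuous_on_inner assms poly_fields_continuous[OF lift_poly])

lemma norm_stab: "inner_on T S S = (\<Sum>F\<in>\<F>. inner_on (pyr F) (lift F) (lift F))"
  unfolding L2_inner_def
  by (rule integral_stab)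
     (auto simp: stab_pyramid stab_outside intro!: continuous_on_inner poly_fields_continuous[OF lift_poly])

lemma inner_T_pyramids:
  fixes u w :: "'a \<Rightarrow> 'a"
  assumes "continuous_on UNIV u" "continuous_on UNIV w"
  shows "inner_on T u w = (\<Sum>F\<in>\<F>. inner_on (pyr F) u w)"
  unfolding L2_inner_def by (intro integral_T_pyramids continuous_on_inner assms)

lemma stab_orthogonal:
  assumes \<phi>: "\<phi> \<in> poly_fields (int k)"
  shows "inner_on T S \<phi> = 0"
proof -
  have RT: "\<phi> \<in> RT_space (int k + 1)"
    using \<phi> poly_fields_mono[of "int k" "int k + 1"] poly_fields_subset_RT_space by (meson less_add_one less_imp_le subsetD)
  have "inner_on T S \<phi> = (\<Sum>F\<in>\<F>. - inner_on (pyr F) z \<phi> + inner_face F (g F) (\<lambda>y. \<phi> y \<bullet> \<nu> F))"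
    unfolding inner_stab[OF poly_fields_continuous[OF \<phi>]] by (intro sum.cong refl lift_eq[OF _ RT])
  also have "\<dots> = - inner_on T z \<phi> + (\<Sum>F\<in>\<F>. inner_face F (g F) (\<lambda>y. \<phi> y \<bullet> \<nu> F))"
    by (simp add: sum_subtractf
        inner_T_pyramids[OF poly_fields_continuous[OF z_poly] poly_fields_continuous[OF \<phi>]])
  also have "\<dots> = 0" using consistency_identity[OF \<phi>] by simp
  finally show ?thesis .
qed

end

section \<open>Stability\<close>

lemma integral_le_const:
  fixes f :: "'a::euclidean_space \<Rightarrow> real"
  assumes M: "finite_region M X" and f: "continuous_on UNIV f" and K: "\<And>x. x \<in> X \<Longrightarrow> f x \<le> K"
  shows "(LINT x:X|M. f x) \<le> K * measure M X"
proof -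
  have X: "X \<in> sets M" "emeasure M X < \<infinity>" using M by (auto simp: finite_region_def)
  have "(LINT x:X|M. f x) \<le> (\<integral>x. indicator X x *\<^sub>R K \<partial>M)"
    unfolding set_lebesgue_integral_def
    using set_integrable_continuous[OF M f] X K unfolding set_integrable_def
    by (intro integral_mono integrable_scaleR_left integrable_real_indicator) (auto simp: indicator_def)
  also have "\<dots> = K * measure M X"
    using X sets.sets_into_space[OF X(1)] by (simp add: Int_absorb2)
  finally show ?thesis .
qed

lemma nn_integral_region:
  fixes f :: "'a::euclidean_space \<Rightarrow> real"
  assumes M: "finite_region M X" and f: "continuous_on UNIV f" and f0: "\<And>x. 0 \<le> f x"
  shows "ennreal (LINT x:X|M. f x) = (\<integral>\<^sup>+x. ennreal (f x) * indicator X x \<partial>M)"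
proof -
  have "(\<integral>\<^sup>+x. ennreal (indicator X x *\<^sub>R f x) \<partial>M) = ennreal (LINT x:X|M. f x)"
    unfolding set_lebesgue_integral_def
    using set_integrable_continuous[OF M f] f0 unfolding set_integrable_def
    by (intro nn_integral_eq_integral) auto
  moreover have "ennreal (indicator X x *\<^sub>R f x) = ennreal (f x) * indicator X x" for x
    by (simp add: indicator_def)
  ultimately show ?thesis by simp
qed

text \<open>C is the constant of the sup bounds for polynomials, between balls of radii \<open>\<kappa> * h\<close> and \<open>2 * h\<close>; a
  ball of the latter radius around any point of the element contains the element.\<close>

locale hho_regular = regular_element T \<F> a \<rho> h + hho_element T \<F> a k l \<omega> v
  for T :: "'a::euclidean_space set" and \<F> a \<rho> h k l \<omega> v +
  fixes C :: real
  assumes C_pos: "0 < C"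
    and sup_field: "\<And>\<phi> c r x. \<phi> \<in> (poly_fields (int k + 2) :: ('a \<Rightarrow> 'a) set) \<Longrightarrow> 0 < r \<Longrightarrow>
      dist c x \<le> 2 / (\<rho> ^ 3 / 32) * r \<Longrightarrow> (\<phi> x \<bullet> \<phi> x) * r ^ DIM('a) \<le> C * inner_on (ball c r) \<phi> \<phi>"
    and sup_scalar: "\<And>q c r x. q \<in> (poly_space (int k + 1) :: ('a \<Rightarrow> real) set) \<Longrightarrow> 0 < r \<Longrightarrow>
      dist c x \<le> 2 / (\<rho> ^ 3 / 32) * r \<Longrightarrow> (q x)\<^sup>2 * r ^ DIM('a) \<le> C * inner_on (ball c r) q q"
begin

text \<open>The first constant is the volume bound of \<open>measure_pyramid_le\<close> times the factor in
  \<open>sup_field_ball\<close>; the others are those in \<open>trace_inequality\<close>, \<open>weighted_norm\<close> and \<open>test_field_norm\<close>.\<close>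

definition volume_const :: real where "volume_const = C * unit_ball_vol (real DIM('a)) / \<kappa> ^ DIM('a)"
definition trace_const :: real where "trace_const = real DIM('a) * volume_const / \<rho>"
definition weight_const :: real where "weight_const = 4 * volume_const"
definition field_const :: real where "field_const = 2 * \<kappa> * volume_const / \<rho>\<^sup>2"

lemma consts_pos: "0 < volume_const" "0 < trace_const" "0 < weight_const" "0 < field_const"
proof -
  show "0 < volume_const" using C_pos \<kappa>_pos by (simp add: volume_const_def)
  then show "0 < trace_const" "0 < weight_const" "0 < field_const" using \<rho> \<kappa>_pos by (auto simp: trace_const_def weight_const_def field_const_def)
qed

lemma \<kappa>h: "0 < \<kappa> * h" "2 / (\<rho> ^ 3 / 32) * (\<kappa> * h) = 2 * h"
  using \<kappa>_pos h_pos \<rho> by (auto simp: \<kappa>_def)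

lemma measure_pyramid_le:
  assumes F: "F \<in> \<F>"
  shows "measure lborel (pyr F) \<le> unit_ball_vol (real DIM('a)) * h ^ DIM('a)"
proof -
  have "pyr F \<subseteq> cball a h"
    using pyramid_subset[OF F] dist_closure_le[OF a_in_closure_T] closure_subset by fastforce
  then have "measure lborel (pyr F) \<le> measure lborel (cball a h)"
    using emeasure_lborel_cball_finite[of a h] open_pyramid
    by (intro measure_mono_fmeasurable) (auto simp: fmeasurable_def)
  then show ?thesis using emeasure_cball[of h a] h_pos by (simp add: measure_def)
qed

lemma volume_const_scaled: "C / (\<kappa> * h) ^ DIM('a) * (unit_ball_vol (real DIM('a)) * h ^ DIM('a)) = volume_const"
  using h_pos by (simp add: volume_const_def power_mult_distrib)

lemma sup_field_ball:
  assumes F: "F \<in> \<F>" and \<phi>: "\<phi> \<in> poly_fields (int k + 2)" and x: "x \<in> closure T"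
  shows "\<phi> x \<bullet> \<phi> x \<le> C / (\<kappa> * h) ^ DIM('a) * inner_on (ball (pyr_center F) (\<kappa> * h)) \<phi> \<phi>"
proof -
  have "pyr_center F \<in> pyr F" using pyramid_ball(1)[OF F] \<kappa>h by simp
  then have "pyr_center F \<in> closure T" using pyramid_subset[OF F] closure_subset by blast
  then have "dist (pyr_center F) x \<le> h" using x by (rule dist_closure_le)
  then have "dist (pyr_center F) x \<le> 2 / (\<rho> ^ 3 / 32) * (\<kappa> * h)" unfolding \<kappa>h(2) using h_pos by simp
  from sup_field[OF \<phi> \<kappa>h(1) this] show ?thesis
    using \<kappa>h(1) by (simp add: le_divide_eq)
qed

lemma ball_le_pyramid:
  assumes F: "F \<in> \<F>" and \<phi>: "\<phi> \<in> poly_fields m"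
  shows "inner_on (ball (pyr_center F) (\<kappa> * h)) \<phi> \<phi> \<le> inner_on (pyr F) \<phi> \<phi>"
  using pyramid_ball(1)[OF F]
  by (intro L2_mono[OF region_pyramid[OF F]] poly_fields_continuous[OF \<phi>]) auto

text \<open>Up to the factor \<open>\<delta> F / DIM('a)\<close> the measure of the face is that of the pyramid, so that the sup
  bound suffices.\<close>

lemma trace_inequality:
  assumes F: "F \<in> \<F>" and \<phi>: "\<phi> \<in> poly_fields (int k + 2)"
  shows "inner_face F (\<lambda>x. \<phi> x \<bullet> \<nu> F) (\<lambda>x. \<phi> x \<bullet> \<nu> F) \<le> trace_const / h * inner_on (pyr F) \<phi> \<phi>"
proof -
  let ?N = "inner_on (pyr F) \<phi> \<phi>" and ?D = "real DIM('a)"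
  have N: "0 \<le> ?N" by (rule L2_nonneg[OF region_pyramid[OF F] poly_fields_continuous[OF \<phi>]])
  have q: "0 \<le> C / (\<kappa> * h) ^ DIM('a)" using C_pos \<kappa>h(1) by simp
  have "inner_face F (\<lambda>x. \<phi> x \<bullet> \<nu> F) (\<lambda>x. \<phi> x \<bullet> \<nu> F) \<le> (C / (\<kappa> * h) ^ DIM('a) * ?N) * measure (face_measure F) F"
    unfolding L2_inner_def
  proof (rule integral_le_const[OF region_face[OF F]])
    show "continuous_on UNIV (\<lambda>x. (\<phi> x \<bullet> \<nu> F) \<bullet> (\<phi> x \<bullet> \<nu> F))"
      by (intro continuous_on_inner poly_fields_continuous[OF \<phi>] continuous_on_const)
    fix x assume x: "x \<in> F"
    have "(\<phi> x \<bullet> \<nu> F) \<bullet> (\<phi> x \<bullet> \<nu> F) \<le> \<phi> x \<bullet> \<phi> x"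
      using Cauchy_Schwarz_ineq[of "\<phi> x" "\<nu> F"] norm_\<nu>[OF F] by (simp add: power2_eq_square norm_eq_1)
    also have "\<dots> \<le> C / (\<kappa> * h) ^ DIM('a) * inner_on (ball (pyr_center F) (\<kappa> * h)) \<phi> \<phi>"
      using x face_in_closure_T[OF F] closure_subset by (intro sup_field_ball[OF F \<phi>]) blast
    also have "\<dots> \<le> C / (\<kappa> * h) ^ DIM('a) * ?N" by (rule mult_left_mono[OF ball_le_pyramid[OF F \<phi>] q])
    finally show "(\<phi> x \<bullet> \<nu> F) \<bullet> (\<phi> x \<bullet> \<nu> F) \<le> C / (\<kappa> * h) ^ DIM('a) * (LINT x:pyr F|lborel. \<phi> x \<bullet> \<phi> x)"
      by (simp add: L2_inner_def)
  qed
  also have "measure (face_measure F) F \<le> ?D / (\<rho> * h) * (unit_ball_vol ?D * h ^ DIM('a))"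
  proof -
    have "measure lborel (pyr F) = \<delta> F / ?D * measure (face_measure F) F"
    proof -
      have "(LINT x:pyr F|lborel. 1) = \<delta> F / (real 0 + ?D) * (LINT y:F|face_measure F. 1)"
        by (rule integral_pyramid_homogeneous[OF F]) auto
      moreover have "(LINT x:X|M. 1) = measure M X" if "X \<in> sets M" for X and M :: "'a measure"
        using sets.sets_into_space[OF that] by (simp add: set_lebesgue_integral_def Int_absorb2)
      moreover have "F \<in> sets (face_measure F)" "pyr F \<in> sets lborel"
        using region_face[OF F] open_pyramid by (auto simp: finite_region_def)
      ultimately show ?thesis by simp
    qed
    then have "measure (face_measure F) F = ?D / \<delta> F * measure lborel (pyr F)"
      using \<delta>_pos[OF F] by (simp add: field_simps)
    also have "\<dots> \<le> ?D / (\<rho> * h) * (unit_ball_vol ?D * h ^ DIM('a))"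
      using \<delta>_ge[OF F] \<rho> h_pos by (intro mult_mono measure_pyramid_le[OF F] divide_left_mono mult_pos_pos) (auto intro: \<delta>_pos[OF F])
    finally show ?thesis .
  qed
  then have "(C / (\<kappa> * h) ^ DIM('a) * ?N) * measure (face_measure F) F \<le>
      (C / (\<kappa> * h) ^ DIM('a) * ?N) * (?D / (\<rho> * h) * (unit_ball_vol ?D * h ^ DIM('a)))"
    using N q by (intro mult_left_mono mult_nonneg_nonneg)
  also have "\<dots> = (C / (\<kappa> * h) ^ DIM('a) * (unit_ball_vol ?D * h ^ DIM('a))) * (?D / (\<rho> * h)) * ?N"
    by (simp add: mult_ac)
  also have "\<dots> = trace_const / h * ?N" unfolding volume_const_scaled trace_const_def by simp
  finally show ?thesis .
qed

lemma height_nonneg_le_1: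
  assumes F: "F \<in> \<F>" and x: "x \<in> pyr F"
  shows "0 \<le> height F x" "height F x \<le> 1"
proof -
  obtain t y where ty: "x = a + t *\<^sub>R (y - a)" "0 < t" "t < 1" "y \<in> F" using x pyramid_cone[OF F] by blast
  then have "height F x = t" using height_ray[OF F, of y t] closure_subset by blast
  then show "0 \<le> height F x" "height F x \<le> 1" using ty by auto
qed

text \<open>The weight \<open>1 - height F\<close>, which vanishes on the base, is at least 1/4 on the ball inside the
  pyramid, and that ball controls the norm on the whole pyramid.\<close>

lemma weighted_norm:
  assumes F: "F \<in> \<F>" and \<phi>: "\<phi> \<in> poly_fields (int k)"
  shows "inner_on (pyr F) \<phi> \<phi> \<le> weight_const * inner_on (pyr F) \<phi> (\<lambda>x. (1 - height F x) *\<^sub>R \<phi> x)"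
proof -
  let ?B = "ball (pyr_center F) (\<kappa> * h)"
  let ?NB = "inner_on ?B \<phi> \<phi>"
  let ?w = "\<lambda>x. (1 - height F x) * (\<phi> x \<bullet> \<phi> x)"
  have \<phi>2: "\<phi> \<in> poly_fields (int k + 2)" using \<phi> poly_fields_mono[of "int k" "int k + 2"] by auto
  have cont: "continuous_on UNIV (\<lambda>x. \<phi> x \<bullet> \<phi> x)" "continuous_on UNIV ?w"
    by (intro continuous_intros poly_fields_continuous[OF \<phi>] poly_space_continuous[OF height_poly])+
  have regB: "finite_region lborel ?B" by (rule finite_region_lborel) auto
  have NB: "0 \<le> ?NB" by (rule L2_nonneg[OF regB poly_fields_continuous[OF \<phi>]])
  have q: "0 \<le> C / (\<kappa> * h) ^ DIM('a)" using C_pos \<kappa>h(1) by simp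
  have "inner_on (pyr F) \<phi> \<phi> \<le> (C / (\<kappa> * h) ^ DIM('a) * ?NB) * measure lborel (pyr F)"
    unfolding L2_inner_def[of lborel "pyr F"]
    using pyramid_subset[OF F] closure_subset[of T]
    by (intro integral_le_const[OF region_pyramid[OF F] cont(1)] sup_field_ball[OF F \<phi>2]) blast
  also have "\<dots> \<le> (C / (\<kappa> * h) ^ DIM('a) * ?NB) * (unit_ball_vol (real DIM('a)) * h ^ DIM('a))"
    using NB q by (intro mult_left_mono measure_pyramid_le[OF F] mult_nonneg_nonneg)
  also have "\<dots> = (C / (\<kappa> * h) ^ DIM('a) * (unit_ball_vol (real DIM('a)) * h ^ DIM('a))) * ?NB"
    by (simp add: mult_ac)
  also have "\<dots> = volume_const * ?NB" unfolding volume_const_scaled ..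
  also have "?NB \<le> 4 * (LINT x:pyr F|lborel. ?w x)"
  proof -
    have "?NB \<le> (LINT x:pyr F|lborel. 4 * ?w x)"
      unfolding L2_inner_def set_lebesgue_integral_def
    proof (rule integral_mono)
      show "integrable lborel (\<lambda>x. indicator ?B x *\<^sub>R (\<phi> x \<bullet> \<phi> x))"
        using set_integrable_continuous[OF regB cont(1)] by (simp add: set_integrable_def)
      show "integrable lborel (\<lambda>x. indicator (pyr F) x *\<^sub>R (4 * ?w x))"
        using set_integrable_continuous[OF region_pyramid[OF F] continuous_on_mult_left[OF cont(2)], of 4]
        by (simp add: set_integrable_def)
      fix x
      show "indicator ?B x *\<^sub>R (\<phi> x \<bullet> \<phi> x) \<le> indicator (pyr F) x *\<^sub>R (4 * ?w x)"
      proof (cases "x \<in> ?B")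
        case True
        have "1/4 * (\<phi> x \<bullet> \<phi> x) \<le> ?w x"
          using pyramid_ball(3)[OF F True] by (intro mult_right_mono) auto
        then have "\<phi> x \<bullet> \<phi> x \<le> 4 * ?w x" by linarith
        moreover have "indicator ?B x = (1::real)" "indicator (pyr F) x = (1::real)"
          using True pyramid_ball(1)[OF F True] by auto
        ultimately show ?thesis by (simp only: scaleR_one)
      next
        case False
        have "0 \<le> ?w x" if "x \<in> pyr F" using height_nonneg_le_1[OF F that] by simp
        then have "0 \<le> indicator (pyr F) x *\<^sub>R (4 * ?w x)"
          by (cases "x \<in> pyr F") simp_all
        moreover have "indicator ?B x = (0::real)" using False by simp
        ultimately show ?thesis by (simp only: scaleR_zero_left)
      qed
    qed
    then show ?thesis by simp
  qed
  then have "volume_const * ?NB \<le> volume_const * (4 * (LINT x:pyr F|lborel. ?w x))" using consts_pos(1) by (intro mult_left_mono) auto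
  also have "\<dots> = weight_const * inner_on (pyr F) \<phi> (\<lambda>x. (1 - height F x) *\<^sub>R \<phi> x)"
    by (simp add: weight_const_def L2_inner_def)
  finally show ?thesis .
qed

text \<open>The datum on a face, extended to be constant along the normal.\<close>

definition g_ext :: "'a set \<Rightarrow> 'a \<Rightarrow> real" where
  "g_ext F x = g F (x - (\<nu> F \<bullet> x - level F) *\<^sub>R \<nu> F)"

lemma g_ext_face: "F \<in> \<F> \<Longrightarrow> x \<in> F \<Longrightarrow> g_ext F x = g F x"
proof -
  assume "F \<in> \<F>" "x \<in> F"
  then have "\<nu> F \<bullet> x - level F = 0" using face_level[of F x] by (simp add: inner_diff_right)
  then show ?thesis unfolding g_ext_def by simp
qed

lemma g_ext_poly:
  assumes F: "F \<in> \<F>"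
  shows "g_ext F \<in> poly_space (int k + 1)"
  unfolding g_ext_def
proof (rule poly_space_affine[OF g_poly[OF F]])
  fix b :: 'a assume "b \<in> Basis"
  have "(\<lambda>x. x \<bullet> b - (\<nu> F \<bullet> b) * (x \<bullet> \<nu> F - level F)) \<in> poly_space 1"
    by (intro poly_space_diff poly_space_cmult poly_space_inner poly_space_const) simp
  then show "(\<lambda>x. (x - (\<nu> F \<bullet> x - level F) *\<^sub>R \<nu> F) \<bullet> b) \<in> poly_space 1"
    by (simp add: inner_diff_left inner_commute[of "\<nu> F"] mult.commute)
qed

text \<open>The ball around the centre of the disc lies in a cylinder over F, on which the integral of the
  extension is the height times the integral over F.\<close>

lemma g_ext_sup:
  assumes F: "F \<in> \<F>" and x: "x \<in> closure T"
  shows "(g_ext F x)\<^sup>2 \<le> C / (\<kappa> * h) ^ DIM('a) * (2 * (\<kappa> * h) * inner_face F (g F) (g F))"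
proof -
  interpret unit_normal "\<nu> F" by (rule unit_normal_\<nu>[OF F])
  let ?c = "disc_center F" and ?P = "proj (level F)"
  have gP: "g_ext F y = g F (?P y)" for y by (simp add: g_ext_def proj_def)
  have c: "?c \<in> F" by (rule disc_center[OF F])
  have nc: "\<nu> F \<bullet> ?c = level F" using face_level[OF F c] by (simp add: inner_diff_right)
  have gc: "continuous_on UNIV (g F)" by (rule poly_space_continuous[OF g_poly[OF F]])
  have [measurable]: "g F \<in> borel_measurable borel" "F \<in> sets borel"
    using borel_measurable_continuous_onI[OF gc] face_borel[OF F] by auto
  have regB: "finite_region lborel (ball ?c (\<kappa> * h))" by (rule finite_region_lborel) auto
  have near: "?P y \<in> F \<and> \<bar>\<nu> F \<bullet> y - level F\<bar> \<le> \<kappa> * h" if y: "y \<in> ball ?c (\<kappa> * h)" for y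
  proof
    define s where "s = \<nu> F \<bullet> y - level F"
    have s: "s = \<nu> F \<bullet> (y - ?c)" by (simp add: s_def nc inner_diff_right)
    have ny: "norm (y - ?c) < \<kappa> * h" using y by (simp add: dist_norm norm_minus_commute)
    have "\<bar>s\<bar> \<le> norm (y - ?c)"
      unfolding s using Cauchy_Schwarz_ineq2[of "\<nu> F" "y - ?c"] norm_\<nu>[OF F] by simp
    then show "\<bar>\<nu> F \<bullet> y - level F\<bar> \<le> \<kappa> * h" using ny by (simp add: s_def)
    have "?P y - ?c = (y - ?c) - s *\<^sub>R \<nu> F" by (simp add: proj_def s_def)
    then have "(?P y - ?c) \<bullet> (?P y - ?c) = (y - ?c) \<bullet> (y - ?c) - s * s"
      using n_inner_n by (simp only: inner_diff_left[of "y - ?c"] inner_diff_right[of _ "y - ?c"]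
          inner_scaleR_left inner_scaleR_right inner_commute[of "y - ?c" "\<nu> F"] s[symmetric]) simp
    then have "norm (?P y - ?c) \<le> norm (y - ?c)" unfolding norm_eq_sqrt_inner by simp
    also have "\<dots> < \<rho>\<^sup>2 / 2 * h"
      using ny \<kappa>_bounds(3) h_pos mult_right_mono[of \<kappa> "\<rho>\<^sup>2 / 2" h] by linarith
    finally have "?P y \<in> ball ?c (\<rho>\<^sup>2 * h / 2)" by (simp add: dist_norm norm_minus_commute)
    moreover have "?P y \<in> affine hull F"
      using inner_proj[of "level F" y] by (simp add: affine_hull_face[OF F])
    ultimately show "?P y \<in> F" using disc_center(2)[OF F] by blast
  qed
  have "ennreal (inner_on (ball ?c (\<kappa> * h)) (g_ext F) (g_ext F)) =
      (\<integral>\<^sup>+y. ennreal (g_ext F y * g_ext F y) * indicator (ball ?c (\<kappa> * h)) y \<partial>lborel)"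
    unfolding L2_inner_def inner_real_def
    by (rule nn_integral_region[OF regB])
       (auto intro!: continuous_on_mult poly_space_continuous[OF g_ext_poly[OF F]])
  also have "\<dots> \<le> (\<integral>\<^sup>+y. (ennreal (g F (?P y) * g F (?P y)) * indicator F (?P y)) *
      indicator {y. \<bar>\<nu> F \<bullet> y - level F\<bar> \<le> \<kappa> * h} y \<partial>lborel)"
  proof (rule nn_integral_mono)
    fix y
    show "ennreal (g_ext F y * g_ext F y) * indicator (ball ?c (\<kappa> * h)) y \<le>
      (ennreal (g F (?P y) * g F (?P y)) * indicator F (?P y)) *
      indicator {y. \<bar>\<nu> F \<bullet> y - level F\<bar> \<le> \<kappa> * h} y"
      using near[of y] by (cases "y \<in> ball ?c (\<kappa> * h)") (simp_all add: gP)
  qed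
  also have "\<dots> = ennreal (2 * (\<kappa> * h)) * (\<integral>\<^sup>+y. ennreal (g F y * g F y) * indicator F y \<partial>\<mu> (level F))"
    by (rule nn_integral_cylinder[of "\<lambda>y. ennreal (g F y * g F y) * indicator F y"])
       (use \<kappa>h(1) in \<open>measurable, simp\<close>)
  also have "(\<integral>\<^sup>+y. ennreal (g F y * g F y) * indicator F y \<partial>\<mu> (level F)) =
      ennreal (inner_face F (g F) (g F))"
    unfolding L2_inner_def inner_real_def face_measure_eq(1)[OF F, symmetric]
    by (rule nn_integral_region[OF region_face[OF F], symmetric]) (auto intro!: continuous_on_mult gc)
  also have "ennreal (2 * (\<kappa> * h)) * \<dots> = ennreal (2 * (\<kappa> * h) * inner_face F (g F) (g F))"
    using \<kappa>h(1) by (intro ennreal_mult[symmetric] L2_nonneg[OF region_face[OF F] gc]) auto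
  finally have le: "inner_on (ball ?c (\<kappa> * h)) (g_ext F) (g_ext F) \<le> 2 * (\<kappa> * h) * inner_face F (g F) (g F)"
    using \<kappa>h(1) L2_nonneg[OF region_face[OF F] gc] by (subst (asm) ennreal_le_iff) auto
  have "?c \<in> closure T" using c face_in_closure_T[OF F] closure_subset by blast
  then have "dist ?c x \<le> h" using x by (rule dist_closure_le)
  then have "dist ?c x \<le> 2 / (\<rho> ^ 3 / 32) * (\<kappa> * h)" unfolding \<kappa>h(2) using h_pos by simp
  from sup_scalar[OF g_ext_poly[OF F] \<kappa>h(1) this]
  have "(g_ext F x)\<^sup>2 \<le> C / (\<kappa> * h) ^ DIM('a) * inner_on (ball ?c (\<kappa> * h)) (g_ext F) (g_ext F)"
    using \<kappa>h(1) by (simp add: le_divide_eq)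
  also have "\<dots> \<le> C / (\<kappa> * h) ^ DIM('a) * (2 * (\<kappa> * h) * inner_face F (g F) (g F))"
    using C_pos \<kappa>h(1) by (intro mult_left_mono le) auto
  finally show ?thesis .
qed

text \<open>A Raviart--Thomas field whose normal trace on the base is the datum: the position vector from
  the apex has constant normal component on the base.\<close>

definition test_field :: "'a set \<Rightarrow> 'a \<Rightarrow> 'a" where
  "test_field F x = (g_ext F x / \<delta> F) *\<^sub>R (x - a)"

lemma test_field_RT:
  assumes F: "F \<in> \<F>"
  shows "test_field F \<in> RT_space (int k + 1)"
proof (rule RT_spaceI)
  have q: "(\<lambda>x. (1 / \<delta> F) * g_ext F x) \<in> poly_space (int k + 1)"
    by (rule poly_space_cmult[OF g_ext_poly[OF F]])
  then show "(\<lambda>x. (1 / \<delta> F) * g_ext F x) \<in> poly_space (int k + 1)" .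
  show "(\<lambda>x. ((1 / \<delta> F) * g_ext F x) *\<^sub>R (- a)) \<in> poly_fields (int k + 1)"
    using poly_fields_mult[OF q poly_fields_const[of 0 "- a"]] by simp
qed (simp add: test_field_def algebra_simps)

lemma test_field_normal: "F \<in> \<F> \<Longrightarrow> x \<in> F \<Longrightarrow> test_field F x \<bullet> \<nu> F = g F x"
  using face_level[of F x] \<delta>_pos[of F] g_ext_face[of F x]
  by (simp add: test_field_def inner_commute[of _ "\<nu> F"])

lemma test_field_norm:
  assumes F: "F \<in> \<F>"
  shows "inner_on (pyr F) (test_field F) (test_field F) \<le> field_const * h * inner_face F (g F) (g F)"
proof -
  let ?N = "inner_face F (g F) (g F)"
  let ?K = "C / (\<kappa> * h) ^ DIM('a) * (2 * (\<kappa> * h) * ?N) / \<rho>\<^sup>2"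
  have N: "0 \<le> ?N" by (rule L2_nonneg[OF region_face[OF F] poly_space_continuous[OF g_poly[OF F]]])
  have cont: "continuous_on UNIV (test_field F)"
    using test_field_RT[OF F] RT_space_subset_poly_fields poly_fields_continuous by blast
  have K: "0 \<le> ?K" using N C_pos \<kappa>h(1) by simp
  have "inner_on (pyr F) (test_field F) (test_field F) \<le> ?K * measure lborel (pyr F)"
    unfolding L2_inner_def[of lborel]
  proof (rule integral_le_const[OF region_pyramid[OF F] continuous_on_inner[OF cont cont]])
    fix x assume "x \<in> pyr F"
    then have x: "x \<in> closure T" using pyramid_subset[OF F] closure_subset by blast
    have "norm (x - a) \<le> h" using dist_closure_le[OF x a_in_closure_T] by (simp add: dist_norm)
    moreover have "\<rho> * h \<le> \<delta> F" by (rule \<delta>_ge[OF F])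
    ultimately have "norm (x - a) / \<delta> F \<le> h / (\<rho> * h)"
      using \<rho> h_pos by (intro frac_le) auto
    then have n: "norm (x - a) / \<delta> F \<le> 1 / \<rho>" using h_pos by simp
    have "test_field F x \<bullet> test_field F x = (norm (x - a) / \<delta> F)\<^sup>2 * (g_ext F x)\<^sup>2"
      by (simp add: test_field_def dot_square_norm power2_eq_square)
    also have "\<dots> \<le> (1 / \<rho>)\<^sup>2 * (C / (\<kappa> * h) ^ DIM('a) * (2 * (\<kappa> * h) * ?N))"
      using n \<delta>_pos[OF F] by (intro mult_mono power_mono g_ext_sup[OF F x]) auto
    also have "\<dots> = ?K" by (simp add: power_divide)
    finally show "test_field F x \<bullet> test_field F x \<le> ?K" .
  qed
  also have "\<dots> \<le> ?K * (unit_ball_vol (real DIM('a)) * h ^ DIM('a))"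
    by (rule mult_left_mono[OF measure_pyramid_le[OF F] K])
  also have "\<dots> = (C / (\<kappa> * h) ^ DIM('a) * (unit_ball_vol (real DIM('a)) * h ^ DIM('a))) *
      (2 * (\<kappa> * h) * ?N / \<rho>\<^sup>2)" by simp
  also have "\<dots> = field_const * h * ?N" unfolding volume_const_scaled field_const_def by simp
  finally show ?thesis .
qed

abbreviation "Z F \<equiv> inner_on (pyr F) z z"
abbreviation "N F \<equiv> inner_on (pyr F) (lift F) (lift F)"
abbreviation "E F \<equiv> inner_face F (g F) (g F)"

lemma z_poly2: "z \<in> poly_fields (int k + 2)"
  using z_poly poly_fields_mono[of "int k" "int k + 2"] by auto

text \<open>The residual z is its own test field in the consistency identity.\<close>

lemma norm_z_le: "(\<Sum>F\<in>\<F>. Z F) \<le> trace_const / h * (\<Sum>F\<in>\<F>. E F)"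
proof -
  note zc = poly_fields_continuous[OF z_poly]
  have "(\<Sum>F\<in>\<F>. Z F) = (\<Sum>F\<in>\<F>. inner_face F (g F) (\<lambda>x. z x \<bullet> \<nu> F))"
    using consistency_identity[OF z_poly] inner_T_pyramids[OF zc zc] by simp
  then have "2 * (\<Sum>F\<in>\<F>. Z F) = (\<Sum>F\<in>\<F>. 2 * inner_face F (g F) (\<lambda>x. z x \<bullet> \<nu> F))"
    by (simp add: sum_distrib_left)
  also have "\<dots> \<le> (\<Sum>F\<in>\<F>. trace_const / h * E F + Z F)"
  proof (rule sum_mono)
    fix F assume F: "F \<in> \<F>"
    let ?w = "\<lambda>x. z x \<bullet> \<nu> F"
    have p: "0 < trace_const / h" using consts_pos h_pos by simp
    have "2 * \<bar>inner_face F (g F) ?w\<bar> \<le> trace_const / h * E F + inner_face F ?w ?w / (trace_const / h)"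
      by (rule L2_young[OF region_face[OF F] poly_space_continuous[OF g_poly[OF F]]
            poly_space_continuous[OF poly_fields_inner[OF z_poly]] p])
    moreover have "inner_face F ?w ?w / (trace_const / h) \<le> Z F"
      using trace_inequality[OF F z_poly2] p by (simp add: divide_le_eq mult.commute del: divide_divide_eq_right)
    ultimately show "2 * inner_face F (g F) ?w \<le> trace_const / h * E F + Z F" by linarith
  qed
  also have "\<dots> = trace_const / h * (\<Sum>F\<in>\<F>. E F) + (\<Sum>F\<in>\<F>. Z F)"
    by (simp add: sum.distrib sum_distrib_left)
  finally show ?thesis by linarith
qed

text \<open>The lifting is its own test field.\<close>

lemma norm_lift_le:
  assumes F: "F \<in> \<F>"
  shows "N F \<le> 2 * Z F + 2 * (trace_const / h) * E F"
proof -
  note zc = poly_fields_continuous[OF z_poly] and Lc = poly_fields_continuous[OF lift_poly[OF F]]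
  let ?w = "\<lambda>x. lift F x \<bullet> \<nu> F"
  have p: "0 < 2 * (trace_const / h)" using consts_pos h_pos by simp
  have "N F = - inner_on (pyr F) z (lift F) + inner_face F (g F) ?w"
    by (rule lift_eq[OF F lift_RT[OF F]])
  moreover have "2 * \<bar>inner_on (pyr F) z (lift F)\<bar> \<le> 2 * Z F + N F / 2"
    by (rule L2_young[OF region_pyramid[OF F] zc Lc]) simp
  moreover have "2 * \<bar>inner_face F (g F) ?w\<bar> \<le> 2 * (trace_const / h) * E F + inner_face F ?w ?w / (2 * (trace_const / h))"
    by (rule L2_young[OF region_face[OF F] poly_space_continuous[OF g_poly[OF F]]
          poly_space_continuous[OF poly_fields_inner[OF lift_poly[OF F]]] p])
  moreover have "inner_face F ?w ?w / (2 * (trace_const / h)) \<le> N F / 2"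
  proof -
    have "inner_face F ?w ?w \<le> (N F / 2) * (2 * (trace_const / h))"
      using trace_inequality[OF F lift_poly[OF F]] by (simp add: mult.commute)
    then show ?thesis by (subst pos_divide_le_eq[OF p])
  qed
  ultimately show ?thesis by linarith
qed

lemma upper_bound: "inner_on T S S \<le> 4 * trace_const * (\<Sum>F\<in>\<F>. E F / h)"
proof -
  have "inner_on T S S \<le> (\<Sum>F\<in>\<F>. 2 * Z F + 2 * (trace_const / h) * E F)"
    unfolding norm_stab by (intro sum_mono norm_lift_le)
  also have "\<dots> = 2 * (\<Sum>F\<in>\<F>. Z F) + 2 * (trace_const / h * (\<Sum>F\<in>\<F>. E F))"
    by (simp add: sum.distrib sum_distrib_left mult.assoc)
  also have "\<dots> \<le> 4 * (trace_const / h * (\<Sum>F\<in>\<F>. E F))" using norm_z_le by linarith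
  finally show ?thesis by (simp add: sum_divide_distrib[symmetric])
qed

text \<open>The residual times the weight that vanishes on the base is a test field without boundary term.\<close>

lemma residual_le_lift:
  assumes F: "F \<in> \<F>"
  shows "Z F \<le> weight_const\<^sup>2 * N F"
proof -
  let ?\<eta> = "\<lambda>x. (1 - height F x) *\<^sub>R z x"
  have \<eta>: "?\<eta> \<in> poly_fields (int k + 1)"
    using poly_fields_mult[OF poly_space_diff[OF poly_space_const height_poly] z_poly, of 1 F]
    by (simp add: add.commute)
  then have RT: "?\<eta> \<in> RT_space (int k + 1)" using poly_fields_subset_RT_space by blast
  note zc = poly_fields_continuous[OF z_poly] and Lc = poly_fields_continuous[OF lift_poly[OF F]]
    and \<eta>c = poly_fields_continuous[OF \<eta>]
  have "inner_face F (g F) (\<lambda>x. ?\<eta> x \<bullet> \<nu> F) = 0"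
    unfolding L2_inner_def set_lebesgue_integral_def
  proof (rule integral_eq_zero_AE, rule AE_I2)
    fix x
    have "height F x = 1" if "x \<in> F" using height_ray[OF F, of x 1] that closure_subset by auto
    then show "indicator F x *\<^sub>R (g F x \<bullet> (?\<eta> x \<bullet> \<nu> F)) = 0" by (auto simp: indicator_def)
  qed
  then have eq: "inner_on (pyr F) (lift F) ?\<eta> = - inner_on (pyr F) z ?\<eta>" using lift_eq[OF F RT] by simp
  have "inner_on (pyr F) ?\<eta> ?\<eta> \<le> Z F"
    unfolding L2_inner_def set_lebesgue_integral_def
  proof (rule integral_mono)
    show "integrable lborel (\<lambda>x. indicator (pyr F) x *\<^sub>R (?\<eta> x \<bullet> ?\<eta> x))"
      using L2_integrable[OF region_pyramid[OF F] \<eta>c \<eta>c] by (simp add: set_integrable_def)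
    show "integrable lborel (\<lambda>x. indicator (pyr F) x *\<^sub>R (z x \<bullet> z x))"
      using L2_integrable[OF region_pyramid[OF F] zc zc] by (simp add: set_integrable_def)
    fix x
    show "indicator (pyr F) x *\<^sub>R (?\<eta> x \<bullet> ?\<eta> x) \<le> indicator (pyr F) x *\<^sub>R (z x \<bullet> z x)"
    proof (cases "x \<in> pyr F")
      case True
      note b = height_nonneg_le_1[OF F True]
      have "(1 - height F x)\<^sup>2 \<le> 1" using b by (intro power_le_one) auto
      then have "(1 - height F x)\<^sup>2 * (z x \<bullet> z x) \<le> 1 * (z x \<bullet> z x)" by (intro mult_right_mono) auto
      then show ?thesis using True by (simp add: power2_eq_square mult.assoc)
    qed simp
  qed
  moreover have "2 * \<bar>inner_on (pyr F) (lift F) ?\<eta>\<bar> \<le> weight_const * N F + inner_on (pyr F) ?\<eta> ?\<eta> / weight_const"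
    by (rule L2_young[OF region_pyramid[OF F] Lc \<eta>c consts_pos(3)])
  ultimately have "2 * \<bar>inner_on (pyr F) (lift F) ?\<eta>\<bar> \<le> weight_const * N F + Z F / weight_const"
    using consts_pos(3) divide_right_mono[of "inner_on (pyr F) ?\<eta> ?\<eta>" "Z F" weight_const] by linarith
  then have "2 * inner_on (pyr F) z ?\<eta> \<le> weight_const * N F + Z F / weight_const" using eq by linarith
  then have "weight_const * (2 * inner_on (pyr F) z ?\<eta>) \<le> weight_const * (weight_const * N F + Z F / weight_const)"
    using consts_pos(3) by (intro mult_left_mono) auto
  also have "\<dots> = weight_const\<^sup>2 * N F + Z F" using consts_pos(3) by (simp add: field_simps power2_eq_square)
  finally have "2 * (weight_const * inner_on (pyr F) z ?\<eta>) \<le> weight_const\<^sup>2 * N F + Z F" by simp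
  then show ?thesis using weighted_norm[OF F z_poly] by linarith
qed

text \<open>Tested with the field whose normal trace is the datum, the equation of the lifting isolates the norm
  of the datum.\<close>

lemma data_le_lift:
  assumes F: "F \<in> \<F>"
  shows "E F / h \<le> 2 * field_const * (1 + weight_const\<^sup>2) * N F"
proof -
  let ?\<eta> = "test_field F" and ?t = "2 * field_const * h"
  have \<eta>: "?\<eta> \<in> poly_fields (int k + 1 + 1)"
    using test_field_RT[OF F] RT_space_subset_poly_fields by blast
  note zc = poly_fields_continuous[OF z_poly] and Lc = poly_fields_continuous[OF lift_poly[OF F]]
    and \<eta>c = poly_fields_continuous[OF \<eta>]
  let ?H = "inner_on (pyr F) ?\<eta> ?\<eta>"
  have t: "0 < ?t" using consts_pos h_pos by simp
  have "E F = inner_face F (g F) (\<lambda>x. ?\<eta> x \<bullet> \<nu> F)"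
    unfolding L2_inner_def set_lebesgue_integral_def
    by (rule Bochner_Integration.integral_cong) (auto simp: indicator_def test_field_normal[OF F])
  also have "\<dots> = inner_on (pyr F) (lift F) ?\<eta> + inner_on (pyr F) z ?\<eta>"
    using lift_eq[OF F test_field_RT[OF F]] by simp
  finally have eq: "E F = inner_on (pyr F) (lift F) ?\<eta> + inner_on (pyr F) z ?\<eta>" .
  have "2 * \<bar>inner_on (pyr F) (lift F) ?\<eta>\<bar> \<le> ?t * N F + ?H / ?t"
    by (rule L2_young[OF region_pyramid[OF F] Lc \<eta>c t])
  moreover have "2 * \<bar>inner_on (pyr F) z ?\<eta>\<bar> \<le> ?t * Z F + ?H / ?t"
    by (rule L2_young[OF region_pyramid[OF F] zc \<eta>c t])
  moreover have "?H / ?t \<le> E F / 2"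
  proof -
    have "?H \<le> (E F / 2) * ?t" using test_field_norm[OF F] by (simp add: mult_ac)
    then show ?thesis by (subst pos_divide_le_eq[OF t])
  qed
  ultimately have "E F \<le> ?t * N F + ?t * Z F" using eq by linarith
  also have "\<dots> \<le> ?t * N F + ?t * (weight_const\<^sup>2 * N F)"
    using residual_le_lift[OF F] t by (intro add_mono mult_left_mono) auto
  also have "\<dots> = (2 * field_const * (1 + weight_const\<^sup>2) * N F) * h" by (simp add: algebra_simps)
  finally show ?thesis using h_pos by (simp add: divide_le_eq)
qed

lemma lower_bound: "(\<Sum>F\<in>\<F>. E F / h) \<le> 2 * field_const * (1 + weight_const\<^sup>2) * inner_on T S S"
  unfolding norm_stab sum_distrib_left by (intro sum_mono data_le_lift)

lemma face_size_le: "F \<in> \<F> \<Longrightarrow> face_size T F \<le> h"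
proof -
  assume F: "F \<in> \<F>"
  have "diameter F \<le> h"
    using face_simplex(4)[OF F] dist_closure_le face_in_closure_T[OF F] closure_subset[of F]
    by (intro diameter_le) (auto simp: dist_norm subset_iff)
  then show ?thesis by (simp add: face_size_def h_def)
qed

text \<open>A face of dimension at least one contains a radius of its disc; in dimension one the size is that of
  the element.\<close>

lemma face_size_ge:
  assumes F: "F \<in> \<F>"
  shows "\<rho>\<^sup>2 / 4 * h \<le> face_size T F"
proof (cases "DIM('a) = 1")
  case True
  have "\<rho>\<^sup>2 / 4 * h \<le> 1 * h" using \<rho> h_pos power_le_one[of \<rho> 2] by (intro mult_right_mono) auto
  then show ?thesis using True by (simp add: face_size_def h_def)
next
  case False
  then have "2 \<le> DIM('a)" using DIM_positive[where 'a='a] by linarith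
  then obtain y where y: "y \<noteq> 0" "orthogonal (\<nu> F) y" by (rule orthogonal_to_vector_exists)
  let ?c = "disc_center F" and ?s = "\<rho>\<^sup>2 / 4 * h"
  have c: "?c \<in> F" by (rule disc_center[OF F])
  have s: "0 < ?s" using \<rho> h_pos by simp
  define x where "x = ?c + (?s / norm y) *\<^sub>R y"
  have d: "dist ?c x = ?s" using y(1) s by (simp add: x_def dist_norm)
  have "\<nu> F \<bullet> x = level F"
    using y(2) face_level[OF F c] by (simp add: x_def inner_add_right orthogonal_def inner_diff_right)
  moreover have "x \<in> ball ?c (\<rho>\<^sup>2 * h / 2)" using d s by simp
  ultimately have "x \<in> F" using disc_center(2)[OF F] affine_hull_face[OF F] by blast
  then have "dist ?c x \<le> diameter F"
    using c bounded_face[OF F] bounded_subset[OF _ closure_subset]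
    by (intro diameter_bounded_bound) blast
  then show ?thesis using d False by (simp add: face_size_def)
qed

lemma seminorm_sq: "(boundary_seminorm k l \<omega> T \<F> v)\<^sup>2 = (\<Sum>F\<in>\<F>. inverse (face_size T F) * E F)"
proof -
  have E: "0 \<le> E F" if "F \<in> \<F>" for F
    by (rule L2_nonneg[OF region_face[OF that] poly_space_continuous[OF g_poly[OF that]]])
  have pos: "0 < face_size T F" if "F \<in> \<F>" for F
  proof -
    have "0 < \<rho>\<^sup>2 / 4 * h" using \<rho> h_pos by simp
    then show ?thesis using face_size_ge[OF that] by linarith
  qed
  have "boundary_seminorm k l \<omega> T \<F> v = sqrt (\<Sum>F\<in>\<F>. inverse (face_size T F) * E F)"
    unfolding boundary_seminorm_def L2_norm_on_def g_def[symmetric]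
    using E by (intro arg_cong[where f=sqrt] sum.cong refl) simp
  moreover have "0 \<le> (\<Sum>F\<in>\<F>. inverse (face_size T F) * E F)"
    using E pos by (intro sum_nonneg mult_nonneg_nonneg) (auto simp: less_imp_le)
  ultimately show ?thesis by simp
qed

lemma seminorm_bounds:
  shows seminorm_lower: "(\<Sum>F\<in>\<F>. E F / h) \<le> (boundary_seminorm k l \<omega> T \<F> v)\<^sup>2"
    and seminorm_upper: "(boundary_seminorm k l \<omega> T \<F> v)\<^sup>2 \<le> 4 / \<rho>\<^sup>2 * (\<Sum>F\<in>\<F>. E F / h)"
proof -
  have E: "0 \<le> E F" if "F \<in> \<F>" for F
    by (rule L2_nonneg[OF region_face[OF that] poly_space_continuous[OF g_poly[OF that]]])
  have low: "0 < \<rho>\<^sup>2 / 4 * h" using \<rho> h_pos by simp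
  have i1: "inverse h \<le> inverse (face_size T F)" if "F \<in> \<F>" for F
    using face_size_le[OF that] face_size_ge[OF that] low by (intro le_imp_inverse_le) linarith+
  have i2: "inverse (face_size T F) \<le> inverse (\<rho>\<^sup>2 / 4 * h)" if "F \<in> \<F>" for F
    using face_size_ge[OF that] low by (intro le_imp_inverse_le) linarith+
  show "(\<Sum>F\<in>\<F>. E F / h) \<le> (boundary_seminorm k l \<omega> T \<F> v)\<^sup>2"
    unfolding seminorm_sq divide_inverse using i1 E
    by (intro sum_mono) (subst mult.commute, intro mult_right_mono, auto)
  have "(boundary_seminorm k l \<omega> T \<F> v)\<^sup>2 \<le> (\<Sum>F\<in>\<F>. inverse (\<rho>\<^sup>2 / 4 * h) * E F)"
    unfolding seminorm_sq by (intro sum_mono mult_right_mono i2 E)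
  also have "\<dots> = 4 / \<rho>\<^sup>2 * (\<Sum>F\<in>\<F>. E F / h)"
  proof -
    have "inverse (\<rho>\<^sup>2 / 4 * h) * e = 4 / \<rho>\<^sup>2 * (e / h)" for e
      using \<rho> h_pos by (simp add: field_simps)
    then show ?thesis by (simp only: sum_distrib_left)
  qed
  finally show "(boundary_seminorm k l \<omega> T \<F> v)\<^sup>2 \<le> 4 / \<rho>\<^sup>2 * (\<Sum>F\<in>\<F>. E F / h)" .
qed

lemma stability:
  shows "(boundary_seminorm k l \<omega> T \<F> v)\<^sup>2 \<le> 8 * field_const * (1 + weight_const\<^sup>2) / \<rho>\<^sup>2 * inner_on T S S"
    and "inner_on T S S \<le> 4 * trace_const * (boundary_seminorm k l \<omega> T \<F> v)\<^sup>2"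
proof -
  have "(boundary_seminorm k l \<omega> T \<F> v)\<^sup>2 \<le> 4 / \<rho>\<^sup>2 * (\<Sum>F\<in>\<F>. E F / h)" by (rule seminorm_upper)
  also have "\<dots> \<le> 4 / \<rho>\<^sup>2 * (2 * field_const * (1 + weight_const\<^sup>2) * inner_on T S S)"
    by (intro mult_left_mono lower_bound) simp
  finally show "(boundary_seminorm k l \<omega> T \<F> v)\<^sup>2 \<le> 8 * field_const * (1 + weight_const\<^sup>2) / \<rho>\<^sup>2 * inner_on T S S"
    by (simp add: mult.assoc)
  have "inner_on T S S \<le> 4 * trace_const * (\<Sum>F\<in>\<F>. E F / h)" by (rule upper_bound)
  also have "\<dots> \<le> 4 * trace_const * (boundary_seminorm k l \<omega> T \<F> v)\<^sup>2"
    using consts_pos by (intro mult_left_mono seminorm_lower) simp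
  finally show "inner_on T S S \<le> 4 * trace_const * (boundary_seminorm k l \<omega> T \<F> v)\<^sup>2" .
qed

end

section \<open>The three properties\<close>

context star_polytope
begin

text \<open>The closed pyramid is a simplex, spanned by the apex and the vertices of the face.\<close>

lemma pyramid_open_polytope:
  assumes F: "F \<in> \<F>"
  shows "open_polytope (pyr F)"
proof -
  obtain B where B: "\<not> affine_dependent B" "int (card B) = int DIM('a)" "closure F = convex hull B"
    using face_simplex(1)[OF F] unfolding simplex_def by auto
  have "affine hull B = affine hull F"
    using B(3) by (metis affine_hull_convex_hull closure_same_affine_hull)
  moreover have "a \<notin> affine hull F"
    using affine_hull_face[OF F] \<delta>_pos[OF F] by simp
  ultimately have off: "a \<notin> affine hull B" by simp
  have "\<not> affine_dependent (insert a B)" by (rule affine_independent_insert[OF B(1) off])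
  moreover have "int (card (insert a B)) = int DIM('a) + 1"
    using off hull_subset[of B affine] B(2) aff_independent_finite[OF B(1)] by (subst card_insert_disjoint) auto
  moreover have "convex hull (insert a (closure F)) = convex hull (insert a B)"
    unfolding B(3) by (rule hull_insert[symmetric])
  ultimately have "int DIM('a) simplex (convex hull (insert a (closure F)))"
    unfolding simplex_def by (intro exI[of _ "insert a B"]) simp
  moreover have "pyr F = interior (convex hull (insert a (closure F)))"
  proof -
    have "interior (closure (pyr F)) = interior (pyr F)" by (rule convex_interior_closure[OF convex_pyramid])
    then show ?thesis using open_pyramid by (simp add: closure_pyramid_hull[OF F] interior_open)
  qed
  ultimately have "\<exists>K. finite K \<and> (\<forall>S\<in>K. int DIM('a) simplex S) \<and> pyr F = interior (\<Union>K)"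
    by (intro exI[of _ "{convex hull (insert a (closure F))}"]) simp
  then show ?thesis
    unfolding open_polytope_def
    using pyramid_nonempty[OF F] convex_connected[OF convex_pyramid] by blast
qed

lemma pyramid_partition: "polytopal_partition (pyr ` \<F>) T"
  unfolding polytopal_partition_def
  using finite_faces pyramids_disjoint pyramid_open_polytope pyramid_subset closure_T_cover
  by (auto simp: pairwise_def disjnt_def)

end

context regular_element
begin

lemma pyramid_regular:
  assumes F: "F \<in> \<F>"
  shows "\<rho> ^ 3 / 32 * diameter (pyr F) \<le> inradius (pyr F)" "\<rho> * diameter T \<le> diameter (pyr F)"
proof -
  have "diameter (pyr F) \<le> h"
    unfolding h_def by (rule diameter_subset[OF pyramid_subset[OF F] bounded_T])
  then have "\<rho> ^ 3 / 32 * diameter (pyr F) \<le> \<kappa> * h"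
    unfolding \<kappa>_def using \<rho> by (intro mult_left_mono) auto
  also have "\<kappa> * h \<le> inradius (pyr F)"
    using pyramid_ball(1)[OF F] by (intro inradius_ge[OF _ bounded_pyramid[OF F]]) blast
  finally show "\<rho> ^ 3 / 32 * diameter (pyr F) \<le> inradius (pyr F)" .
  let ?y = "disc_center F"
  have y: "?y \<in> F" by (rule disc_center[OF F])
  have "\<rho> * h \<le> \<delta> F" by (rule \<delta>_ge[OF F])
  also have "\<dots> = \<nu> F \<bullet> (?y - a)" using face_level[OF F y] by simp
  also have "\<dots> \<le> dist a ?y"
    using norm_cauchy_schwarz[of "\<nu> F" "?y - a"] norm_\<nu>[OF F] by (simp add: dist_norm norm_minus_commute)
  also have "\<dots> \<le> diameter (closure (pyr F))"
  proof (rule diameter_bounded_bound[OF bounded_closure[OF bounded_pyramid[OF F]]])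
    have "a + t *\<^sub>R (?y - a) \<in> closure (pyr F)" if "0 \<le> t" "t \<le> 1" for t
      unfolding closure_pyramid[OF F] using that y closure_subset by blast
    from this[of 0] this[of 1] show "a \<in> closure (pyr F)" "?y \<in> closure (pyr F)" by simp_all
  qed
  also have "\<dots> = diameter (pyr F)" by (rule diameter_closure[OF bounded_pyramid[OF F]])
  finally show "\<rho> * diameter T \<le> diameter (pyr F)" by (simp add: h_def)
qed

end

theorem proposition14:
  fixes k :: nat and l :: int and \<rho> p :: real
  assumes "0 < \<rho>" and "\<rho> < 1"
    and "1 < p"
    and "l \<in> {int k - 1, int k, int k + 1}"
  shows "\<exists>(C::real) (k\<^sub>S::nat) (\<rho>\<^sub>S::real). 0 < C \<and> 0 < \<rho>\<^sub>S \<and> \<rho>\<^sub>S \<le> \<rho> \<and>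
    (\<forall>(\<Omega> :: 'a::euclidean_space set) \<T>\<^sub>h \<F>\<^sub>h \<F> T x\<^sub>T \<omega>.
       polytopal_mesh \<Omega> \<T>\<^sub>h \<F>\<^sub>h \<F> \<and> regular_mesh \<rho> \<Omega> \<T>\<^sub>h \<F>\<^sub>h \<and> T \<in> \<T>\<^sub>h \<and>
       (\<forall>F\<in>\<F> T. \<exists>S. (int DIM('a) - 1) simplex S \<and> F = rel_interior S) \<and>
       star_shaped T x\<^sub>T \<and>
       (\<forall>F\<in>\<F> T. \<rho> * diameter T \<le> infdist x\<^sub>T (affine hull F)) \<and>
       (l = -1 \<longrightarrow> admissible_weights T (\<F> T) \<omega>)
     \<longrightarrow>
       (\<forall>v\<in>local_space k l (\<F> T).
          C * boundary_seminorm k l \<omega> T (\<F> T) v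
            \<le> L2_norm_on lborel T (stab k l \<omega> T (\<F> T) x\<^sub>T v) \<and>
          L2_norm_on lborel T (stab k l \<omega> T (\<F> T) x\<^sub>T v)
            \<le> inverse C * boundary_seminorm k l \<omega> T (\<F> T) v) \<and>
       (\<forall>v\<in>local_space k l (\<F> T). \<forall>\<phi>\<in>poly_fields (int k).
          inner_on T (stab k l \<omega> T (\<F> T) x\<^sub>T v) \<phi> = 0) \<and>
       (p \<noteq> 2 \<longrightarrow>
          (\<exists>\<P>. polytopal_partition \<P> T \<and>
             (\<forall>P\<in>\<P>. \<rho>\<^sub>S * diameter P \<le> inradius P \<and> \<rho> * diameter T \<le> diameter P) \<and>
             (\<forall>v\<in>local_space k l (\<F> T). \<forall>P\<in>\<P>.
                \<exists>q\<in>poly_fields (int k\<^sub>S). \<forall>x\<in>P. stab k l \<omega> T (\<F> T) x\<^sub>T v x = q x))))"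
proof -
  \<comment> \<open>the ratio of the radii \<open>2 * h\<close> and \<open>\<kappa> * h\<close>\<close>
  define R where "R = 2 / (\<rho> ^ 3 / 32)"
  obtain C where C: "0 < C" "\<And>\<phi> c r x. \<phi> \<in> (poly_fields (int k + 2) :: ('a \<Rightarrow> 'a) set) \<Longrightarrow> 0 < r \<Longrightarrow>
      dist c x \<le> R * r \<Longrightarrow> (\<phi> x \<bullet> \<phi> x) * r ^ DIM('a) \<le> C * inner_on (ball c r) \<phi> \<phi>"
    using poly_fields_sup_bound[of "int k + 2" R] by metis
  obtain C' where C': "0 < C'" "\<And>q c r x. q \<in> (poly_space (int k + 1) :: ('a \<Rightarrow> real) set) \<Longrightarrow> 0 < r \<Longrightarrow>
      dist c x \<le> R * r \<Longrightarrow> (q x)\<^sup>2 * r ^ DIM('a) \<le> C' * inner_on (ball c r) q q"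
    using poly_space_sup_bound[of "int k + 1" R] by metis
  \<comment> \<open>one constant for vector and scalar polynomials\<close>
  define D where "D = C + C'"
  \<comment> \<open>the constants of the stability estimates, which do not depend on the element\<close>
  define A where "A = D * unit_ball_vol (real DIM('a)) / (\<rho> ^ 3 / 32) ^ DIM('a)"
  define c2 where "c2 = real DIM('a) * A / \<rho>"
  define c3 where "c3 = 4 * A"
  define c4 where "c4 = 2 * (\<rho> ^ 3 / 32) * A / \<rho>\<^sup>2"
  define K where "K = 4 * c2 + 8 * c4 * (1 + c3\<^sup>2) / \<rho>\<^sup>2"
  have D: "0 < D" using C(1) C'(1) by (simp add: D_def)
  have pos: "0 < A" "0 < c2" "0 < c4"
    using D assms(1) by (auto simp: A_def c2_def c4_def)
  have c4_term: "0 < 8 * c4 * (1 + c3\<^sup>2) / \<rho>\<^sup>2"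
    using pos assms(1) by (intro divide_pos_pos mult_pos_pos add_pos_nonneg) auto
  then have K: "0 < K" using pos by (simp add: K_def)
  have main: "(\<forall>v\<in>local_space k l (\<F> T).
          (1 / sqrt K) * boundary_seminorm k l \<omega> T (\<F> T) v
            \<le> L2_norm_on lborel T (stab k l \<omega> T (\<F> T) x\<^sub>T v) \<and>
          L2_norm_on lborel T (stab k l \<omega> T (\<F> T) x\<^sub>T v)
            \<le> inverse (1 / sqrt K) * boundary_seminorm k l \<omega> T (\<F> T) v) \<and>
       (\<forall>v\<in>local_space k l (\<F> T). \<forall>\<phi>\<in>poly_fields (int k).
          inner_on T (stab k l \<omega> T (\<F> T) x\<^sub>T v) \<phi> = 0) \<and>
       (p \<noteq> 2 \<longrightarrow>
          (\<exists>\<P>. polytopal_partition \<P> T \<and>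
             (\<forall>P\<in>\<P>. \<rho> ^ 3 / 32 * diameter P \<le> inradius P \<and> \<rho> * diameter T \<le> diameter P) \<and>
             (\<forall>v\<in>local_space k l (\<F> T). \<forall>P\<in>\<P>.
                \<exists>q\<in>poly_fields (int (k + 2)). \<forall>x\<in>P. stab k l \<omega> T (\<F> T) x\<^sub>T v x = q x)))"
    if mesh: "polytopal_mesh \<Omega> \<T>\<^sub>h \<F>\<^sub>h \<F>" "regular_mesh \<rho> \<Omega> \<T>\<^sub>h \<F>\<^sub>h" "T \<in> \<T>\<^sub>h"
      "\<forall>F\<in>\<F> T. \<exists>S. (int DIM('a) - 1) simplex S \<and> F = rel_interior S" "star_shaped T x\<^sub>T"
      "\<forall>F\<in>\<F> T. \<rho> * diameter T \<le> infdist x\<^sub>T (affine hull F)"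
    for \<Omega> T :: "'a set" and \<T>\<^sub>h \<F>\<^sub>h \<F> x\<^sub>T \<omega>
  proof -
    interpret E: regular_element T "\<F> T" x\<^sub>T \<rho> "diameter T"
      by (rule regular_element_of_mesh[OF assms(1,2) mesh])
    have hho: "hho_regular T (\<F> T) x\<^sub>T \<rho> (diameter T) k l v D" if v: "v \<in> local_space k l (\<F> T)" for v
    proof
      show "l \<in> {int k - 1, int k, int k + 1}" by (rule assms(4))
      show "v \<in> local_space k l (\<F> T)" by (rule v)
      show "0 < D" by (rule D)
      fix c x :: 'a and r :: real
      assume r: "0 < r" "dist c x \<le> 2 / (\<rho> ^ 3 / 32) * r"
      have reg: "finite_region lborel (ball c r)" by (rule finite_region_lborel) auto
      show "(\<phi> x \<bullet> \<phi> x) * r ^ DIM('a) \<le> D * inner_on (ball c r) \<phi> \<phi>"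
        if "\<phi> \<in> poly_fields (int k + 2)" for \<phi> :: "'a \<Rightarrow> 'a"
        using C(2)[OF that r(1), of c x] r(2) C'(1) L2_nonneg[OF reg poly_fields_continuous[OF that]]
        by (simp add: D_def R_def distrib_right add_increasing2)
      show "(q x)\<^sup>2 * r ^ DIM('a) \<le> D * inner_on (ball c r) q q"
        if "q \<in> poly_space (int k + 1)" for q :: "'a \<Rightarrow> real"
        using C'(2)[OF that r(1), of c x] r(2) C(1) L2_nonneg[OF reg poly_space_continuous[OF that]]
        by (simp add: D_def R_def distrib_right add_increasing)
    qed
    have S1: "(1 / sqrt K) * boundary_seminorm k l \<omega> T (\<F> T) v
            \<le> L2_norm_on lborel T (stab k l \<omega> T (\<F> T) x\<^sub>T v) \<and>
          L2_norm_on lborel T (stab k l \<omega> T (\<F> T) x\<^sub>T v)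
            \<le> inverse (1 / sqrt K) * boundary_seminorm k l \<omega> T (\<F> T) v"
      if v: "v \<in> local_space k l (\<F> T)" for v
    proof -
      interpret H: hho_regular T "\<F> T" x\<^sub>T \<rho> "diameter T" k l \<omega> v D by (rule hho[OF v])
      let ?b = "boundary_seminorm k l \<omega> T (\<F> T) v" and ?s = "inner_on T (stab k l \<omega> T (\<F> T) x\<^sub>T v) (stab k l \<omega> T (\<F> T) x\<^sub>T v)"
      have ceq: "H.trace_const = c2" "H.weight_const = c3" "H.field_const = c4"
        by (simp_all add: H.trace_const_def H.weight_const_def H.field_const_def H.volume_const_def E.\<kappa>_def c2_def c3_def c4_def A_def)
      have s0: "0 \<le> ?s"
        unfolding L2_inner_def set_lebesgue_integral_def by (intro integral_nonneg_AE) auto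
      have "?b\<^sup>2 \<le> 8 * c4 * (1 + c3\<^sup>2) / \<rho>\<^sup>2 * ?s" using H.stability(1) unfolding ceq .
      also have "\<dots> \<le> K * ?s" using pos s0 by (intro mult_right_mono) (auto simp: K_def)
      finally have b: "?b\<^sup>2 \<le> K * ?s" .
      have "?s \<le> 4 * c2 * ?b\<^sup>2" using H.stability(2) unfolding ceq .
      also have "\<dots> \<le> K * ?b\<^sup>2" using c4_term by (intro mult_right_mono) (auto simp: K_def)
      finally have s: "?s \<le> K * ?b\<^sup>2" .
      have "?b \<le> sqrt (K * ?s)" by (rule real_le_rsqrt[OF b])
      then have "?b \<le> sqrt K * sqrt ?s" by (simp add: real_sqrt_mult)
      then have "(1 / sqrt K) * ?b \<le> sqrt ?s" using K by (simp add: divide_le_eq mult.commute)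
      moreover have b0: "0 \<le> ?b"
        unfolding boundary_seminorm_def
        using H.face_size_ge E.h_pos assms(1)
        by (intro real_sqrt_ge_zero sum_nonneg mult_nonneg_nonneg)
           (auto intro!: less_imp_le[OF less_le_trans[OF _ H.face_size_ge]])
      moreover have "sqrt ?s \<le> sqrt (K * ?b\<^sup>2)" using s by (rule real_sqrt_le_mono)
      then have "sqrt ?s \<le> inverse (1 / sqrt K) * ?b" using b0 by (simp add: real_sqrt_mult)
      ultimately show ?thesis by (simp add: L2_norm_on_def)
    qed
    have S2: "inner_on T (stab k l \<omega> T (\<F> T) x\<^sub>T v) \<phi> = 0"
      if v: "v \<in> local_space k l (\<F> T)" and \<phi>: "\<phi> \<in> poly_fields (int k)" for v \<phi>
    proof -
      interpret H: hho_regular T "\<F> T" x\<^sub>T \<rho> "diameter T" k l \<omega> v D by (rule hho[OF v])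
      show ?thesis by (rule H.stab_orthogonal[OF \<phi>])
    qed
    have S3: "\<exists>q\<in>poly_fields (int (k + 2)). \<forall>x\<in>pyramid x\<^sub>T F. stab k l \<omega> T (\<F> T) x\<^sub>T v x = q x"
      if v: "v \<in> local_space k l (\<F> T)" and F: "F \<in> \<F> T" for v F
    proof -
      interpret H: hho_regular T "\<F> T" x\<^sub>T \<rho> "diameter T" k l \<omega> v D by (rule hho[OF v])
      have "H.lift F \<in> poly_fields (int (k + 2))"
        using H.lift_poly[OF F] by (simp only: of_nat_add of_nat_numeral)
      then show ?thesis using H.stab_pyramid[OF F] by (intro bexI[of _ "H.lift F"] ballI)
    qed
    show ?thesis
      using S1 S2 S3 E.pyramid_partition E.pyramid_regular
      by (intro conjI ballI impI exI[of _ "pyramid x\<^sub>T ` \<F> T"]) auto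
  qed
  have "\<rho> ^ 3 / 32 \<le> \<rho>"
  proof -
    have "\<rho> ^ 3 \<le> \<rho> ^ 1" using assms by (intro power_decreasing) auto
    then show ?thesis using assms(1) by simp
  qed
  then show ?thesis
    using K assms(1) main
    by (intro exI[of _ "1 / sqrt K"] exI[of _ "k + 2"] exI[of _ "\<rho> ^ 3 / 32"] conjI allI impI) auto
qed

end
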